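(* Let $f$ be an indecomposable finite character on the infinite symmetric inverse semigroup $R_\infty$. Then the restriction of $f$ to the subgroup $\mathfrak{S}_\infty\subset R_\infty$ is an indecomposable finite character of $\mathfrak{S}_\infty$. Consequently, with $\alpha=\{\alpha_1\geq\alpha_2\geq\ldots>0\}$ and $\beta=\{\beta_1\geq\beta_2\geq\ldots>0\}$ the corresponding Thoma parameters, for every $s\in\mathfrak{S}_\infty$ with cycle decomposition $s=c_1\cdot c_2\cdots c_k$ into disjoint cycles $c_j$ of lengths $l(c_j)>1$ one has $$f(c_j)=\sum_i\alpha_i^{l(c_j)}+(-1)^{l(c_j)-1}\sum_i\beta_i^{l(c_j)}\quad\text{and}\quad f(s)=\prod_{j=1}^kf(c_j).$$
   Context: $R_\infty$ is the semigroup (under matrix multiplication) of all infinite 0-1 matrices $[r_{ij}]_{i,j\in\mathbb{N}}$ with at most one entry 1 in each row and each column and such that $r_{nn}=1$ for all sufficiently large $n$. Its involution is transposition, $[r_{ij}]^\star=[r_{ji}]$ (also written $r^*$). The group $\mathfrak{S}_\infty$ of finitely supported permutations of $\mathbb{N}$ is the subgroup of permutation matrices in $R_\infty$ (on which $r^*=r^{-1}$). For $G=R_\infty$ or $G=\mathfrak{S}_\infty$, an indecomposable finite character on $G$ is a function $f:G\to\mathbb{C}$ that is (1) central: $f(rs)=f(sr)$ for all $r,s\in G$; (2) positive definite: for all $r_1,\ldots,r_n\in G$ the matrix $[f(r_i^*r_j)]$ is Hermitian and non-negative definite; (3) indecomposable: not a sum of two linearly independent functions satisfying (1) and (2); (4)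 normalized: $f(e)=1$, where $e$ is the identity. Thoma's theorem: indecomposable finite characters of $\mathfrak{S}_\infty$ are in bijection with pairs of (finite or infinite, possibly empty) non-increasing sequences $\alpha,\beta$ of positive numbers with $\sum_i\alpha_i+\sum_i\beta_i\leq1$ (the Thoma parameters); the corresponding character takes the value $\sum_i\alpha_i^{l}+(-1)^{l-1}\sum_i\beta_i^{l}$ on a cycle of length $l>1$ and is multiplicative over disjoint cycles. *)

theory Defs
  imports Complex_Main "HOL-Combinatorics.Cycles"
begin

type_synonym inf_matrix = "nat \<Rightarrow> nat \<Rightarrow> nat"

(* The sum over the support of row i agrees with the full sum over k whenever
   that row has finitely many non-zero entries, as all rows in R_inf do. *)
definition mat_mult :: "inf_matrix \<Rightarrow> inf_matrix \<Rightarrow> inf_matrix"  (infixl "\<odot>" 70)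
  where "r \<odot> s = (\<lambda>i j. \<Sum>k | r i k \<noteq> 0. r i k * s k j)"

definition mat_one :: inf_matrix
  where "mat_one = (\<lambda>i j. if i = j then 1 else 0)"

definition mat_star :: "inf_matrix \<Rightarrow> inf_matrix"
  where "mat_star r = (\<lambda>i j. r j i)"

definition R_inf :: "inf_matrix set"
  where "R_inf = {r.
    (\<forall>i j. r i j \<in> {0, 1}) \<and>
    (\<forall>i j k. r i j = 1 \<and> r i k = 1 \<longrightarrow> j = k) \<and>
    (\<forall>i j k. r i k = 1 \<and> r j k = 1 \<longrightarrow> i = j) \<and>
    (\<exists>N. \<forall>n\<ge>N. r n n = 1)}"

(* Column j carries its entry 1 in row p j, so that composition of permutations
   corresponds to matrix multiplication. *)
definition perm_matrix :: "(nat \<Rightarrow> nat) \<Rightarrow> inf_matrix"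
  where "perm_matrix p = (\<lambda>i j. if i = p j then 1 else 0)"

definition S_inf :: "inf_matrix set"
  where "S_inf = perm_matrix ` {p. bij p \<and> finite {i. p i \<noteq> i}}"

(* The following notions depend only on the values of f on G: a function on G is
   represented by any function on all matrices that extends it, and restricting f
   to a subset H of G amounts to replacing G by H. *)

definition central_on :: "inf_matrix set \<Rightarrow> (inf_matrix \<Rightarrow> complex) \<Rightarrow> bool"
  where "central_on G f \<longleftrightarrow> (\<forall>r\<in>G. \<forall>s\<in>G. f (r \<odot> s) = f (s \<odot> r))"

definition hermitian_nonneg_definite :: "nat \<Rightarrow> (nat \<Rightarrow> nat \<Rightarrow> complex) \<Rightarrow> bool"
  where "hermitian_nonneg_definite n A \<longleftrightarrow>
    (\<forall>i<n. \<forall>j<n. A j i = cnj (A i j)) \<and>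
    (\<forall>z. (\<Sum>i<n. \<Sum>j<n. cnj (z i) * A i j * z j) \<in> \<real> \<and>
         0 \<le> Re (\<Sum>i<n. \<Sum>j<n. cnj (z i) * A i j * z j))"

definition positive_definite_on :: "inf_matrix set \<Rightarrow> (inf_matrix \<Rightarrow> complex) \<Rightarrow> bool"
  where "positive_definite_on G f \<longleftrightarrow>
    (\<forall>n r. (\<forall>i<n. r i \<in> G) \<longrightarrow>
      hermitian_nonneg_definite n (\<lambda>i j. f (mat_star (r i) \<odot> r j)))"

definition linearly_independent_on ::
    "inf_matrix set \<Rightarrow> (inf_matrix \<Rightarrow> complex) \<Rightarrow> (inf_matrix \<Rightarrow> complex) \<Rightarrow> bool"
  where "linearly_independent_on G g h \<longleftrightarrow>
    (\<forall>a b. (\<forall>r\<in>G. a * g r + b * h r = 0) \<longrightarrow> a = 0 \<and> b = 0)"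

definition indecomposable_on :: "inf_matrix set \<Rightarrow> (inf_matrix \<Rightarrow> complex) \<Rightarrow> bool"
  where "indecomposable_on G f \<longleftrightarrow>
    \<not> (\<exists>g h. central_on G g \<and> positive_definite_on G g \<and>
             central_on G h \<and> positive_definite_on G h \<and>
             linearly_independent_on G g h \<and>
             (\<forall>r\<in>G. f r = g r + h r))"

definition indecomposable_character :: "inf_matrix set \<Rightarrow> (inf_matrix \<Rightarrow> complex) \<Rightarrow> bool"
  where "indecomposable_character G f \<longleftrightarrow>
    central_on G f \<and> positive_definite_on G f \<and> indecomposable_on G f \<and> f mat_one = 1"

(* A finite (possibly empty) sequence of positive numbers is padded with zeros.
   Since zeros can only occur at the end of a non-increasing non-negative sequence,
   this encodes the finite and infinite positive sequences bijectively; the padding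
   contributes nothing to the sums of l-th powers for l > 1. *)
definition thoma_parameters :: "(nat \<Rightarrow> real) \<Rightarrow> (nat \<Rightarrow> real) \<Rightarrow> bool"
  where "thoma_parameters \<alpha> \<beta> \<longleftrightarrow>
    (\<forall>i. 0 \<le> \<alpha> i) \<and> (\<forall>i. 0 \<le> \<beta> i) \<and> decseq \<alpha> \<and> decseq \<beta> \<and>
    summable \<alpha> \<and> summable \<beta> \<and> (\<Sum>i. \<alpha> i) + (\<Sum>i. \<beta> i) \<le> 1"

(* The list [a, b, c] stands for the cycle sending a to b, b to c and c to a. *)
definition cycle_matrix :: "nat list \<Rightarrow> inf_matrix"
  where "cycle_matrix c = perm_matrix (cycle_of_list c)"

definition cycle_decomposition :: "nat list list \<Rightarrow> inf_matrix \<Rightarrow> bool"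
  where "cycle_decomposition cs s \<longleftrightarrow>
    (\<forall>c\<in>set cs. 1 < length c) \<and> distinct (concat cs) \<and>
    s = foldr (\<odot>) (map cycle_matrix cs) mat_one"

lemma perm_matrix_id: "perm_matrix id = mat_one"
  by (simp add: perm_matrix_def mat_one_def)

lemma perm_matrix_comp:
  assumes "bij p"
  shows "perm_matrix (p \<circ> q) = perm_matrix p \<odot> perm_matrix q"
proof (intro ext)
  fix i j
  have "{k. perm_matrix p i k \<noteq> 0} = {inv p i}"
    using assms by (auto simp: perm_matrix_def bij_is_inj bij_is_surj surj_f_inv_f)
  moreover have "i = p (q j) \<longleftrightarrow> inv p i = q j" "p (inv p i) = i"
    using assms by (metis bij_inv_eq_iff)+
  ultimately show "perm_matrix (p \<circ> q) i j = (perm_matrix p \<odot> perm_matrix q) i j"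
    by (simp add: mat_mult_def perm_matrix_def)
qed

lemma mat_star_perm_matrix: "bij p \<Longrightarrow> mat_star (perm_matrix p) = perm_matrix (inv p)"
  by (intro ext) (auto simp: mat_star_def perm_matrix_def bij_inv_eq_iff bij_is_inj bij_is_surj surj_f_inv_f)

lemma S_inf_subset_R_inf: "S_inf \<subseteq> R_inf"
proof
  fix r assume "r \<in> S_inf"
  then obtain p where p: "bij p" "finite {i. p i \<noteq> i}" "r = perm_matrix p"
    by (auto simp: S_inf_def)
  obtain N where "\<forall>i\<in>{i. p i \<noteq> i}. i < N"
    using p(2) finite_nat_set_iff_bounded by blast
  then have "\<forall>n\<ge>N. r n n = 1"
    by (auto simp: p(3) perm_matrix_def) (metis not_le)
  moreover have "inj p"
    using p(1) by (rule bij_is_inj)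
  ultimately show "r \<in> R_inf"
    by (auto simp: R_inf_def p(3) perm_matrix_def inj_eq split: if_splits)
qed

end

theory Submission
  imports Defs "HOL-Probability.Probability"
begin

text \<open>
  Let \<open>P\<close> be a copy of a permutation \<open>p\<close> moved far away from \<open>r\<close>, and \<open>F r = f (r P)\<close>, which does not
  depend on the copy. For \<open>cmod c = 1\<close> the element \<open>2 + c P + cnj c P\<^sup>*\<close> equals \<open>(1 + c P)\<^sup>* (1 + c P)\<close>,
  so the functions obtained from \<open>2 f \<plusminus> (c F + cnj c F\<^sup>*)\<close> are central and positive definite, and
  indecomposability of \<open>f\<close> forces \<open>F = f(p) f\<close>. Hence \<open>f\<close> is multiplicative on permutations with
  disjoint supports. Conversely, a multiplicative \<open>f\<close> is extremal on the finitary symmetric group: the mean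
  of \<open>N\<close> disjoint copies of \<open>p\<close> converges to the constant \<open>f(p)\<close> in the seminorm of \<open>f\<close>, hence in that
  of every \<open>g\<close> dominated by \<open>f\<close>, which gives \<open>g(p) = g(1) f(p)\<close>.

  The Thoma parameters are found by Okounkov's method. Products of transpositions of \<open>i\<close> with far
  points behave like powers of commuting self-adjoint operators \<open>A\<^sub>i\<close>. The values on cycles of length \<open>m + 1\<close>
  are the moments \<open>\<integral> x\<^sup>m d\<mu>\<close> of the spectral measure of \<open>A\<^sub>0\<close>, which lives on \<open>[-1, 1]\<close>.
  Cutting down by spectral projections to a closed set \<open>E\<close> and (anti)symmetrizing over \<open>k\<close> letters shows that
  the sums over permutations of \<open>k\<close> letters of \<open>\<plusminus> \<Prod> \<integral>\<^sub>E x\<^bsup>m-1\<^esup> d\<mu>\<close> (product over the cycle lengths \<open>m\<close>) are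
  nonnegative. The case \<open>k = 2\<close> shows that \<open>\<mu>\<close> is discrete away from 0. For \<open>E = {x}\<close> the sum equals
  \<open>w (w \<plusminus> x) \<dots> (w \<plusminus> (k - 1) x)\<close> with \<open>w = \<mu>{x}\<close>, so \<open>w\<close> is an integer multiple of \<open>|x|\<close>.
\<close>

hide_const (open) Finite_Cartesian_Product.transpose

section \<open>Orbit products of permutations\<close>

text \<open>No Hilbert space and no operator is constructed. A word in the commuting operators
  enters only through its matrix coefficients, and by multiplicativity such a coefficient depends
  only on how many letters fall into each orbit of a permutation of a fixed finite set. This is why
  permutations are handled through products over orbits with natural number weights.
  Indecomposability on the semigroup serves only to obtain multiplicativity; all that concerns
  measures and parameters takes place on finitary permutations. The spectral theorem is replaced by
  a moment problem, solved with Bernstein weights and a weak limit, and spectral projections are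
  replaced by polynomials that converge to indicators. The parameters \<beta> belong to the negative
  half-line and are reached by reflecting the measure, so that one argument serves both families.
  The mass at 0 belongs to no parameter: it is invisible on cycles of length above 1 and accounts
  for the possible gap between the sum of all parameters and 1.\<close>

definition orbits :: "('a \<Rightarrow> 'a) \<Rightarrow> 'a set \<Rightarrow> 'a set set" where
  "orbits p D = {A. A \<subseteq> D \<and> A \<noteq> {} \<and> p ` A \<subseteq> A \<and>
    (\<forall>B. B \<subseteq> A \<longrightarrow> B \<noteq> {} \<longrightarrow> p ` B \<subseteq> B \<longrightarrow> B = A)}"

text \<open>With all weights 1 and \<open>p\<close> a permutation of a finite \<open>D\<close>, this
  is the product of \<open>P\<close> over the cycle lengths, fixed points included. A larger weight
  stands for points that were fused into \<open>i\<close>, so cycles can grow while \<open>D\<close>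
  stays fixed.\<close>

definition orbit_prod :: "(nat \<Rightarrow> 'b::comm_monoid_mult) \<Rightarrow> ('a \<Rightarrow> 'a) \<Rightarrow> 'a set \<Rightarrow> ('a \<Rightarrow> nat) \<Rightarrow> 'b" where
  "orbit_prod P p D e = (\<Prod>A\<in>orbits p D. P (\<Sum>i\<in>A. e i))"

lemma orbits_subset: "A \<in> orbits p D \<Longrightarrow> A \<subseteq> D"
  by (simp add: orbits_def)

lemma orbits_nonempty: "A \<in> orbits p D \<Longrightarrow> A \<noteq> {}"
  by (simp add: orbits_def)

lemma orbits_invariant: "A \<in> orbits p D \<Longrightarrow> p ` A \<subseteq> A"
  by (simp add: orbits_def)

lemma orbits_minimal: "A \<in> orbits p D \<Longrightarrow> B \<subseteq> A \<Longrightarrow> B \<noteq> {} \<Longrightarrow> p ` B \<subseteq> B \<Longrightarrow> B = A"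
  by (simp add: orbits_def)

lemma finite_orbits: "finite D \<Longrightarrow> finite (orbits p D)"
  by (rule finite_subset[of _ "Pow D"]) (auto simp: orbits_def)

lemma orbits_disjoint:
  assumes "A \<in> orbits p D" "B \<in> orbits p D" "A \<noteq> B"
  shows "A \<inter> B = {}"
proof (rule ccontr)
  assume ne: "A \<inter> B \<noteq> {}"
  have "p ` (A \<inter> B) \<subseteq> A \<inter> B"
    using orbits_invariant[OF assms(1)] orbits_invariant[OF assms(2)] by blast
  then have "A \<inter> B = A" "A \<inter> B = B"
    using orbits_minimal[OF assms(1), of "A \<inter> B"] orbits_minimal[OF assms(2), of "A \<inter> B"] ne by auto
  then show False using assms by simp
qed

lemma image_inj_subset_eq:
  assumes "inj p" "finite A" "p ` A \<subseteq> A"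
  shows "p ` A = A"
  by (meson assms card_image card_subset_eq inj_on_subset subset_UNIV)

text \<open>A minimal invariant set among those containing \<open>x\<close> is minimal among all
  nonempty ones: if a smaller invariant \<open>B\<close> missed \<open>x\<close>, its complement in
  \<open>A\<close> would be invariant too, because an injective map of a finite set into itself is
  onto.\<close>

lemma orbits_cover:
  assumes "finite D" "inj p" "p ` D \<subseteq> D"
  shows "\<Union>(orbits p D) = D"
proof
  show "\<Union>(orbits p D) \<subseteq> D" by (auto simp: orbits_def)
  show "D \<subseteq> \<Union>(orbits p D)"
  proof
    fix x assume x: "x \<in> D"
    define F where "F = {A. A \<subseteq> D \<and> x \<in> A \<and> p ` A \<subseteq> A}"
    have "finite F" "F \<noteq> {}" unfolding F_def using assms x by auto
    from finite_has_minimal[OF this] obtain A where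
      A: "A \<in> F" and min: "\<forall>B\<in>F. B \<subseteq> A \<longrightarrow> A = B" by (rule bexE)
    have A2: "B = A" if "B \<in> F" "B \<subseteq> A" for B
      using min[rule_format, OF that] by simp
    have fA: "finite A" using A assms(1) finite_subset unfolding F_def by blast
    have "B = A" if B: "B \<subseteq> A" "B \<noteq> {}" "p ` B \<subseteq> B" for B
    proof (cases "x \<in> B")
      case True
      then have "B \<in> F" using A B unfolding F_def by auto
      then show ?thesis using A2 B(1) by blast
    next
      case False
      have "p ` A = A" "p ` B = B"
        using image_inj_subset_eq[OF assms(2)] fA B A finite_subset[OF B(1)]
        unfolding F_def by auto
      then have "p ` (A - B) = A - B" using image_set_diff[OF assms(2)] by metis
      then have "A - B \<in> F" using A False unfolding F_def by auto
      then have "A - B = A" using A2 by blast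
      then show ?thesis using B by blast
    qed
    then have "A \<in> orbits p D" using A unfolding orbits_def F_def by auto
    then show "x \<in> \<Union>(orbits p D)" using A unfolding F_def by auto
  qed
qed

lemma prod_orbits:
  assumes "finite D" "inj p" "p ` D \<subseteq> D"
  shows "(\<Prod>A\<in>orbits p D. \<Prod>i\<in>A. h i) = prod h D"
proof -
  have "prod h (\<Union>(orbits p D)) = prod (prod h) (orbits p D)"
  proof (subst prod.Union_disjoint)
    show "\<forall>A\<in>orbits p D. finite A" using finite_subset[OF orbits_subset assms(1)] by blast
    show "\<forall>A\<in>orbits p D. \<forall>B\<in>orbits p D. A \<noteq> B \<longrightarrow> A \<inter> B = {}"
      using orbits_disjoint by metis
  qed simp
  then show ?thesis using orbits_cover[OF assms] by simp
qed

text \<open>A finite invariant set is mapped onto itself, hence is invariant under the inverse as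
  well. This makes character values real and transfers results on left factors to right
  factors.\<close>

lemma orbits_inv:
  assumes "bij p" "finite D"
  shows "orbits (inv p) D = orbits p D"
proof -
  have eq: "inv p ` A \<subseteq> A \<longleftrightarrow> p ` A \<subseteq> A" if "A \<subseteq> D" for A
  proof -
    have fA: "finite A" using that assms finite_subset by blast
    have "p ` A \<subseteq> A \<Longrightarrow> inv p ` A \<subseteq> A"
      using image_inj_subset_eq[OF bij_is_inj[OF assms(1)] fA] assms(1)
      by (metis bij_is_inj image_inv_f_f order_refl)
    moreover have "inv p ` A \<subseteq> A \<Longrightarrow> p ` A \<subseteq> A"
      using image_inj_subset_eq[OF bij_is_inj[OF bij_imp_bij_inv[OF assms(1)]] fA] assms(1)
      by (metis bij_is_surj image_f_inv_f order_refl)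
    ultimately show ?thesis by blast
  qed
  have "A \<in> orbits (inv p) D \<longleftrightarrow> A \<in> orbits p D" for A
  proof (cases "A \<subseteq> D")
    case True
    then have "B \<subseteq> A \<Longrightarrow> inv p ` B \<subseteq> B \<longleftrightarrow> p ` B \<subseteq> B" for B
      using eq by (meson order_trans)
    then show ?thesis unfolding orbits_def mem_Collect_eq by (metis order_refl)
  qed (simp add: orbits_def)
  then show ?thesis by blast
qed

lemma orbit_prod_inv: "bij p \<Longrightarrow> finite D \<Longrightarrow> orbit_prod P (inv p) D e = orbit_prod P p D e"
  by (simp add: orbit_prod_def orbits_inv)

lemma orbit_prod_cong: "(\<And>x. x \<in> D \<Longrightarrow> e x = e' x) \<Longrightarrow> orbit_prod P p D e = orbit_prod P p D e'"
  unfolding orbit_prod_def by (rule prod.cong[OF refl], rule arg_cong[where f=P], rule sum.cong[OF refl]) (auto dest: orbits_subset)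

context
  fixes p :: "'a \<Rightarrow> 'a" and D :: "'a set" and i n :: 'a
  assumes p: "p permutes D" and fin: "finite D" and i: "i \<in> D" and n: "n \<notin> D"
begin

private abbreviation "q \<equiv> transpose i n \<circ> p"
private abbreviation "ext A \<equiv> (if i \<in> A then insert n A else A)"

text \<open>Composing with the transposition of \<open>i\<close> and a fresh point \<open>n\<close> inserts \<open>n\<close> into the orbit of \<open>i\<close>; on invariant
  sets this is the order isomorphism \<open>ext\<close>.\<close>
lemma transpose_comp_invariant_ext:
  assumes "A \<subseteq> D" "p ` A \<subseteq> A"
  shows "q ` ext A \<subseteq> ext A"
proof -
  have pn: "p n = n" using p n by (simp add: permutes_def)
  have "q x \<in> ext A" if x: "x \<in> ext A" for x
  proof (cases "x = n")
    case True
    then show ?thesis using x pn n assms(1) by (auto split: if_splits)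
  next
    case False
    then have "x \<in> A" using x by (auto split: if_splits)
    then have "p x \<in> A" using assms(2) by blast
    moreover from this have "p x \<noteq> n" using n assms(1) by blast
    ultimately show ?thesis by (cases "p x = i") auto
  qed
  then show ?thesis by blast
qed

lemma transpose_comp_invariant_restrict:
  assumes "A \<subseteq> insert n D" "q ` A \<subseteq> A"
  shows "p ` (A - {n}) \<subseteq> A - {n}" "A = ext (A - {n})"
proof -
  have pn: "p n = n" using p n by (simp add: permutes_def)
  have inn: "i \<noteq> n" using i n by blast
  have qn: "q n = i" using pn by simp
  have fA: "finite A" using assms fin finite_subset by blast
  have bq: "bij q" using permutes_bij[OF p] by (intro bij_comp) auto
  have qA: "q ` A = A" by (rule image_inj_subset_eq[OF bij_is_inj[OF bq] fA assms(2)])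
  have niff: "n \<in> A \<longleftrightarrow> i \<in> A"
  proof
    assume "n \<in> A" then show "i \<in> A" using qn assms(2) by (metis image_subset_iff)
  next
    assume "i \<in> A"
    then obtain y where "y \<in> A" "q y = i" using qA by (metis imageE)
    then have "y = n" using qn bij_is_inj[OF bq] by (metis injD)
    then show "n \<in> A" using \<open>y \<in> A\<close> by simp
  qed
  show "p ` (A - {n}) \<subseteq> A - {n}"
  proof
    fix y assume "y \<in> p ` (A - {n})"
    then obtain x where x: "x \<in> A" "x \<noteq> n" "y = p x" by auto
    have yn: "y \<noteq> n" using x pn permutes_inj[OF p] by (metis injD)
    have "q x \<in> A" using x assms(2) by blast
    then show "y \<in> A - {n}" using x yn niff by (cases "y = i") (auto simp: transpose_def)
  qed
  show "A = ext (A - {n})" using niff inn by auto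
qed

lemma orbits_transpose_comp:
  "orbits (transpose i n \<circ> p) (insert n D) = (\<lambda>A. ext A) ` orbits p D"
proof (intro set_eqI iffI)
  fix A assume A: "A \<in> orbits q (insert n D)"
  let ?B = "A - {n}"
  have inv: "A \<subseteq> insert n D" "q ` A \<subseteq> A" using A by (auto simp: orbits_def)
  note r = transpose_comp_invariant_restrict[OF inv]
  have ne: "?B \<noteq> {}"
  proof
    assume B: "?B = {}"
    have "A = {}" using r(2) unfolding B by simp
    then show False using A by (simp add: orbits_def)
  qed
  have "?B \<in> orbits p D"
    unfolding orbits_def
  proof (intro CollectI conjI allI impI)
    fix C assume C: "C \<subseteq> ?B" "C \<noteq> {}" "p ` C \<subseteq> C"
    have "C \<subseteq> D" using C inv by auto
    note e = transpose_comp_invariant_ext[OF this C(3)]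
    have "ext C \<subseteq> A"
      using C by (subst r(2)) auto
    moreover have "ext C \<noteq> {}" using C by auto
    ultimately have "ext C = A" using orbits_minimal[OF A] e by blast
    then show "C = ?B" using C \<open>C \<subseteq> D\<close> n by (auto split: if_splits)
  qed (use inv r(1) ne in auto)
  then show "A \<in> (\<lambda>A. ext A) ` orbits p D" 
    using r(2) by (intro image_eqI[where x="?B"])
next
  fix A assume "A \<in> (\<lambda>A. ext A) ` orbits p D"
  then obtain B where B: "B \<in> orbits p D" "A = ext B" by auto
  have BD: "B \<subseteq> D" "p ` B \<subseteq> B" "B \<noteq> {}" using B by (auto simp: orbits_def)
  show "A \<in> orbits q (insert n D)"
    unfolding orbits_def
  proof (intro CollectI conjI allI impI)
    show "A \<subseteq> insert n D" "A \<noteq> {}" using BD B by auto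
    show "q ` A \<subseteq> A" using transpose_comp_invariant_ext[OF BD(1,2)] B(2) by blast
    fix C assume C: "C \<subseteq> A" "C \<noteq> {}" "q ` C \<subseteq> C"
    have "C \<subseteq> insert n D" using C B BD by (auto split: if_splits)
    note r = transpose_comp_invariant_restrict[OF this C(3)]
    have "C - {n} \<noteq> {}"
    proof
      assume E: "C - {n} = {}"
      have "C = {}" using r(2) unfolding E by simp
      then show False using C by simp
    qed
    moreover have "C - {n} \<subseteq> B" using C B BD n by (auto split: if_splits)
    ultimately have "C - {n} = B" using orbits_minimal[OF B(1)] r(1) by blast
    then show "C = A" by (subst r(2), subst B(2)) simp
  qed
qed

text \<open>The basic reduction for all length computations: a fresh point multiplied in by a
  transposition disappears from the domain and leaves its weight on \<open>i\<close>.\<close>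

lemma orbit_prod_transpose_comp:
  "orbit_prod P (transpose i n \<circ> p) (insert n D) e = orbit_prod P p D (e(i := e i + e n))"
proof -
  have inj: "inj_on (\<lambda>A. ext A) (orbits p D)"
    using n by (intro inj_onI) (auto dest!: orbits_subset split: if_splits)
  have "(\<Sum>j\<in>ext A. e j) = (\<Sum>j\<in>A. (e(i := e i + e n)) j)" if "A \<in> orbits p D" for A
  proof -
    have A: "A \<subseteq> D" "finite A" "n \<notin> A" using that orbits_subset finite_subset[OF _ fin] n by blast+
    show ?thesis
    proof (cases "i \<in> A")
      case True
      then have "(\<Sum>j\<in>A. (e(i := e i + e n)) j) = (e i + e n) + (\<Sum>j\<in>A - {i}. e j)"
        using A by (subst sum.remove[of A i]) auto
      also have "\<dots> = e n + (\<Sum>j\<in>A. e j)" using A True sum.remove[of A i e] by simp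
      finally show ?thesis using A True by simp
    next
      case False
      then show ?thesis by (auto intro!: sum.cong)
    qed
  qed
  then show ?thesis
    unfolding orbit_prod_def orbits_transpose_comp by (subst prod.reindex[OF inj]) (auto intro!: prod.cong)
qed

end

lemma orbit_prod_comp_transpose:
  assumes p: "p permutes D" and fin: "finite D" and i: "i \<in> D" and n: "n \<notin> D"
  shows "orbit_prod P (p \<circ> transpose i n) (insert n D) e = orbit_prod P p D (e(i := e i + e n))"
proof -
  have "bij (p \<circ> transpose i n)" using permutes_bij[OF p] by (intro bij_comp) auto
  then have "orbit_prod P (p \<circ> transpose i n) (insert n D) e = orbit_prod P (inv (p \<circ> transpose i n)) (insert n D) e"
    using fin by (simp add: orbit_prod_inv)
  also have "inv (p \<circ> transpose i n) = transpose i n \<circ> inv p"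
    by (subst o_inv_distrib) (use permutes_bij[OF p] in auto)
  also have "orbit_prod P \<dots> (insert n D) e = orbit_prod P (inv p) D (e(i := e i + e n))"
    by (rule orbit_prod_transpose_comp[OF permutes_inv[OF p] fin i n])
  finally show ?thesis using fin permutes_bij[OF p] by (simp only: orbit_prod_inv)
qed

lemma orbit_prod_insert_fixed:
  assumes p: "p permutes D" and fin: "finite D" and n: "n \<notin> D"
  shows "orbit_prod P p (insert n D) e = P (e n) * orbit_prod P p D e"
proof -
  have pn: "p n = n" using p n by (simp add: permutes_def)
  have "orbits p (insert n D) = insert {n} (orbits p D)"
  proof (intro set_eqI iffI)
    fix A assume A: "A \<in> orbits p (insert n D)"
    show "A \<in> insert {n} (orbits p D)"
    proof (cases "n \<in> A")
      case True
      then have "{n} = A" using orbits_minimal[OF A, of "{n}"] pn by simp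
      then show ?thesis by simp
    next
      case False
      then show ?thesis using A by (auto simp: orbits_def)
    qed
  next
    fix A assume "A \<in> insert {n} (orbits p D)"
    then show "A \<in> orbits p (insert n D)" using pn by (auto simp: orbits_def)
  qed
  moreover have "{n} \<notin> orbits p D" using n by (auto simp: orbits_def)
  ultimately show ?thesis
    unfolding orbit_prod_def using finite_orbits[OF fin] by simp
qed

lemma orbits_empty [simp]: "orbits p {} = {}"
  by (auto simp: orbits_def)

lemma orbit_prod_empty [simp]: "orbit_prod P p {} e = 1"
  by (simp add: orbit_prod_def)

text \<open>Unfolding \<open>cycle_of_list\<close> peels off transpositions. The first point of the
  list is fresh for the cycle on the rest and is fused into the second one, until a single fixed
  point carries the whole weight.\<close>

lemma orbit_prod_cycle_comp:
  assumes "cs \<noteq> []" "distinct cs" "p permutes I" "finite I" "set cs \<inter> I = {}"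
  shows "orbit_prod P (cycle_of_list cs \<circ> p) (set cs \<union> I) e = P (\<Sum>i\<in>set cs. e i) * orbit_prod P p I e"
  using assms
proof (induction cs arbitrary: e rule: cycle_of_list.induct)
  case (1 i j cs)
  let ?c = "cycle_of_list (j # cs) \<circ> p"
  have "?c permutes (set (j # cs) \<union> I)"
    using cycle_permutes[of "j # cs"] 1(4)
    by (intro permutes_compose) (auto intro: permutes_subset simp del: cycle_of_list.simps)
  then have "orbit_prod P (transpose j i \<circ> ?c) (insert i (set (j # cs) \<union> I)) e
      = orbit_prod P ?c (set (j # cs) \<union> I) (e(j := e j + e i))"
    by (rule orbit_prod_transpose_comp) (use 1 in auto)
  also have "\<dots> = P (\<Sum>k\<in>set (j # cs). (e(j := e j + e i)) k) * orbit_prod P p I (e(j := e j + e i))"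
    by (rule 1(1)) (use 1 in auto)
  also have "orbit_prod P p I (e(j := e j + e i)) = orbit_prod P p I e"
    by (rule orbit_prod_cong) (use 1 in auto)
  also have "(\<Sum>k\<in>set (j # cs). (e(j := e j + e i)) k) = (\<Sum>k\<in>set (i # j # cs). e k)"
  proof -
    have "(\<Sum>k\<in>set cs. (e(j := e j + e i)) k) = (\<Sum>k\<in>set cs. e k)"
      by (rule sum.cong) (use 1 in auto)
    then show ?thesis using 1 by simp
  qed
  finally show ?case by (simp add: transpose_commute comp_assoc)
next
  case "2_1" then show ?case by simp
next
  case ("2_2" v)
  then show ?case using orbit_prod_insert_fixed[of p I v P e] by simp
qed

section \<open>Positive central functions on the finitary symmetric group\<close>

text \<open>There are as many points of the image outside \<open>A\<close> as points of
  \<open>A\<close> outside the image, so any bijection between these two sets completes the partial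
  injection.\<close>

lemma permutes_extension:
  assumes "finite A" "inj_on \<phi> A"
  obtains \<tau> where "\<tau> permutes (A \<union> \<phi> ` A)" "\<And>x. x \<in> A \<Longrightarrow> \<tau> x = \<phi> x"
proof -
  let ?B = "\<phi> ` A"
  have "card (?B - A) = card (A - ?B)"
    using assms card_image[OF assms(2)] by (simp add: card_Diff_subset_Int Int_commute)
  then obtain h where h: "bij_betw h (?B - A) (A - ?B)"
    using assms finite_same_card_bij[of "?B - A" "A - ?B"] by auto
  have "bij_betw \<phi> A ?B" using assms by (simp add: bij_betw_def)
  then have "bij_betw (\<lambda>x. if x \<in> A then \<phi> x else h x) (A \<union> (?B - A)) (?B \<union> (A - ?B))"
    using h by (intro bij_betw_disjoint_Un) auto
  moreover have "A \<union> (?B - A) = A \<union> ?B" "?B \<union> (A - ?B) = A \<union> ?B" by auto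
  ultimately have b: "bij_betw (\<lambda>x. if x \<in> A then \<phi> x else h x) (A \<union> ?B) (A \<union> ?B)"
    by simp
  define \<tau> where "\<tau> x = (if x \<in> A \<union> ?B then (if x \<in> A then \<phi> x else h x) else x)" for x
  have "bij_betw \<tau> (A \<union> ?B) (A \<union> ?B)"
    using b by (rule bij_betw_cong[THEN iffD1, rotated]) (simp add: \<tau>_def)
  then have "\<tau> permutes (A \<union> ?B)"
    by (rule bij_imp_permutes) (simp add: \<tau>_def)
  then show ?thesis using that[of \<tau>] by (simp add: \<tau>_def)
qed

locale positive_class_function =
  fixes g :: "(nat \<Rightarrow> nat) \<Rightarrow> complex"
  assumes central: "permutation p \<Longrightarrow> permutation q \<Longrightarrow> g (p \<circ> q) = g (q \<circ> p)"
    and hermitian: "permutation p \<Longrightarrow> g (inv p) = cnj (g p)"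
    and positive_lessThan: "(\<And>i. i < (n::nat) \<Longrightarrow> permutation (v i)) \<Longrightarrow>
      0 \<le> Re (\<Sum>i<n. \<Sum>j<n. cnj (w i) * g (inv (v i) \<circ> v j) * w j)"
begin

lemma positive:
  fixes u :: "'i \<Rightarrow> nat \<Rightarrow> nat"
  assumes "finite I" "\<And>i. i \<in> I \<Longrightarrow> permutation (u i)"
  shows "0 \<le> Re (\<Sum>i\<in>I. \<Sum>j\<in>I. cnj (z i) * g (inv (u i) \<circ> u j) * z j)"
proof -
  obtain h where h: "bij_betw h {..<card I} I"
    using ex_bij_betw_nat_finite[OF assms(1)] by (auto simp: atLeast0LessThan)
  have "(\<Sum>i\<in>I. \<Sum>j\<in>I. cnj (z i) * g (inv (u i) \<circ> u j) * z j)
      = (\<Sum>i<card I. \<Sum>j<card I. cnj (z (h i)) * g (inv (u (h i)) \<circ> u (h j)) * z (h j))"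
    by (subst sum.reindex_bij_betw[OF h, symmetric], rule sum.cong[OF refl],
        subst sum.reindex_bij_betw[OF h, symmetric], rule refl)
  then show ?thesis
    using positive_lessThan[of "card I" "\<lambda>i. u (h i)" "\<lambda>i. z (h i)"] assms(2) bij_betwE[OF h]
    by simp
qed

lemma conjugate:
  assumes "permutation p" "permutation q"
  shows "g (q \<circ> p \<circ> inv q) = g p"
proof -
  have "g ((q \<circ> p) \<circ> inv q) = g (inv q \<circ> (q \<circ> p))"
    using assms by (intro central permutation_compose permutation_inverse)
  also have "inv q \<circ> (q \<circ> p) = p"
    using assms(2) by (simp add: comp_assoc[symmetric] permutation_bijective bij_is_inj)
  finally show ?thesis .
qed

lemma cycle_value:
  assumes "distinct cs" "distinct ds" "length cs = length ds"
  shows "g (cycle_of_list cs) = g (cycle_of_list ds)"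
proof -
  define \<phi> where "\<phi> x = the (map_of (zip cs ds) x)" for x
  have m: "map \<phi> cs = ds"
  proof (rule nth_equalityI)
    fix i assume "i < length (map \<phi> cs)"
    then show "map \<phi> cs ! i = ds ! i"
      using assms by (simp add: \<phi>_def map_of_zip_nth)
  qed (use assms in simp)
  have "inj_on \<phi> (set cs)"
    using m assms distinct_map[of \<phi> cs] by simp
  then obtain \<tau> where t: "\<tau> permutes (set cs \<union> \<phi> ` set cs)" "\<And>x. x \<in> set cs \<Longrightarrow> \<tau> x = \<phi> x"
    using permutes_extension[of "set cs" \<phi>] by auto
  have pt: "permutation \<tau>" using t(1) unfolding permutation_permutes by (intro exI[of _ "set cs \<union> \<phi> ` set cs"]) simp
  have "map \<tau> cs = ds" using m t(2) by (metis map_cong)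
  then have "\<tau> \<circ> cycle_of_list cs \<circ> inv \<tau> = cycle_of_list ds"
    using conjugation_of_cycle[OF assms(1) permutation_bijective[OF pt]] by simp
  then show ?thesis
    using conjugate[OF permutation_of_cycle pt] by metis
qed

end

text \<open>Besides centrality and positivity, these two properties are all that the construction of
  the parameters and the proof of extremality use.\<close>

locale multiplicative_character = positive_class_function +
  assumes one: "g id = 1"
    and mult: "p permutes A \<Longrightarrow> q permutes B \<Longrightarrow> finite A \<Longrightarrow> finite B \<Longrightarrow> A \<inter> B = {} \<Longrightarrow>
      g (p \<circ> q) = g p * g q"
begin

text \<open>A list with one element gives the identity, so fixed points contribute the factor 1.
  Taking the real part loses nothing, by \<open>real_valued\<close> below.\<close>

definition cyc :: "nat \<Rightarrow> real" where
  "cyc l = Re (g (cycle_of_list [0..<l]))"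

lemma eq_orbit_prod_complex:
  assumes "p permutes D" "finite D"
  shows "g p = orbit_prod (\<lambda>l. g (cycle_of_list [0..<l])) p D (\<lambda>_. 1)"
proof -
  define P where "P l = g (cycle_of_list [0..<l])" for l
  have "finite D \<and> p permutes D \<and> g p = orbit_prod P p D (\<lambda>_. 1)"
    using cycle_decomposition[OF assms]
  proof (induction rule: cycle_decomp.induct)
    case empty
    then show ?case by (simp add: one permutes_id del: id_apply)
  next
    case (comp I p cs)
    show ?case
    proof (cases "cs = []")
      case True
      then show ?thesis using comp by simp
    next
      case False
      have perm: "(cycle_of_list cs \<circ> p) permutes (set cs \<union> I)"
        using cycle_permutes[of cs] comp by (intro permutes_compose) (auto intro: permutes_subset)
      have "g (cycle_of_list cs \<circ> p) = g (cycle_of_list cs) * g p"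
        by (rule mult[OF cycle_permutes[of cs], of p I]) (use comp in auto)
      moreover have "g (cycle_of_list cs) = P (length cs)"
        unfolding P_def using comp by (intro cycle_value) auto
      moreover have "orbit_prod P (cycle_of_list cs \<circ> p) (set cs \<union> I) (\<lambda>_. 1) = P (\<Sum>i\<in>set cs. 1) * orbit_prod P p I (\<lambda>_. 1)"
        using comp False by (intro orbit_prod_cycle_comp) auto
      moreover have "(\<Sum>i\<in>set cs. 1) = length cs"
        using comp by (simp add: distinct_card)
      ultimately have "g (cycle_of_list cs \<circ> p) = orbit_prod P (cycle_of_list cs \<circ> p) (set cs \<union> I) (\<lambda>_. 1)"
        using comp.IH by (simp only:)
      then show ?thesis using perm comp.IH by blast
    qed
  qed
  then show ?thesis by (simp add: P_def[abs_def])
qed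

text \<open>A permutation and its inverse have the same orbits, hence the same value, while
  hermitian symmetry makes the two values conjugate.\<close>

lemma real_valued:
  assumes "permutation p"
  shows "g p \<in> \<real>"
proof -
  obtain D where D: "finite D" "p permutes D"
    using assms unfolding permutation_permutes by auto
  have "g (inv p) = g p"
    using eq_orbit_prod_complex[OF D(2,1)] eq_orbit_prod_complex[OF permutes_inv[OF D(2)] D(1)]
      orbit_prod_inv[OF permutes_bij[OF D(2)] D(1)] by metis
  then have "cnj (g p) = g p" using hermitian[OF assms] by simp
  then show ?thesis by (simp add: Reals_cnj_iff)
qed

lemma cycle_eq_cyc: "distinct cs \<Longrightarrow> g (cycle_of_list cs) = of_real (cyc (length cs))"
  using cycle_value[of cs "[0..<length cs]"] real_valued[OF permutation_of_cycle]
  by (simp add: cyc_def of_real_Re)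

lemma eq_orbit_prod:
  assumes "p permutes D" "finite D"
  shows "g p = of_real (orbit_prod cyc p D (\<lambda>_. 1))"
proof -
  have "(\<lambda>l. g (cycle_of_list [0..<l])) = (\<lambda>l. of_real (cyc l))"
    by (simp add: cycle_eq_cyc)
  then show ?thesis using eq_orbit_prod_complex[OF assms] by (simp add: orbit_prod_def)
qed

lemma cyc_1 [simp]: "cyc (Suc 0) = 1"
  by (simp add: cyc_def one)

text \<open>Positivity at \<open>id + s p\<close> for \<open>s = 1\<close> and
  \<open>s = -1\<close>; the two diagonal terms contribute 2.\<close>

lemma norm_le_1:
  assumes "permutation p"
  shows "\<bar>Re (g p)\<bar> \<le> 1"
proof -
  have *: "0 \<le> 2 + 2 * s * Re (g p)" if s: "s = 1 \<or> s = -1" for s :: real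
  proof -
    have "0 \<le> Re (\<Sum>i\<in>{0::nat,1}. \<Sum>j\<in>{0::nat,1}. cnj (if i = 0 then 1 else of_real s) *
        g (inv (if i = 0 then id else p) \<circ> (if j = 0 then id else p)) *
        (if j = 0 then 1 else of_real s))"
      by (rule positive[where u="\<lambda>i::nat. if i = 0 then id else p" and z="\<lambda>i::nat. if i = 0 then 1 else of_real s"])
        (auto simp: assms)
    moreover have "inv p \<circ> p = id" using assms by (simp add: permutation_bijective bij_is_inj)
    ultimately show ?thesis
      using s hermitian[OF assms] by (auto simp: one algebra_simps)
  qed
  show ?thesis using *[of 1] *[of "-1"] by auto
qed

end

section \<open>Words of transpositions with fresh points\<close>

fun attach :: "('a \<times> 'a) list \<Rightarrow> 'a \<Rightarrow> 'a" where
  "attach [] = id"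
| "attach ((i, n) # l) = attach l \<circ> transpose i n"

text \<open>A pair \<open>(i, n)\<close> stands for one factor of the operator of letter
  \<open>i\<close>, realized with the fresh point \<open>n\<close>. Only the number of occurrences
  of each letter survives, which is the commutation of these operators. Fresh points have weight 1,
  so each adds one to the weight of its letter.\<close>

lemma orbit_prod_comp_attach:
  assumes q: "q permutes D" and fin: "finite D"
    and l: "set (map fst l) \<subseteq> D" "distinct (map snd l)" "set (map snd l) \<inter> D = {}"
  shows "(q \<circ> attach l) permutes (D \<union> set (map snd l)) \<and>
    orbit_prod P (q \<circ> attach l) (D \<union> set (map snd l)) (\<lambda>x. if x \<in> D then d x else 1)
      = orbit_prod P q D (\<lambda>x. d x + count_list (map fst l) x)"
  using l
proof (induction l arbitrary: d)
  case Nil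
  have "orbit_prod P q D (\<lambda>x. if x \<in> D then d x else 1) = orbit_prod P q D d"
    by (rule orbit_prod_cong) simp
  then show ?case using q by simp
next
  case (Cons a l)
  obtain i n where a: "a = (i, n)" by fastforce
  let ?D = "D \<union> set (map snd l)"
  let ?e = "\<lambda>x. if x \<in> D then d x else 1"
  have i: "i \<in> ?D" "i \<in> D" and n: "n \<notin> ?D" using Cons.prems a by auto
  have IH: "(q \<circ> attach l) permutes ?D"
    "\<And>d. orbit_prod P (q \<circ> attach l) ?D (\<lambda>x. if x \<in> D then d x else 1)
      = orbit_prod P q D (\<lambda>x. d x + count_list (map fst l) x)"
  proof -
    have pr: "set (map fst l) \<subseteq> D" "distinct (map snd l)" "set (map snd l) \<inter> D = {}"
      using Cons.prems by auto
    show "(q \<circ> attach l) permutes ?D" by (rule conjunct1[OF Cons.IH[OF pr]])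
    show "orbit_prod P (q \<circ> attach l) ?D (\<lambda>x. if x \<in> D then d x else 1)
      = orbit_prod P q D (\<lambda>x. d x + count_list (map fst l) x)" for d
      by (rule conjunct2[OF Cons.IH[OF pr]])
  qed
  have perm: "(q \<circ> attach l \<circ> transpose i n) permutes (insert n ?D)"
    by (rule permutes_compose[OF permutes_swap_id permutes_subset[OF IH(1)]]) (use i in auto)
  have "orbit_prod P (q \<circ> attach l \<circ> transpose i n) (insert n ?D) ?e
      = orbit_prod P (q \<circ> attach l) ?D (?e(i := ?e i + ?e n))"
    using fin by (intro orbit_prod_comp_transpose[OF IH(1) _ i(1) n]) auto
  also have "\<dots> = orbit_prod P (q \<circ> attach l) ?D (\<lambda>x. if x \<in> D then (d(i := d i + 1)) x else 1)"
    using i n by (intro orbit_prod_cong) auto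
  also have "\<dots> = orbit_prod P q D (\<lambda>x. (d(i := d i + 1)) x + count_list (map fst l) x)"
    by (rule IH(2))
  also have "\<dots> = orbit_prod P q D (\<lambda>x. d x + count_list (map fst (a # l)) x)"
    by (rule orbit_prod_cong) (simp add: a)
  finally have "orbit_prod P (q \<circ> attach l \<circ> transpose i n) (insert n ?D) ?e
      = orbit_prod P q D (\<lambda>x. d x + count_list (map fst (a # l)) x)" .
  moreover have "q \<circ> attach (a # l) = q \<circ> attach l \<circ> transpose i n"
    by (simp add: a fun_eq_iff)
  moreover have "D \<union> set (map snd (a # l)) = insert n ?D" by (simp add: a)
  ultimately show ?case using perm by (simp only: simp_thms)
qed

text \<open>This is the matrix coefficient between two words with disjoint fresh points. The left
  word is reached by passing to the inverse permutation, which turns \<open>inv (attach l)\<close>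
  on the left into \<open>attach l\<close> on the right without changing the orbits.\<close>

lemma orbit_prod_inv_attach_comp_attach:
  assumes q: "q permutes D" and fin: "finite D"
    and l: "set (map fst l) \<subseteq> D" "set (map fst l') \<subseteq> D"
      "distinct (map snd l)" "distinct (map snd l')" "set (map snd l) \<inter> D = {}" "set (map snd l') \<inter> D = {}"
      "set (map snd l) \<inter> set (map snd l') = {}"
  shows "(inv (attach l) \<circ> (q \<circ> attach l')) permutes (D \<union> set (map snd l') \<union> set (map snd l))" (is ?A)
    and "orbit_prod P (inv (attach l) \<circ> (q \<circ> attach l')) (D \<union> set (map snd l') \<union> set (map snd l)) (\<lambda>_. 1)
      = orbit_prod P q D (\<lambda>x. 1 + count_list (map fst l) x + count_list (map fst l') x)" (is ?B)
proof -
  let ?q = "q \<circ> attach l'" and ?D = "D \<union> set (map snd l')"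
  have r: "?q permutes ?D"
    "\<And>d. orbit_prod P ?q ?D (\<lambda>x. if x \<in> D then d x else 1) = orbit_prod P q D (\<lambda>x. d x + count_list (map fst l') x)"
    using orbit_prod_comp_attach[OF q fin l(2,4,6)] by auto
  have fD: "finite ?D" "finite (?D \<union> set (map snd l))" using fin by auto
  have s: "(inv ?q \<circ> attach l) permutes (?D \<union> set (map snd l))"
    "\<And>d. orbit_prod P (inv ?q \<circ> attach l) (?D \<union> set (map snd l)) (\<lambda>x. if x \<in> ?D then d x else 1)
      = orbit_prod P (inv ?q) ?D (\<lambda>x. d x + count_list (map fst l) x)"
  proof -
    have pr: "set (map fst l) \<subseteq> ?D" "set (map snd l) \<inter> ?D = {}" using l by auto
    note W = orbit_prod_comp_attach[OF permutes_inv[OF r(1)] fD(1) pr(1) l(3) pr(2)]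
    show "(inv ?q \<circ> attach l) permutes (?D \<union> set (map snd l))" by (rule conjunct1[OF W])
    show "orbit_prod P (inv ?q \<circ> attach l) (?D \<union> set (map snd l)) (\<lambda>x. if x \<in> ?D then d x else 1)
      = orbit_prod P (inv ?q) ?D (\<lambda>x. d x + count_list (map fst l) x)" for d
      by (rule conjunct2[OF W])
  qed
  have "(id \<circ> attach l) permutes (D \<union> set (map snd l))"
    using orbit_prod_comp_attach[OF permutes_id fin, of l] l by blast
  then have ba: "bij (attach l)" by (simp add: permutes_bij)
  have bq: "bij ?q" using permutes_bij[OF r(1)] .
  have inv: "inv (inv ?q \<circ> attach l) = inv (attach l) \<circ> ?q"
    using ba bq by (subst o_inv_distrib) (auto simp: bij_imp_bij_inv inv_inv_eq)
  show ?A using permutes_inv[OF s(1)] unfolding inv .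
  have "orbit_prod P (inv (attach l) \<circ> ?q) (?D \<union> set (map snd l)) (\<lambda>_. 1)
      = orbit_prod P (inv ?q \<circ> attach l) (?D \<union> set (map snd l)) (\<lambda>_. 1)"
    using orbit_prod_inv[OF permutes_bij[OF s(1)] fD(2)] unfolding inv .
  also have "\<dots> = orbit_prod P (inv ?q) ?D (\<lambda>x. 1 + count_list (map fst l) x)"
    using s(2)[of "\<lambda>_. 1"] by (simp cong: if_cong)
  also have "\<dots> = orbit_prod P ?q ?D (\<lambda>x. 1 + count_list (map fst l) x)"
    by (rule orbit_prod_inv[OF bq fD(1)])
  also have "\<dots> = orbit_prod P ?q ?D (\<lambda>x. if x \<in> D then 1 + count_list (map fst l) x else 1)"
  proof (rule orbit_prod_cong)
    fix x assume "x \<in> ?D"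
    have "count_list (map fst l) x = 0" if "x \<notin> D"
      using that l(1) by (intro count_notin) auto
    then show "1 + count_list (map fst l) x = (if x \<in> D then 1 + count_list (map fst l) x else 1)"
      by simp
  qed
  also have "\<dots> = orbit_prod P q D (\<lambda>x. 1 + count_list (map fst l) x + count_list (map fst l') x)"
    by (rule r(2))
  finally show ?B .
qed

text \<open>Takes the place of a division by \<open>N\<close> followed by a limit; \<open>B\<close>
  collects the terms that do not grow.\<close>

lemma nonneg_if_affine_bounded:
  fixes B C :: real
  assumes "\<And>N::nat. 0 \<le> B + real N * C"
  shows "0 \<le> C"
proof (rule ccontr)
  assume "\<not> 0 \<le> C"
  then obtain N :: nat where "B < real N * (- C)"
    using reals_Archimedean3[of "- C"] by auto
  then show False using assms[of N] by auto
qed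

context multiplicative_character
begin

text \<open>Positivity is tested on the elements \<open>s u \<circ> attach l\<close>, averaged over \<open>N\<close> choices of pairwise disjoint fresh points in
  the words \<open>l\<close>; the terms with coinciding fresh points disappear as \<open>N \<rightarrow> \<infinity>\<close>.\<close>
theorem orbit_prod_positive:
  fixes s :: "'u \<Rightarrow> nat \<Rightarrow> nat" and ws :: "'u \<Rightarrow> nat list" and c :: "'u \<Rightarrow> real"
  assumes U: "finite U" and D: "finite D" and s: "\<And>u. u \<in> U \<Longrightarrow> s u permutes D"
    and ws: "\<And>u. u \<in> U \<Longrightarrow> set (ws u) \<subseteq> D"
  shows "0 \<le> (\<Sum>u\<in>U. \<Sum>v\<in>U. c u * c v *
    orbit_prod cyc (inv (s u) \<circ> s v) D (\<lambda>x. 1 + count_list (ws u) x + count_list (ws v) x))"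
    (is "0 \<le> ?C")
proof -
  obtain b where b: "\<And>x. x \<in> D \<Longrightarrow> x < b"
    using D finite_nat_set_iff_bounded by auto
  obtain M where "\<forall>m\<in>(\<lambda>u. length (ws u)) ` U. m < M"
    using U finite_nat_set_iff_bounded[of "(\<lambda>u. length (ws u)) ` U"] by auto
  then have M: "\<And>u. u \<in> U \<Longrightarrow> length (ws u) \<le> M" by (auto intro: less_imp_le)
  \<comment> \<open>\<open>b\<close> exceeds every point of \<open>D\<close> and \<open>M\<close>
    bounds all word lengths, so copy \<open>j\<close> takes its fresh points from a block of length
    \<open>M\<close> of its own above \<open>D\<close>.\<close>
  define l where "l u j = zip (ws u) [b + j * M ..< b + j * M + length (ws u)]" for u j
  have fst_l: "map fst (l u j) = ws u" for u j by (simp add: l_def)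
  have snd_l: "map snd (l u j) = [b + j * M ..< b + j * M + length (ws u)]" for u j
    by (simp add: l_def)
  have l1: "set (map fst (l u j)) \<subseteq> D" "distinct (map snd (l u j))" "set (map snd (l u j)) \<inter> D = {}"
    if "u \<in> U" for u j
    using ws[OF that] unfolding fst_l snd_l by (auto dest!: b)
  have l2: "set (map snd (l u j)) \<inter> set (map snd (l v k)) = {}" if uv: "u \<in> U" "v \<in> U" "j \<noteq> k" for u v j k
  proof -
    have disj: "{b + j * M ..< b + j * M + length (ws u)} \<inter> {b + k * M ..< b + k * M + length (ws v)} = {}"
      if "j < k" "u \<in> U" for u v j k
    proof -
      have "Suc j * M \<le> k * M" using that by (intro mult_right_mono) auto
      then show ?thesis using M[OF that(2)] by auto
    qed
    show ?thesis
      using disj[of j k u v] disj[of k j v u] uv unfolding snd_l set_upt by (cases "j < k") (auto simp del: ivl_disj_int)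
  qed
  define w where "w = (\<lambda>(u, j). s u \<circ> attach (l u j))"
  have perm_attach: "attach (l u j) permutes (D \<union> set (map snd (l u j)))" if "u \<in> U" for u j
    using conjunct1[OF orbit_prod_comp_attach[OF permutes_id D l1[OF that]]] by (simp only: id_o)
  have pw: "permutation (w (u, j))" if "u \<in> U" for u j
    unfolding w_def prod.case
  proof (rule permutation_compose)
    show "permutation (s u)" using s[OF that] D unfolding permutation_permutes by blast
    show "permutation (attach (l u j))" unfolding permutation_permutes
      by (rule exI, rule conjI[OF _ perm_attach[OF that]]) (use D in simp)
  qed
  define T where "T j k = (\<Sum>u\<in>U. \<Sum>v\<in>U. c u * c v * Re (g (inv (w (u, j)) \<circ> w (v, k))))" for j k
  define B where "B = (\<Sum>u\<in>U. \<Sum>v\<in>U. \<bar>c u * c v\<bar>)"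
  \<comment> \<open>Different copies have disjoint fresh points, so the coefficient depends on the
    letters but not on the copies.\<close>
  have off: "T j k = ?C" if "j \<noteq> k" for j k
    unfolding T_def
  proof (intro sum.cong refl arg_cong2[where f="(*)"])
    fix u v assume u: "u \<in> U" and v: "v \<in> U"
    have "bij (s u)" "bij (attach (l u j))"
      using permutes_bij[OF s[OF u]] permutes_bij[OF perm_attach[OF u]] by blast+
    then have "inv (w (u, j)) \<circ> w (v, k) = inv (attach (l u j)) \<circ> ((inv (s u) \<circ> s v) \<circ> attach (l v k))"
      by (simp add: w_def o_inv_distrib comp_assoc)
    moreover have q: "(inv (s u) \<circ> s v) permutes D"
      using s u v by (intro permutes_compose permutes_inv)
    note W = orbit_prod_inv_attach_comp_attach[OF q D l1(1)[OF u] l1(1)[OF v] l1(2)[OF u] l1(2)[OF v]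
        l1(3)[OF u] l1(3)[OF v] l2[OF u v that]]
    ultimately show "Re (g (inv (w (u, j)) \<circ> w (v, k))) =
        orbit_prod cyc (inv (s u) \<circ> s v) D (\<lambda>x. 1 + count_list (ws u) x + count_list (ws v) x)"
      using eq_orbit_prod[OF W(1)] W(2)[of cyc] D unfolding fst_l by simp
  qed
  have diag: "T j j \<le> B" for j
    unfolding T_def B_def
  proof (intro sum_mono)
    fix u v assume "u \<in> U" "v \<in> U"
    then have "\<bar>Re (g (inv (w (u, j)) \<circ> w (v, j)))\<bar> \<le> 1"
      by (intro norm_le_1 permutation_compose permutation_inverse pw)
    then have "\<bar>c u * c v\<bar> * \<bar>Re (g (inv (w (u, j)) \<circ> w (v, j)))\<bar> \<le> \<bar>c u * c v\<bar> * 1"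
      by (intro mult_left_mono) auto
    then show "c u * c v * Re (g (inv (w (u, j)) \<circ> w (v, j))) \<le> \<bar>c u * c v\<bar>"
      by (simp add: abs_mult[symmetric])
  qed
  have "0 \<le> B + real N * ?C" for N
  proof -
    \<comment> \<open>Among the pairs of \<open>Suc N\<close> copies there are \<open>Suc N\<close>
      diagonal ones, each contributing at most \<open>B\<close>, and \<open>Suc N * N\<close>
      others; the positive factor \<open>Suc N\<close> is divided out at the end.\<close>
    let ?N = "{..<Suc N}"
    have "0 \<le> Re (\<Sum>i\<in>U\<times>?N. \<Sum>j\<in>U\<times>?N. cnj (of_real (c (fst i))) * g (inv (w i) \<circ> w j) * of_real (c (fst j)))"
      by (rule positive) (use U pw in auto)
    also have "\<dots> = (\<Sum>i\<in>U\<times>?N. \<Sum>j\<in>U\<times>?N. c (fst i) * c (fst j) * Re (g (inv (w i) \<circ> w j)))"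
      by (simp add: mult_ac)
    also have "\<dots> = (\<Sum>u\<in>U. \<Sum>j\<in>?N. \<Sum>v\<in>U. \<Sum>k\<in>?N. c u * c v * Re (g (inv (w (u, j)) \<circ> w (v, k))))"
      by (simp only: sum.cartesian_product' fst_conv)
    also have "\<dots> = (\<Sum>j\<in>?N. \<Sum>u\<in>U. \<Sum>v\<in>U. \<Sum>k\<in>?N. c u * c v * Re (g (inv (w (u, j)) \<circ> w (v, k))))"
      by (rule sum.swap)
    also have "\<dots> = (\<Sum>j\<in>?N. \<Sum>u\<in>U. \<Sum>k\<in>?N. \<Sum>v\<in>U. c u * c v * Re (g (inv (w (u, j)) \<circ> w (v, k))))"
      by (intro sum.cong refl sum.swap)
    also have "\<dots> = (\<Sum>j\<in>?N. \<Sum>k\<in>?N. T j k)"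
      unfolding T_def by (intro sum.cong refl sum.swap)
    also have "\<dots> \<le> (\<Sum>j\<in>?N. \<Sum>k\<in>?N. ?C + (if j = k then B - ?C else 0))"
      using off diag by (intro sum_mono) auto
    also have "\<dots> = real (Suc N) * (B + real N * ?C)"
      by (simp add: sum.distrib algebra_simps)
    finally show ?thesis by (simp add: zero_le_mult_iff)
  qed
  then show ?thesis by (rule nonneg_if_affine_bounded)
qed

end

section \<open>A moment problem on the unit interval\<close>

text \<open>The ratio of binomials is the product of \<open>(k - j) / (n - j)\<close> over
  \<open>j < m\<close>, with each factor close to \<open>k / n\<close>. All factors have absolute
  value at most 1, so the products differ by at most the sum of the differences. The condition
  \<open>2 * m < n\<close> keeps the bound 1 valid when \<open>k < j\<close>.\<close>

lemma falling_ratio_approx: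
  fixes m n k :: nat
  assumes "2 * m < n" "k \<le> n"
  shows "\<bar>(real k / real n) ^ m - real (k choose m) / real (n choose m)\<bar> \<le> real m * (real m / (real n - real m))"
proof -
  have n: "real n - real j > 0" "real j \<le> real n - real j" if "j < m" for j
    using that assms by auto
  define z where "z j = (real k - real j) / (real n - real j)" for j
  have "real (k choose m) / real (n choose m) = (\<Prod>j<m. z j)"
    by (simp add: binomial_gbinomial gbinomial_prod_rev prod_dividef z_def atLeast0LessThan)
  moreover have "(real k / real n) ^ m = (\<Prod>j<m. real k / real n)" by simp
  moreover have "norm ((\<Prod>j<m. real k / real n) - (\<Prod>j<m. z j)) \<le> (\<Sum>j<m. norm (real k / real n - z j))"
  proof (rule norm_prod_diff)
    show "norm (real k / real n) \<le> 1" using assms by simp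
    fix j assume "j \<in> {..<m}"
    then have "\<bar>real k - real j\<bar> \<le> real n - real j" using n[of j] assms by (auto simp: abs_le_iff)
    then show "norm (z j) \<le> 1" using n[of j] \<open>j \<in> {..<m}\<close> by (simp add: z_def)
  qed
  moreover have "(\<Sum>j<m. norm (real k / real n - z j)) \<le> (\<Sum>j<m. real m / (real n - real m))"
  proof (rule sum_mono)
    fix j assume "j \<in> {..<m}"
    then have j: "real n - real j > 0" "real j \<le> real m" "real n - real m > 0" "real n > 0" using assms by auto
    have "real k / real n - z j = real j / (real n - real j) * ((real n - real k) / real n)"
      using j by (simp add: z_def field_simps)
    also have "norm \<dots> \<le> real j / (real n - real j) * 1"
    proof -
      have "norm ((real n - real k) / real n) \<le> 1" using assms j by simp
      then show ?thesis using j unfolding norm_mult by (intro mult_mono) auto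
    qed
    also have "\<dots> \<le> real m / (real n - real m)"
      using j by (simp add: frac_le)
    finally show "norm (real k / real n - z j) \<le> real m / (real n - real m)" .
  qed
  ultimately show ?thesis by simp
qed

text \<open>Nonnegativity on products of powers of \<open>x\<close> and \<open>1 - x\<close> is
  Hausdorff's condition for moments on the unit interval. The exponents 0, 0 are covered by the
  normalization \<open>one\<close>.\<close>

locale positive_functional =
  fixes L :: "real poly \<Rightarrow> real"
  assumes add: "L (p + q) = L p + L q"
    and smult: "L (smult c p) = c * L p"
    and one: "L 1 = 1"
    and nonneg: "0 < i + j \<Longrightarrow> 0 \<le> L ([:0, 1:] ^ i * [:1, -1:] ^ j)"
begin

lemma zero: "L 0 = 0"
  using smult[of 0 0] by simp

lemma sum: "L (\<Sum>i\<in>A. f i) = (\<Sum>i\<in>A. L (f i))"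
  by (induction A rule: infinite_finite_induct) (simp_all add: zero add)

text \<open>The value of \<open>L\<close> at a Bernstein basis polynomial. For positive
  \<open>n\<close> these values are probabilities on 0, ..., \<open>n\<close>, to be placed at the
  points \<open>k / n\<close>.\<close>

definition bernstein_weight :: "nat \<Rightarrow> nat \<Rightarrow> real" where
  "bernstein_weight n k = real (n choose k) * L ([:0, 1:] ^ k * [:1, -1:] ^ (n - k))"

lemma bernstein_weight_nonneg: "0 < n \<Longrightarrow> 0 \<le> bernstein_weight n k"
  unfolding bernstein_weight_def using nonneg[of k "n - k"] by (cases "k \<le> n") auto

text \<open>By C(n,k) C(k,m) = C(n,m) C(n-m,k-m) the sum reduces to the expansion of
  \<open>(x + (1 - x)) ^ (n - m)\<close>, which is 1. The factorial moments are thus exact for every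
  \<open>n\<close>, not only in the limit.\<close>

lemma binomial_moment:
  assumes "m \<le> n"
  shows "(\<Sum>k\<le>n. real (k choose m) * bernstein_weight n k) = real (n choose m) * L ([:0, 1:] ^ m)"
proof -
  let ?X = "[:0, 1:] :: real poly" and ?Y = "[:1, -1:] :: real poly"
  have "(\<Sum>k\<le>n. real (k choose m) * bernstein_weight n k) = (\<Sum>k\<in>{m..n}. real (k choose m) * bernstein_weight n k)"
    by (rule sum.mono_neutral_right) (auto simp: binomial_eq_0)
  also have "\<dots> = (\<Sum>k\<in>{m..n}. real (n choose m) * (real ((n - m) choose (k - m)) * L (?X ^ k * ?Y ^ (n - k))))"
  proof (rule sum.cong[OF refl])
    fix k assume "k \<in> {m..n}"
    then have "(n choose k) * (k choose m) = (n choose m) * ((n - m) choose (k - m))"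
      by (simp add: choose_mult)
    then have "real (n choose k) * real (k choose m) = real (n choose m) * real ((n - m) choose (k - m))"
      by (metis of_nat_mult)
    then show "real (k choose m) * bernstein_weight n k =
        real (n choose m) * (real ((n - m) choose (k - m)) * L (?X ^ k * ?Y ^ (n - k)))"
      unfolding bernstein_weight_def by (simp add: algebra_simps)
  qed
  also have "\<dots> = real (n choose m) * (\<Sum>k\<in>{m..n}. real ((n - m) choose (k - m)) * L (?X ^ k * ?Y ^ (n - k)))"
    by (simp add: sum_distrib_left)
  also have "(\<Sum>k\<in>{m..n}. real ((n - m) choose (k - m)) * L (?X ^ k * ?Y ^ (n - k)))
      = (\<Sum>k\<le>n - m. real ((n - m) choose k) * L (?X ^ (k + m) * ?Y ^ (n - m - k)))"
    by (rule sum.reindex_bij_witness[of _ "\<lambda>k. k + m" "\<lambda>k. k - m"]) (use assms in auto)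
  also have "\<dots> = L (?X ^ m * (\<Sum>k\<le>n - m. of_nat ((n - m) choose k) * ?X ^ k * ?Y ^ (n - m - k)))"
    by (simp add: sum_distrib_left sum of_nat_poly smult[symmetric] power_add mult_ac)
  also have "(\<Sum>k\<le>n - m. of_nat ((n - m) choose k) * ?X ^ k * ?Y ^ (n - m - k)) = (?X + ?Y) ^ (n - m)"
    by (rule binomial_ring[symmetric])
  also have "?X + ?Y = 1" by (simp add: one_pCons)
  finally show ?thesis by simp
qed

lemma sum_bernstein_weight: "(\<Sum>k\<le>n. bernstein_weight n k) = 1"
  using binomial_moment[of 0 n] by (simp add: one)

text \<open>Ordinary moments differ from the exact factorial ones by the error in
  \<open>falling_ratio_approx\<close>, and the weights have total mass 1. The index
  \<open>Suc n\<close> keeps the quotients \<open>k / n\<close> meaningful.\<close>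

lemma bernstein_moment_tendsto:
  "(\<lambda>n. \<Sum>k\<le>Suc n. (real k / real (Suc n)) ^ m * bernstein_weight (Suc n) k) \<longlonglongrightarrow> L ([:0, 1:] ^ m)"
proof (rule Lim_null[THEN iffD2], rule Lim_null_comparison)
  show "eventually (\<lambda>n. norm ((\<Sum>k\<le>Suc n. (real k / real (Suc n)) ^ m * bernstein_weight (Suc n) k) - L ([:0, 1:] ^ m))
      \<le> real m * (real m / (real (Suc n) - real m))) sequentially"
    using eventually_gt_at_top[of "2 * m"]
  proof eventually_elim
    case (elim n)
    have pos: "real (Suc n choose m) > 0" using elim by simp
    have "L ([:0, 1:] ^ m) = (\<Sum>k\<le>Suc n. real (k choose m) / real (Suc n choose m) * bernstein_weight (Suc n) k)"
      using binomial_moment[of m "Suc n"] elim pos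
      by (simp add: sum_divide_distrib[symmetric] field_simps del: sum.atMost_Suc binomial_Suc_Suc)
    then have "(\<Sum>k\<le>Suc n. (real k / real (Suc n)) ^ m * bernstein_weight (Suc n) k) - L ([:0, 1:] ^ m)
        = (\<Sum>k\<le>Suc n. ((real k / real (Suc n)) ^ m - real (k choose m) / real (Suc n choose m)) * bernstein_weight (Suc n) k)"
      by (simp only: sum_subtractf[symmetric] left_diff_distrib)
    also have "norm \<dots> \<le> (\<Sum>k\<le>Suc n. real m * (real m / (real (Suc n) - real m)) * bernstein_weight (Suc n) k)"
    proof (rule sum_norm_le)
      fix k assume "k \<in> {..Suc n}"
      then have "\<bar>(real k / real (Suc n)) ^ m - real (k choose m) / real (Suc n choose m)\<bar>
          \<le> real m * (real m / (real (Suc n) - real m))"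
        using elim by (intro falling_ratio_approx) auto
      then show "norm (((real k / real (Suc n)) ^ m - real (k choose m) / real (Suc n choose m)) * bernstein_weight (Suc n) k)
          \<le> real m * (real m / (real (Suc n) - real m)) * bernstein_weight (Suc n) k"
        using bernstein_weight_nonneg[OF zero_less_Suc, of n k]
        by (simp only: real_norm_def abs_mult abs_of_nonneg zero_less_Suc) (rule mult_right_mono)
    qed
    also have "\<dots> = real m * (real m / (real (Suc n) - real m))"
      using sum_bernstein_weight[of "Suc n"] by (simp only: sum_distrib_left[symmetric] mult_1_right)
    finally show ?case .
  qed
  show "(\<lambda>n. real m * (real m / (real (Suc n) - real m))) \<longlonglongrightarrow> 0"
    by real_asymp
qed

text \<open>Hausdorff's moment theorem: the discrete laws of \<open>k / n\<close> under the
  Bernstein weights form a tight sequence, and a weak limit of a subsequence has the required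
  moments.\<close>

theorem representing_measure:
  obtains M where "real_distribution M" "AE y in M. y \<in> {0..1}"
    "\<And>m. (\<integral>y. y ^ m \<partial>M) = L ([:0, 1:] ^ m)"
proof -
  define p where "p n = embed_pmf (\<lambda>k. if k \<le> Suc n then bernstein_weight (Suc n) k else 0)" for n
  have pmf: "pmf (p n) k = (if k \<le> Suc n then bernstein_weight (Suc n) k else 0)" for n k
    unfolding p_def
  proof (rule pmf_embed_pmf)
    have "(\<integral>\<^sup>+k. ennreal (if k \<le> Suc n then bernstein_weight (Suc n) k else 0) \<partial>count_space UNIV)
        = (\<Sum>k\<le>Suc n. ennreal (if k \<le> Suc n then bernstein_weight (Suc n) k else 0))"
      by (rule nn_integral_count_space') auto
    also have "\<dots> = ennreal (\<Sum>k\<le>Suc n. bernstein_weight (Suc n) k)"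
      using bernstein_weight_nonneg[of "Suc n"] by (subst sum_ennreal[symmetric]) (auto intro!: sum.cong simp del: sum.atMost_Suc)
    also have "\<dots> = 1" by (simp only: sum_bernstein_weight ennreal_1)
    finally show "(\<integral>\<^sup>+k. ennreal (if k \<le> Suc n then bernstein_weight (Suc n) k else 0) \<partial>count_space UNIV) = 1" .
  qed (use bernstein_weight_nonneg in auto)
  define \<mu> where "\<mu> n = distr (measure_pmf (p n)) borel (\<lambda>k. real k / real (Suc n))" for n
  have rd: "real_distribution (\<mu> n)" for n
    unfolding \<mu>_def by (intro real_distribution.intro real_distribution_axioms.intro prob_space.prob_space_distr)
      (auto simp: measure_pmf.prob_space_axioms)
  have int: "(\<integral>y. \<phi> y \<partial>\<mu> n) = (\<Sum>k\<le>Suc n. \<phi> (real k / real (Suc n)) * bernstein_weight (Suc n) k)"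
    if "\<phi> \<in> borel_measurable borel" for \<phi> :: "real \<Rightarrow> real" and n
  proof -
    have "(\<integral>y. \<phi> y \<partial>\<mu> n) = (\<integral>k. \<phi> (real k / real (Suc n)) \<partial>measure_pmf (p n))"
      unfolding \<mu>_def using that by (subst integral_distr) auto
    also have "\<dots> = (\<Sum>k\<le>Suc n. \<phi> (real k / real (Suc n)) * pmf (p n) k)"
      by (rule integral_measure_pmf_real) (auto simp: set_pmf_iff pmf split: if_splits)
    finally show ?thesis by (simp add: pmf del: sum.atMost_Suc)
  qed
  have "tight \<mu>"
    unfolding tight_def
  proof (intro conjI allI impI)
    fix \<epsilon> :: real assume "0 < \<epsilon>"
    \<comment> \<open>\<open>tight\<close> is phrased with intervals open on the left, so the left
      end must lie strictly below 0 to capture the point 0.\<close>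
    have "measure (\<mu> n) {-1<..1} = 1" for n
    proof -
      have "measure (\<mu> n) {-1<..1} = (\<integral>y. indicator {-1<..1} y \<partial>\<mu> n)"
        using rd[of n] by (simp add: real_distribution.space_eq_univ real_distribution.events_eq_borel)
      also have "\<dots> = (\<Sum>k\<le>Suc n. indicator {-1<..1} (real k / real (Suc n)) * bernstein_weight (Suc n) k)"
        by (rule int) auto
      also have "\<dots> = (\<Sum>k\<le>Suc n. bernstein_weight (Suc n) k)"
        by (intro sum.cong refl) (auto simp: indicator_def divide_le_eq less_le_trans[of "-1" 0])
      finally show ?thesis by (simp only: sum_bernstein_weight)
    qed
    then show "\<exists>a b. a < b \<and> (\<forall>n. 1 - \<epsilon> < measure (\<mu> n) {a<..b})"
      using \<open>0 < \<epsilon>\<close> by (intro exI[of _ "-1"] exI[of _ 1]) auto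
  qed (rule rd)
  then obtain r M where r: "strict_mono (r :: nat \<Rightarrow> nat)" and M: "real_distribution M"
    and conv: "weak_conv_m (\<mu> \<circ> id \<circ> r) M"
    using tight_imp_convergent_subsubsequence[of \<mu> id] by (auto simp: strict_mono_def)
  interpret M: real_distribution M by (rule M)
  \<comment> \<open>Weak convergence tests only bounded continuous functions. Clamping makes the
    powers bounded, does not change the points \<open>k / n\<close>, and has an image law carried by
    the unit interval.\<close>
  define cl :: "real \<Rightarrow> real" where "cl y = max 0 (min 1 y)" for y
  have cl: "isCont cl y" "0 \<le> cl y" "cl y \<le> 1" for y
    unfolding cl_def[abs_def] by (auto intro!: continuous_intros)
  have clm[measurable]: "cl \<in> borel_measurable borel"
    using cl by (intro borel_measurable_continuous_onI continuous_at_imp_continuous_on) auto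
  have moment: "(\<integral>y. cl y ^ m \<partial>M) = L ([:0, 1:] ^ m)" for m
  proof (rule LIMSEQ_unique)
    have "(\<lambda>n. \<integral>y. cl y ^ m \<partial>((\<mu> \<circ> id \<circ> r) n)) \<longlonglongrightarrow> (\<integral>y. cl y ^ m \<partial>M)"
      using cl by (intro weak_conv_imp_integral_bdd_continuous_conv[of _ _ _ 1] conv M)
        (auto intro!: continuous_intros power_le_one simp: rd)
    moreover have "(\<integral>y. cl y ^ m \<partial>((\<mu> \<circ> id \<circ> r) n)) =
        (\<Sum>k\<le>Suc (r n). (real k / real (Suc (r n))) ^ m * bernstein_weight (Suc (r n)) k)" for n
    proof -
      have "(\<integral>y. cl y ^ m \<partial>\<mu> (r n)) =
        (\<Sum>k\<le>Suc (r n). cl (real k / real (Suc (r n))) ^ m * bernstein_weight (Suc (r n)) k)"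
        by (rule int) measurable
      also have "\<dots> = (\<Sum>k\<le>Suc (r n). (real k / real (Suc (r n))) ^ m * bernstein_weight (Suc (r n)) k)"
      proof (rule sum.cong[OF refl])
        fix k assume "k \<in> {..Suc (r n)}"
        then have "cl (real k / real (Suc (r n))) = real k / real (Suc (r n))" by (simp add: cl_def)
        then show "cl (real k / real (Suc (r n))) ^ m * bernstein_weight (Suc (r n)) k =
          (real k / real (Suc (r n))) ^ m * bernstein_weight (Suc (r n)) k" by (simp only:)
      qed
      finally show ?thesis by simp
    qed
    ultimately show "(\<lambda>n. \<Sum>k\<le>Suc (r n). (real k / real (Suc (r n))) ^ m * bernstein_weight (Suc (r n)) k)
        \<longlonglongrightarrow> (\<integral>y. cl y ^ m \<partial>M)" by (simp only:)
    show "(\<lambda>n. \<Sum>k\<le>Suc (r n). (real k / real (Suc (r n))) ^ m * bernstein_weight (Suc (r n)) k)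
        \<longlonglongrightarrow> L ([:0, 1:] ^ m)"
      using LIMSEQ_subseq_LIMSEQ[OF bernstein_moment_tendsto r] by (simp only: o_def)
  qed
  show ?thesis
  proof (rule that[of "distr M borel cl"])
    show "real_distribution (distr M borel cl)"
      by (intro real_distribution.intro real_distribution_axioms.intro M.prob_space_distr) auto
    show "AE y in distr M borel cl. y \<in> {0..1}"
      by (subst AE_distr_iff) (auto simp: cl)
    show "(\<integral>y. y ^ m \<partial>distr M borel cl) = L ([:0, 1:] ^ m)" for m
      by (subst integral_distr) (auto simp: moment)
  qed
qed

end

section \<open>The moment functional of the cycle values and the spectral measure\<close>

definition moment_functional :: "(nat \<Rightarrow> real) \<Rightarrow> real poly \<Rightarrow> real" where
  "moment_functional s q = (\<Sum>i\<le>degree q. coeff q i * s i)"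

lemma moment_functional_bound:
  "degree q \<le> N \<Longrightarrow> moment_functional s q = (\<Sum>i\<le>N. coeff q i * s i)"
  unfolding moment_functional_def by (rule sum.mono_neutral_left) (auto simp: coeff_eq_0)

lemma moment_functional_add:
  "moment_functional s (p + q) = moment_functional s p + moment_functional s q"
proof -
  let ?N = "max (degree p) (degree q)"
  show ?thesis
    using moment_functional_bound[of p ?N s] moment_functional_bound[of q ?N s]
      moment_functional_bound[of "p + q" ?N s] degree_add_le_max[of p q]
    by (simp add: sum.distrib distrib_right)
qed

lemma moment_functional_smult: "moment_functional s (smult c p) = c * moment_functional s p"
  using moment_functional_bound[OF degree_smult_le[of c p], of s]
  by (simp add: moment_functional_def sum_distrib_left mult.assoc)

lemma moment_functional_sum: "moment_functional s (\<Sum>i\<in>A. f i) = (\<Sum>i\<in>A. moment_functional s (f i))"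
proof (induction A rule: infinite_finite_induct)
  case empty show ?case by (simp add: moment_functional_def)
next
  case (infinite A) then show ?case by (simp add: moment_functional_def)
qed (simp add: moment_functional_add)

lemma moment_functional_monom: "moment_functional s (monom 1 n) = s n"
proof -
  have "(\<Sum>i\<le>n. (if n = i then 1 else 0) * s i) = (\<Sum>i\<in>{n}. s i)"
    by (rule sum.mono_neutral_cong_right) auto
  then show ?thesis by (simp add: moment_functional_def degree_monom_eq)
qed

lemma moment_functional_square:
  "moment_functional s ([:1, e:] * (q * q)) =
    (\<Sum>a\<le>degree q. \<Sum>b\<le>degree q. coeff q a * coeff q b * (s (a + b) + e * s (Suc (a + b))))"
proof -
  have q: "q = (\<Sum>a\<le>degree q. smult (coeff q a) (monom 1 a))"
    using poly_as_sum_of_monoms[of q] by (simp add: smult_monom)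
  have e: "[:1, e:] * monom 1 n = monom 1 n + smult e (monom 1 (Suc n))" for n
    by (simp add: monom_Suc)
  have "q * q = (\<Sum>a\<le>degree q. \<Sum>b\<le>degree q. smult (coeff q a * coeff q b) (monom 1 (a + b)))"
    by (subst (1 2) q) (simp add: sum_product mult_monom mult_ac smult_monom)
  then have "[:1, e:] * (q * q) = (\<Sum>a\<le>degree q. \<Sum>b\<le>degree q. smult (coeff q a * coeff q b) ([:1, e:] * monom 1 (a + b)))"
    by (simp only: sum_distrib_left mult_smult_right)
  then show ?thesis
    by (simp only: moment_functional_sum moment_functional_smult e moment_functional_add moment_functional_monom)
qed

lemma count_list_replicate: "count_list (replicate n x) y = (if x = y then n else 0)"
  by (induction n) auto

lemma sum_bool: "sum f (UNIV :: bool set) = f False + f True"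
  by (simp add: UNIV_bool)

context multiplicative_character
begin

lemma orbit_prod_id_pair: "orbit_prod P id {0::nat, 1} e = P (e 0) * P (e 1)"
  using orbit_prod_insert_fixed[of id "{1::nat}" 0 P e] orbit_prod_insert_fixed[of id "{}" "1::nat" P e]
    permutes_id by simp

lemma orbit_prod_transpose_pair: "orbit_prod P (transpose 0 1) {0::nat, 1} e = P (e 0 + e 1)"
  using orbit_prod_cycle_comp[of "[0::nat, 1]" id "{}" P e] permutes_id by simp

text \<open>The test vectors are \<open>1 + e t\<close> times words in the letter 0, with
  \<open>t\<close> the transposition of 0 and 1. If the permutations of two terms agree, point 1
  stays fixed; otherwise it joins the cycle of 0 and raises the moment by one. The result is
  positivity of \<open>1 + e x\<close> against squares, the source of the interval [-1, 1].\<close>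

lemma moment_functional_pos:
  assumes e: "e = 1 \<or> e = (-1::real)"
  shows "0 \<le> moment_functional (\<lambda>i. cyc (Suc i)) ([:1, e:] * (q * q))"
proof -
  let ?s = "\<lambda>u::bool \<times> nat. if fst u then transpose 0 1 else (id :: nat \<Rightarrow> nat)"
  let ?c = "\<lambda>u::bool \<times> nat. coeff q (snd u) * (if fst u then e else 1)"
  let ?ws = "\<lambda>u::bool \<times> nat. replicate (snd u) (0::nat)"
  have t: "transpose 0 1 \<circ> transpose 0 1 = (id :: nat \<Rightarrow> nat)" by (rule transpose_comp_involutory)
  let ?W = "\<lambda>u v. orbit_prod cyc (inv (?s u) \<circ> ?s v) {0, 1} (\<lambda>x. 1 + count_list (?ws u) x + count_list (?ws v) x)"
  let ?F = "\<lambda>u v. ?c u * ?c v * ?W u v"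
  let ?S = "\<lambda>a b. cyc (Suc (a + b)) + e * cyc (Suc (Suc (a + b)))"
  have W: "?W (x, a) (y, b) = (if x = y then cyc (Suc (a + b)) else cyc (Suc (Suc (a + b))))" for x y a b
    by (cases x; cases y) (simp_all add: t orbit_prod_id_pair orbit_prod_transpose_pair count_list_replicate del: One_nat_def, simp_all)
  have F: "(\<Sum>x\<in>UNIV. \<Sum>y\<in>UNIV. ?F (x, a) (y, b)) = 2 * (coeff q a * coeff q b * ?S a b)" for a b
    unfolding W sum_bool using e by (elim disjE) (simp_all add: algebra_simps)
  have "0 \<le> (\<Sum>u\<in>UNIV \<times> {..degree q}. \<Sum>v\<in>UNIV \<times> {..degree q}. ?F u v)"
    by (rule orbit_prod_positive) (auto intro: permutes_id permutes_swap_id)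
  also have "\<dots> = (\<Sum>x\<in>UNIV. \<Sum>a\<le>degree q. \<Sum>y\<in>UNIV. \<Sum>b\<le>degree q. ?F (x, a) (y, b))"
    by (simp only: sum.cartesian_product')
  also have "\<dots> = (\<Sum>a\<le>degree q. \<Sum>x\<in>UNIV. \<Sum>y\<in>UNIV. \<Sum>b\<le>degree q. ?F (x, a) (y, b))"
    by (rule sum.swap)
  also have "\<dots> = (\<Sum>a\<le>degree q. \<Sum>x\<in>UNIV. \<Sum>b\<le>degree q. \<Sum>y\<in>UNIV. ?F (x, a) (y, b))"
    by (intro sum.cong refl sum.swap)
  also have "\<dots> = (\<Sum>a\<le>degree q. \<Sum>b\<le>degree q. \<Sum>x\<in>UNIV. \<Sum>y\<in>UNIV. ?F (x, a) (y, b))"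
    by (intro sum.cong refl sum.swap)
  also have "\<dots> = 2 * (\<Sum>a\<le>degree q. \<Sum>b\<le>degree q. coeff q a * coeff q b * ?S a b)"
    by (simp only: F sum_distrib_left)
  finally show ?thesis unfolding moment_functional_square by simp
qed

text \<open>Splitting off squares leaves exponents 0 or 1. For two even exponents, 1 is half of
  \<open>(1 + x) + (1 - x)\<close>; for two odd ones, \<open>2 (1 + x) (1 - x)\<close> equals
  \<open>(1 + x) (1 - x)^2 + (1 - x) (1 + x)^2\<close>.\<close>

lemma basis_functional_pos:
  assumes ij: "0 < i + j"
  shows "0 \<le> moment_functional (\<lambda>i. cyc (Suc i)) ([:1, 1:] ^ i * [:1, -1:] ^ j)"
proof -
  let ?L = "moment_functional (\<lambda>i. cyc (Suc i))"
  let ?A = "[:1, 1:] :: real poly" and ?B = "[:1, -1:] :: real poly"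
  define q where "q = ?A ^ (i div 2) * ?B ^ (j div 2)"
  have A: "0 \<le> ?L (?A * (q * q))" and B: "0 \<le> ?L (?B * (q * q))" for q
    using moment_functional_pos[of 1 q] moment_functional_pos[of "-1" q] by auto
  have pw: "x ^ k = x ^ (k mod 2) * (x ^ (k div 2) * x ^ (k div 2))" for x :: "real poly" and k
    by (metis mod_mult_div_eq mult.commute power_add power_mult power2_eq_square)
  have eq: "?A ^ i * ?B ^ j = (?A ^ (i mod 2) * ?B ^ (j mod 2)) * (q * q)"
    unfolding q_def by (subst pw[of ?A i], subst pw[of ?B j]) (simp only: mult_ac)
  consider "even i" "even j" | "even i" "odd j" | "odd i" "even j" | "odd i" "odd j" by blast
  then show ?thesis
  proof cases
    case 1
    have "?A ^ i * ?B ^ j = smult (1/2) (?A * (q * q) + ?B * (q * q))"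
    proof -
      have "smult (1/2) (?A * (q * q) + ?B * (q * q)) = smult (1/2) ((?A + ?B) * (q * q))"
        by (simp only: distrib_right)
      also have "?A + ?B = [:2:]" by simp
      finally show ?thesis using 1 unfolding eq by (simp add: even_iff_mod_2_eq_zero)
    qed
    then show ?thesis using A[of q] B[of q]
      by (simp only: moment_functional_smult moment_functional_add) simp
  next
    case 2
    then show ?thesis unfolding eq using B[of q] by (simp add: even_iff_mod_2_eq_zero odd_iff_mod_2_eq_one)
  next
    case 3
    then show ?thesis unfolding eq using A[of q] by (simp add: even_iff_mod_2_eq_zero odd_iff_mod_2_eq_one)
  next
    case 4
    have "?A * ((?B * q) * (?B * q)) + ?B * ((?A * q) * (?A * q)) = (?A + ?B) * (?A * ?B * (q * q))"
      by (simp only: algebra_simps)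
    also have "?A + ?B = [:2:]" by simp
    also have "[:2:] * (?A * ?B * (q * q)) = smult 2 (?A ^ i * ?B ^ j)"
      using 4 unfolding eq by (simp add: odd_iff_mod_2_eq_one)
    finally have "2 * ?L (?A ^ i * ?B ^ j) = ?L (?A * ((?B * q) * (?B * q))) + ?L (?B * ((?A * q) * (?A * q)))"
      by (metis moment_functional_smult moment_functional_add)
    then show ?thesis using A[of "?B * q"] B[of "?A * q"] by linarith
  qed
qed

lemma pcompose_power: "pcompose (p ^ n) q = pcompose p q ^ n" for p q :: "real poly"
  by (induction n) (simp_all add: pcompose_1 pcompose_mult)

lemma moment_functional_one: "moment_functional (\<lambda>i. cyc (Suc i)) 1 = 1"
  using moment_functional_monom[of "\<lambda>i. cyc (Suc i)" 0] by simp

text \<open>The substitution \<open>y = (1 + x) / 2\<close> leads to the moment problem on the unit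
  interval; the measure found there is carried back by \<open>2 * y - 1\<close>.\<close>

theorem spectral_measure:
  obtains M where "real_distribution M" "AE x in M. x \<in> {-1..1}"
    "\<And>m. (\<integral>x. x ^ m \<partial>M) = cyc (Suc m)"
proof -
  let ?L = "moment_functional (\<lambda>i. cyc (Suc i))"
  let ?X = "[:1/2, 1/2:] :: real poly"
  have c: "pcompose [:0, 1:] ?X = smult (1/2) [:1, 1:]" "pcompose [:1, -1:] ?X = smult (1/2) [:1, -1:]"
    by (simp_all add: pcompose_pCons)
  interpret positive_functional "\<lambda>q. ?L (pcompose q ?X)"
  proof
    show "0 \<le> ?L (pcompose ([:0, 1:] ^ i * [:1, -1:] ^ j) ?X)" if "0 < i + j" for i j
    proof -
      have "pcompose ([:0, 1:] ^ i * [:1, -1:] ^ j) ?X = smult ((1/2) ^ i * (1/2) ^ j) ([:1, 1:] ^ i * [:1, -1:] ^ j)"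
        unfolding pcompose_mult pcompose_power c smult_power by (simp only: mult_smult_left mult_smult_right smult_smult mult_ac)
      then show ?thesis
        using basis_functional_pos[OF that] by (simp only: moment_functional_smult) (simp del: mult_pCons_left)
    qed
  qed (simp_all add: pcompose_add pcompose_smult moment_functional_add moment_functional_smult
      pcompose_1 moment_functional_one)
  obtain M where M: "real_distribution M" "AE y in M. y \<in> {0..1}"
    "\<And>m. (\<integral>y. y ^ m \<partial>M) = ?L (pcompose ([:0, 1:] ^ m) ?X)"
    using representing_measure by blast
  interpret M: real_distribution M by fact
  have int: "integrable M (\<lambda>y. y ^ m)" for m
    by (rule M.integrable_const_bound[of _ 1]) (use eventually_mono[OF M(2), of "\<lambda>y. norm (y ^ m) \<le> 1"] in \<open>auto simp: power_le_one\<close>)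
  have poly: "(\<integral>y. poly q y \<partial>M) = ?L (pcompose q ?X)" for q
  proof -
    have "q = (\<Sum>i\<le>degree q. smult (coeff q i) ([:0, 1:] ^ i))"
      using poly_as_sum_of_monoms[of q] by (simp add: smult_monom monom_altdef)
    then have "?L (pcompose q ?X) = (\<Sum>i\<le>degree q. coeff q i * ?L (pcompose ([:0, 1:] ^ i) ?X))"
      by (metis (no_types, lifting) sum smult sum.cong)
    then show ?thesis
      unfolding poly_altdef using int by (simp add: M(3))
  qed
  show ?thesis
  proof (rule that[of "distr M borel (\<lambda>y. 2 * y - 1)"])
    show "real_distribution (distr M borel (\<lambda>y. 2 * y - 1))"
      by (intro real_distribution.intro real_distribution_axioms.intro M.prob_space_distr) auto
    show "AE x in distr M borel (\<lambda>y. 2 * y - 1). x \<in> {-1..1}"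
      using M(2) by (subst AE_distr_iff) (auto elim!: eventually_mono)
    fix m
    have "(\<integral>x. x ^ m \<partial>distr M borel (\<lambda>y. 2 * y - 1)) = (\<integral>y. poly ([:-1, 2:] ^ m) y \<partial>M)"
      by (subst integral_distr) (auto intro!: Bochner_Integration.integral_cong simp: algebra_simps)
    also have "\<dots> = ?L ([:0, 1:] ^ m)"
      unfolding poly pcompose_power by (simp add: pcompose_pCons)
    also have "\<dots> = cyc (Suc m)"
      using moment_functional_monom[of _ m] by (simp add: monom_altdef)
    finally show "(\<integral>x. x ^ m \<partial>distr M borel (\<lambda>y. 2 * y - 1)) = cyc (Suc m)" .
  qed
qed

end

section \<open>Spectral measure and orbit sums\<close>

lemma count_list_concat_replicate:
  "distinct xs \<Longrightarrow> count_list (concat (map (\<lambda>i. replicate (f i) i) xs)) x = (if x \<in> set xs then f x else 0)"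
  by (induction xs) (auto simp: count_list_replicate)

lemma sum_permutations_inv_comp:
  assumes "u permutes D"
  shows "(\<Sum>v | v permutes D. f (inv u \<circ> v)) = (\<Sum>w | w permutes D. f w)"
  by (rule sum.reindex_bij_witness[of _ "\<lambda>w. u \<circ> w" "\<lambda>v. inv u \<circ> v"])
    (use assms in \<open>auto intro: permutes_compose permutes_inv simp: fun_eq_iff permutes_inverses\<close>)

text \<open>Words yield only polynomials in the operators, so spectral projections have to be
  approximated. The cut-off \<open>h n\<close> converges to the indicator because \<open>E\<close>
  is closed, Stone-Weierstrass replaces it by a polynomial up to \<open>1 / Suc n\<close>, and the
  bound 2 is 1 plus this error.\<close>

lemma polynomials_tendsto_indicator:
  fixes E :: "real set"
  assumes E: "closed E"
  obtains r :: "nat \<Rightarrow> real poly" where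
    "\<And>n x. x \<in> {-1..1} \<Longrightarrow> \<bar>poly (r n) x\<bar> \<le> 2"
    "\<And>x. x \<in> {-1..1} \<Longrightarrow> (\<lambda>n. poly (r n) x) \<longlonglongrightarrow> indicator E x"
proof (cases "E = {}")
  \<comment> \<open>The distance to the empty set is 0 by convention, so the cut-off used below
    would not vanish.\<close>
  case True
  then show ?thesis by (intro that[of "\<lambda>_. 0"]) auto
next
  case False
  define h where "h n x = max 0 (1 - real n * infdist x E)" for n x
  have hc: "continuous_on {-1..1} (h n)" for n
    unfolding h_def[abs_def] by (intro continuous_intros)
  have hb: "0 \<le> h n x" "h n x \<le> 1" for n x
    unfolding h_def by (auto simp: infdist_nonneg)
  have hl: "(\<lambda>n. h n x) \<longlonglongrightarrow> indicator E x" for x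
  proof (cases "x \<in> E")
    case True
    then show ?thesis by (simp add: h_def)
  next
    case nin: False
    then have pos: "infdist x E > 0" using infdist_pos_not_in_closed[OF E False] by simp
    obtain N :: nat where N: "1 < real N * infdist x E" using reals_Archimedean3[OF pos] by blast
    then have "h n x = 0" if "n \<ge> N" for n
    proof -
      have "real N * infdist x E \<le> real n * infdist x E"
        using that pos by (intro mult_right_mono) auto
      then show ?thesis using N unfolding h_def by linarith
    qed
    then show ?thesis using nin
      by (auto intro!: tendsto_eventually exI[of _ N] simp: eventually_sequentially)
  qed
  have "\<exists>p. \<forall>x\<in>{-1..1}. \<bar>h n x - poly p x\<bar> < 1 / real (Suc n)" for n
  proof -
    obtain f where f: "real_polynomial_function f" "\<And>x. x \<in> {-1..1} \<Longrightarrow> \<bar>h n x - f x\<bar> < 1 / real (Suc n)"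
      using Stone_Weierstrass_real_polynomial_function[OF compact_Icc hc, of "1 / real (Suc n)" n] by auto
    obtain a N where "f = (\<lambda>x. \<Sum>i\<le>N. a i * x ^ i)"
      using f(1) unfolding real_polynomial_function_iff_sum by blast
    then have "f x = poly (\<Sum>i\<le>N. monom (a i) i) x" for x
      by (simp add: poly_sum poly_monom)
    then show ?thesis using f(2) by metis
  qed
  then obtain r where r: "\<And>n x. x \<in> {-1..1} \<Longrightarrow> \<bar>h n x - poly (r n) x\<bar> < 1 / real (Suc n)"
    by metis
  show ?thesis
  proof (rule that[of r])
    fix n :: nat and x :: real assume x: "x \<in> {-1..1}"
    have "1 / real (Suc n) \<le> 1" by simp
    then show "\<bar>poly (r n) x\<bar> \<le> 2" using r[OF x, of n] hb[of n x] by linarith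
  next
    fix x :: real assume x: "x \<in> {-1..1}"
    have "(\<lambda>n. h n x - poly (r n) x) \<longlonglongrightarrow> 0"
    proof (rule Lim_null_comparison)
      show "\<forall>\<^sub>F n in sequentially. norm (h n x - poly (r n) x) \<le> 1 / real (Suc n)"
        by (intro always_eventually allI, subst real_norm_def, rule less_imp_le, rule r[OF x])
    qed real_asymp
    from tendsto_diff[OF hl[of x] this] show "(\<lambda>n. poly (r n) x) \<longlonglongrightarrow> indicator E x" by simp
  qed
qed

locale measure_on_Icc = real_distribution M for M +
  assumes AE_Icc: "AE x in M. x \<in> {-1..1}"
begin

lemma integrable_bounded_on_Icc:
  fixes f :: "real \<Rightarrow> real"
  assumes "f \<in> borel_measurable borel" "\<And>x. x \<in> {-1..1} \<Longrightarrow> \<bar>f x\<bar> \<le> B"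
  shows "integrable M f"
proof (rule integrable_const_bound[of _ B])
  show "AE x in M. norm (f x) \<le> B"
    using AE_Icc by eventually_elim (use assms(2) in auto)
qed (use assms(1) in simp)

lemma integrable_continuous:
  fixes f :: "real \<Rightarrow> real"
  assumes "continuous_on UNIV f"
  shows "integrable M f"
proof -
  have "compact (f ` {-1..1})"
    using assms by (intro compact_continuous_image) (auto intro: continuous_on_subset)
  then obtain B where "\<And>x. x \<in> {-1..1} \<Longrightarrow> \<bar>f x\<bar> \<le> B"
    using compact_imp_bounded bounded_iff by (metis imageI real_norm_def)
  then show ?thesis
    using assms by (intro integrable_bounded_on_Icc) (auto intro: borel_measurable_continuous_onI)
qed

text \<open>Both sides are integrals over the product space with one coordinate per orbit, with equal integrands.\<close>
lemma sum_prod_integral: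
  fixes r :: "real poly"
  assumes D: "finite D" and p: "p permutes D"
  defines "A \<equiv> PiE D (\<lambda>_. {..degree r})"
  shows "(\<Sum>a\<in>A. \<Sum>b\<in>A. (\<Prod>i\<in>D. coeff r (a i)) * (\<Prod>i\<in>D. coeff r (b i)) *
      (\<Prod>C\<in>orbits p D. \<integral>x. x ^ (card C - 1) * (\<Prod>i\<in>C. x ^ a i * x ^ b i) \<partial>M))
    = (\<Prod>C\<in>orbits p D. \<integral>x. x ^ (card C - 1) * poly r x ^ (2 * card C) \<partial>M)"
proof -
  interpret P: product_sigma_finite "\<lambda>_. M"
    by standard
  let ?P = "orbits p D"
  let ?PM = "Pi\<^sub>M ?P (\<lambda>_. M)"
  have pD: "p ` D \<subseteq> D" using permutes_image[OF p] by simp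
  have fP: "finite ?P" by (rule finite_orbits[OF D])
  note prodD = prod_orbits[OF D permutes_inj[OF p] pD]
  have fA: "finite A" unfolding A_def using D by (intro finite_PiE) auto
  have i1: "integrable M (\<lambda>x. x ^ (card C - 1) * (\<Prod>i\<in>C. x ^ a i * x ^ b i))" for C and a b :: "_ \<Rightarrow> nat"
    by (intro integrable_continuous continuous_intros)
  have i2: "integrable M (\<lambda>x. x ^ (card C - 1) * poly r x ^ (2 * card C))" for C :: "'a set"
    by (intro integrable_continuous continuous_intros)
  have pt: "(\<Sum>a\<in>A. \<Sum>b\<in>A. (\<Prod>i\<in>D. coeff r (a i)) * (\<Prod>i\<in>D. coeff r (b i)) *
      (\<Prod>C\<in>?P. x C ^ (card C - 1) * (\<Prod>i\<in>C. x C ^ a i * x C ^ b i)))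
    = (\<Prod>C\<in>?P. x C ^ (card C - 1) * poly r (x C) ^ (2 * card C))" for x :: "_ \<Rightarrow> real"
  proof -
    \<comment> \<open>\<open>y i\<close> is the variable of the orbit that contains
      \<open>i\<close>. It turns products over orbits into products over points, where the sums over
      exponents factorize.\<close>
    define y where "y i = x (THE C. C \<in> ?P \<and> i \<in> C)" for i
    have y: "y i = x C" if "C \<in> ?P" "i \<in> C" for C i
    proof -
      have "(THE C. C \<in> ?P \<and> i \<in> C) = C"
        using that orbits_disjoint[of _ p D C] by (intro the_equality) blast+
      then show ?thesis by (simp add: y_def)
    qed
    have rw: "(\<Prod>C\<in>?P. x C ^ (card C - 1) * (\<Prod>i\<in>C. x C ^ a i * x C ^ b i))
        = (\<Prod>C\<in>?P. x C ^ (card C - 1)) * ((\<Prod>i\<in>D. y i ^ a i) * (\<Prod>i\<in>D. y i ^ b i))" for a b :: "_ \<Rightarrow> nat"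
    proof -
      have "(\<Prod>C\<in>?P. x C ^ (card C - 1) * (\<Prod>i\<in>C. x C ^ a i * x C ^ b i))
        = (\<Prod>C\<in>?P. x C ^ (card C - 1)) * (\<Prod>C\<in>?P. \<Prod>i\<in>C. y i ^ a i * y i ^ b i)"
        unfolding prod.distrib[symmetric] by (rule prod.cong[OF refl], rule arg_cong2[where f="(*)", OF refl], rule prod.cong[OF refl], metis y)
      then show ?thesis by (simp only: prodD prod.distrib)
    qed
    have S: "(\<Sum>a\<in>A. \<Prod>i\<in>D. coeff r (a i) * y i ^ a i) = (\<Prod>i\<in>D. poly r (y i))"
      unfolding A_def poly_altdef using D by (subst prod_sum_PiE) auto
    have "(\<Sum>a\<in>A. \<Sum>b\<in>A. (\<Prod>i\<in>D. coeff r (a i)) * (\<Prod>i\<in>D. coeff r (b i)) *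
        (\<Prod>C\<in>?P. x C ^ (card C - 1) * (\<Prod>i\<in>C. x C ^ a i * x C ^ b i)))
      = (\<Prod>C\<in>?P. x C ^ (card C - 1)) * (\<Sum>a\<in>A. \<Sum>b\<in>A. (\<Prod>i\<in>D. coeff r (a i) * y i ^ a i) * (\<Prod>i\<in>D. coeff r (b i) * y i ^ b i))"
      unfolding rw sum_distrib_left by (intro sum.cong refl) (simp only: prod.distrib mult_ac)
    also have "\<dots> = (\<Prod>C\<in>?P. x C ^ (card C - 1)) * ((\<Prod>i\<in>D. poly r (y i)) * (\<Prod>i\<in>D. poly r (y i)))"
      by (simp only: sum_product[symmetric] S)
    also have "(\<Prod>i\<in>D. poly r (y i)) = (\<Prod>C\<in>?P. poly r (x C) ^ card C)"
    proof -
      have "(\<Prod>i\<in>D. poly r (y i)) = (\<Prod>C\<in>?P. \<Prod>i\<in>C. poly r (y i))" by (simp only: prodD)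
      also have "\<dots> = (\<Prod>C\<in>?P. \<Prod>i\<in>C. poly r (x C))" by (rule prod.cong[OF refl], rule prod.cong[OF refl], metis y)
      finally show ?thesis by simp
    qed
    finally show ?thesis
      by (simp only: prod.distrib[symmetric] mult_2 power_add)
  qed
  have "(\<Sum>a\<in>A. \<Sum>b\<in>A. (\<Prod>i\<in>D. coeff r (a i)) * (\<Prod>i\<in>D. coeff r (b i)) *
      (\<Prod>C\<in>?P. \<integral>x. x ^ (card C - 1) * (\<Prod>i\<in>C. x ^ a i * x ^ b i) \<partial>M))
    = (\<Sum>a\<in>A. \<Sum>b\<in>A. \<integral>x. (\<Prod>i\<in>D. coeff r (a i)) * (\<Prod>i\<in>D. coeff r (b i)) *
      (\<Prod>C\<in>?P. x C ^ (card C - 1) * (\<Prod>i\<in>C. x C ^ a i * x C ^ b i)) \<partial>?PM)"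
    by (simp add: P.product_integral_prod[OF fP i1] del: One_nat_def)
  also have "\<dots> = (\<integral>x. (\<Sum>a\<in>A. \<Sum>b\<in>A. (\<Prod>i\<in>D. coeff r (a i)) * (\<Prod>i\<in>D. coeff r (b i)) *
      (\<Prod>C\<in>?P. x C ^ (card C - 1) * (\<Prod>i\<in>C. x C ^ a i * x C ^ b i))) \<partial>?PM)"
    (is "_ = (\<integral>x. (\<Sum>a\<in>A. \<Sum>b\<in>A. ?T a b x) \<partial>?PM)")
  proof -
    have int: "integrable ?PM (?T a b)" for a b
      by (intro integrable_mult_right P.product_integrable_prod[OF fP i1])
    have "(\<integral>x. (\<Sum>a\<in>A. \<Sum>b\<in>A. ?T a b x) \<partial>?PM) = (\<Sum>a\<in>A. \<integral>x. (\<Sum>b\<in>A. ?T a b x) \<partial>?PM)"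
      by (rule Bochner_Integration.integral_sum, rule Bochner_Integration.integrable_sum, rule int)
    also have "\<dots> = (\<Sum>a\<in>A. \<Sum>b\<in>A. \<integral>x. ?T a b x \<partial>?PM)"
      by (rule sum.cong[OF refl], rule Bochner_Integration.integral_sum, rule int)
    finally show ?thesis by (rule sym)
  qed
  also have "\<dots> = (\<integral>x. (\<Prod>C\<in>?P. x C ^ (card C - 1) * poly r (x C) ^ (2 * card C)) \<partial>?PM)"
    by (simp only: pt)
  also have "\<dots> = (\<Prod>C\<in>?P. \<integral>x. x ^ (card C - 1) * poly r x ^ (2 * card C) \<partial>M)"
    by (rule P.product_integral_prod[OF fP i2])
  finally show ?thesis .
qed

end

context multiplicative_character
begin

text \<open>This is positivity at the sum over \<open>u\<close> of \<open>\<sigma> u\<close> times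
  \<open>u\<close> times the product of \<open>r\<close> at the operators of all letters in
  \<open>D\<close>. Multiplicativity of \<open>\<sigma>\<close> makes a term depend on
  \<open>inv u \<circ> v\<close> only, so the double sum is a multiple of a single one. Both sides
  contribute a factor \<open>r\<close> per point, whence \<open>2 * card C\<close>; an orbit of
  \<open>m\<close> points starts at the moment of order \<open>m - 1\<close>.\<close>

lemma orbit_sum_nonneg_poly:
  fixes \<sigma> :: "(nat \<Rightarrow> nat) \<Rightarrow> real" and r :: "real poly"
  assumes M: "measure_on_Icc M" and mom: "\<And>m. (\<integral>x. x ^ m \<partial>M) = cyc (Suc m)"
    and D: "finite D"
    and \<sigma>: "\<And>u v. u permutes D \<Longrightarrow> v permutes D \<Longrightarrow> \<sigma> (inv u \<circ> v) = \<sigma> u * \<sigma> v"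
  shows "0 \<le> (\<Sum>u | u permutes D. \<sigma> u * (\<Prod>C\<in>orbits u D. \<integral>x. x ^ (card C - 1) * poly r x ^ (2 * card C) \<partial>M))"
proof -
  interpret M: measure_on_Icc M by (rule M)
  define A where "A = PiE D (\<lambda>_. {..degree r})"
  have fA: "finite A" unfolding A_def using D by (intro finite_PiE) auto
  let ?S = "{u. u permutes D}"
  have fS: "finite ?S" using D by (rule finite_permutations)
  define c where "c a = (\<Prod>i\<in>D. coeff r (a i))" for a
  define F where "F w a b = orbit_prod cyc w D (\<lambda>x. 1 + a x + b x)" for w a b
  define G where "G w = (\<Sum>a\<in>A. \<Sum>b\<in>A. c a * c b * F w a b)" for w
  define word where "word a = concat (map (\<lambda>i. replicate (a i) i) (sorted_list_of_set D))" for a :: "nat \<Rightarrow> nat"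
  have set_word: "set (word a) \<subseteq> D" for a unfolding word_def using D by auto
  have cnt: "count_list (word a) x = a x" if "x \<in> D" for a x
    unfolding word_def using D that by (subst count_list_concat_replicate) auto
  have F: "orbit_prod cyc w D (\<lambda>x. 1 + count_list (word a) x + count_list (word b) x) = F w a b" for w a b
    unfolding F_def by (rule orbit_prod_cong) (simp add: cnt)
  let ?T = "\<lambda>u a v b. (\<sigma> u * c a) * (\<sigma> v * c b) * F (inv u \<circ> v) a b"
  have "0 \<le> (\<Sum>u\<in>?S \<times> A. \<Sum>v\<in>?S \<times> A. (\<sigma> (fst u) * c (snd u)) * (\<sigma> (fst v) * c (snd v)) *
    orbit_prod cyc (inv (fst u) \<circ> fst v) D (\<lambda>x. 1 + count_list (word (snd u)) x + count_list (word (snd v)) x))"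
    by (rule orbit_prod_positive[where c = "\<lambda>u. \<sigma> (fst u) * c (snd u)" and s = fst and ws = "\<lambda>u. word (snd u)"])
      (use fS fA D set_word in auto)
  also have "\<dots> = (\<Sum>u\<in>?S. \<Sum>a\<in>A. \<Sum>v\<in>?S. \<Sum>b\<in>A. ?T u a v b)"
    unfolding F by (simp only: sum.cartesian_product' fst_conv snd_conv)
  also have "\<dots> = (\<Sum>u\<in>?S. \<Sum>v\<in>?S. \<Sum>a\<in>A. \<Sum>b\<in>A. ?T u a v b)"
    by (intro sum.cong refl sum.swap)
  also have "\<dots> = (\<Sum>u\<in>?S. \<Sum>v\<in>?S. \<sigma> (inv u \<circ> v) * G (inv u \<circ> v))"
    unfolding G_def sum_distrib_left by (intro sum.cong refl) (simp add: \<sigma>)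
  also have "\<dots> = (\<Sum>u\<in>?S. \<Sum>w\<in>?S. \<sigma> w * G w)"
    by (intro sum.cong refl sum_permutations_inv_comp) simp
  also have "\<dots> = real (card ?S) * (\<Sum>w\<in>?S. \<sigma> w * G w)"
    by simp
  finally have "0 \<le> real (card ?S) * (\<Sum>w\<in>?S. \<sigma> w * G w)" .
  moreover have "id \<in> ?S" by (simp add: permutes_id)
  then have "?S \<noteq> {}" by blast
  then have "card ?S > 0" using fS by (simp only: card_gt_0_iff simp_thms)
  ultimately have nn: "0 \<le> (\<Sum>w\<in>?S. \<sigma> w * G w)" by (simp add: zero_le_mult_iff)
  have "G w = (\<Prod>C\<in>orbits w D. \<integral>x. x ^ (card C - 1) * poly r x ^ (2 * card C) \<partial>M)" if w: "w permutes D" for w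
  proof -
    have "F w a b = (\<Prod>C\<in>orbits w D. \<integral>x. x ^ (card C - 1) * (\<Prod>i\<in>C. x ^ a i * x ^ b i) \<partial>M)" for a b
      unfolding F_def orbit_prod_def
    proof (rule prod.cong[OF refl])
      fix C assume C: "C \<in> orbits w D"
      have "finite C" "C \<noteq> {}"
        using finite_subset[OF orbits_subset[OF C] D] orbits_nonempty[OF C] by auto
      then have "card C > 0" by (simp add: card_gt_0_iff)
      moreover have "(\<Sum>i\<in>C. 1 + a i + b i) = (\<Sum>i\<in>C. 1) + (\<Sum>i\<in>C. a i + b i)"
        by (simp only: sum.distrib add.assoc)
      moreover have "(\<Sum>i\<in>C. 1) = card C" by simp
      ultimately have e: "(\<Sum>i\<in>C. 1 + a i + b i) = Suc (card C - 1 + (\<Sum>i\<in>C. a i + b i))"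
        by linarith
      have "x ^ (card C - 1 + (\<Sum>i\<in>C. a i + b i)) = x ^ (card C - 1) * (\<Prod>i\<in>C. x ^ a i * x ^ b i)" for x :: real
        by (simp only: power_add power_sum)
      then show "cyc (\<Sum>i\<in>C. 1 + a i + b i) = (\<integral>x. x ^ (card C - 1) * (\<Prod>i\<in>C. x ^ a i * x ^ b i) \<partial>M)"
        unfolding e mom[symmetric] by (simp only:)
    qed
    then show ?thesis
      unfolding G_def c_def A_def using M.sum_prod_integral[OF D w, of r] by (simp only:)
  qed
  then have "(\<Sum>w\<in>?S. \<sigma> w * G w) = (\<Sum>w\<in>?S. \<sigma> w * (\<Prod>C\<in>orbits w D. \<integral>x. x ^ (card C - 1) * poly r x ^ (2 * card C) \<partial>M))"
    by (intro sum.cong refl) simp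
  then show ?thesis using nn by (simp only:)
qed

text \<open>A power of an indicator with positive exponent is the indicator itself, so the exponents
  \<open>2 * card C\<close> disappear in the limit; they are positive because orbits are
  nonempty.\<close>

lemma orbit_sum_nonneg:
  fixes \<sigma> :: "(nat \<Rightarrow> nat) \<Rightarrow> real"
  assumes M: "measure_on_Icc M" and mom: "\<And>m. (\<integral>x. x ^ m \<partial>M) = cyc (Suc m)"
    and D: "finite D"
    and \<sigma>: "\<And>u v. u permutes D \<Longrightarrow> v permutes D \<Longrightarrow> \<sigma> (inv u \<circ> v) = \<sigma> u * \<sigma> v"
    and E: "closed E"
  shows "0 \<le> (\<Sum>u | u permutes D. \<sigma> u * (\<Prod>C\<in>orbits u D. \<integral>x. x ^ (card C - 1) * indicator E x \<partial>M))"
proof -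
  interpret M: measure_on_Icc M by (rule M)
  obtain r where r: "\<And>n x. x \<in> {-1..1} \<Longrightarrow> \<bar>poly (r n) x\<bar> \<le> 2"
    "\<And>x. x \<in> {-1..1} \<Longrightarrow> (\<lambda>n. poly (r n) x) \<longlonglongrightarrow> indicator E x"
    using polynomials_tendsto_indicator[OF E] by metis
  have [measurable]: "(\<lambda>x. poly (r n) x) \<in> borel_measurable borel" for n
    by (intro borel_measurable_continuous_onI continuous_intros)
  have [measurable]: "E \<in> sets borel" using E by simp
  have lim: "(\<lambda>n. \<integral>x. x ^ (k - 1) * poly (r n) x ^ (2 * k) \<partial>M) \<longlonglongrightarrow> (\<integral>x. x ^ (k - 1) * indicator E x \<partial>M)"
    if k: "k > 0" for k
  proof (rule integral_dominated_convergence[where w = "\<lambda>_. 2 ^ (2 * k)"])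
    show "AE x in M. (\<lambda>n. x ^ (k - 1) * poly (r n) x ^ (2 * k)) \<longlonglongrightarrow> x ^ (k - 1) * indicator E x"
      using M.AE_Icc
    proof eventually_elim
      case (elim x)
      have "(\<lambda>n. x ^ (k - 1) * poly (r n) x ^ (2 * k)) \<longlonglongrightarrow> x ^ (k - 1) * indicator E x ^ (2 * k)"
        by (intro tendsto_intros r elim)
      moreover have "indicator E x ^ (2 * k) = (indicator E x :: real)"
        using k by (cases "x \<in> E") (simp_all add: power_0_left)
      ultimately show ?case by (simp only:)
    qed
    show "AE x in M. norm (x ^ (k - 1) * poly (r n) x ^ (2 * k)) \<le> 2 ^ (2 * k)" for n
      using M.AE_Icc
    proof eventually_elim
      case (elim x)
      have "\<bar>x\<bar> ^ (k - 1) * \<bar>poly (r n) x\<bar> ^ (2 * k) \<le> 1 * 2 ^ (2 * k)"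
        using elim r(1)[OF elim, of n] by (intro mult_mono power_le_one power_mono) auto
      then show ?case by (simp add: abs_mult power_abs)
    qed
  qed auto
  have "(\<lambda>n. \<Sum>u | u permutes D. \<sigma> u * (\<Prod>C\<in>orbits u D. \<integral>x. x ^ (card C - 1) * poly (r n) x ^ (2 * card C) \<partial>M))
    \<longlonglongrightarrow> (\<Sum>u | u permutes D. \<sigma> u * (\<Prod>C\<in>orbits u D. \<integral>x. x ^ (card C - 1) * indicator E x \<partial>M))"
  proof (intro tendsto_sum tendsto_mult tendsto_const tendsto_prod lim)
    fix u C assume C: "C \<in> orbits u D"
    show "card C > 0"
      using finite_subset[OF orbits_subset[OF C] D] orbits_nonempty[OF C] by (simp add: card_gt_0_iff)
  qed
  then show ?thesis
    by (rule LIMSEQ_le_const) (use orbit_sum_nonneg_poly[OF M mom D \<sigma>] in blast)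
qed

end

section \<open>Sums over permutations weighted by the trivial or the sign character\<close>

definition sign_or_one :: "real \<Rightarrow> ('a \<Rightarrow> 'a) \<Rightarrow> real" where
  "sign_or_one e u = (if e = 1 then 1 else of_int (sign u))"

text \<open>Only the orbit through \<open>b\<close> changes, and its factor is multiplied by
  \<open>x\<close>. The recursion for \<open>h\<close> starts at 1 because the exponent
  \<open>m - 1\<close> of the intended \<open>h\<close> is truncated at
  \<open>m = 0\<close>.\<close>

lemma orbit_prod_increase_one:
  fixes h :: "nat \<Rightarrow> real"
  assumes D: "finite D" and q: "q permutes D" and b: "b \<in> D"
    and h: "\<And>m. 0 < m \<Longrightarrow> h (Suc m) = x * h m"
  shows "orbit_prod h q D ((\<lambda>_. 1)(b := 2)) = x * orbit_prod h q D (\<lambda>_. 1)"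
proof -
  have "orbit_prod h q D ((\<lambda>_. 1)(b := 2)) = (\<Prod>C\<in>orbits q D. (\<Prod>i\<in>C. if i = b then x else 1) * h (\<Sum>i\<in>C. 1))"
    unfolding orbit_prod_def
  proof (rule prod.cong[OF refl])
    fix C assume C: "C \<in> orbits q D"
    have fC: "finite C" "C \<noteq> {}"
      using finite_subset[OF orbits_subset[OF C] D] orbits_nonempty[OF C] by auto
    show "h (\<Sum>i\<in>C. ((\<lambda>_. 1::nat)(b := 2)) i) = (\<Prod>i\<in>C. if i = b then x else 1) * h (\<Sum>i\<in>C. 1)"
    proof (cases "b \<in> C")
      case True
      have "(\<Sum>i\<in>C. ((\<lambda>_. 1::nat)(b := 2)) i) = 2 + (\<Sum>i\<in>C - {b}. 1)"
        using fC True by (subst sum.remove[of C b]) auto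
      also have "\<dots> = Suc (card C)"
        using fC True by (simp add: card_gt_0_iff Suc_diff_Suc)
      finally show ?thesis using h[of "card C"] fC True by (simp add: card_gt_0_iff)
    next
      case False
      then have "(\<Sum>i\<in>C. ((\<lambda>_. 1::nat)(b := 2)) i) = (\<Sum>i\<in>C. 1)" by (intro sum.cong) auto
      then show ?thesis using fC False by simp
    qed
  qed
  also have "\<dots> = (\<Prod>C\<in>orbits q D. \<Prod>i\<in>C. if i = b then x else 1) * orbit_prod h q D (\<lambda>_. 1)"
    by (simp add: orbit_prod_def prod.distrib)
  also have "(\<Prod>C\<in>orbits q D. \<Prod>i\<in>C. if i = b then x else 1) = (\<Prod>i\<in>D. if i = b then x else 1)"
    using prod_orbits[OF D permutes_inj[OF q]] permutes_image[OF q] by blast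
  also have "\<dots> = x" using D b by simp
  finally show ?thesis .
qed

text \<open>A new point either stays fixed, with factor \<open>w\<close>, or is inserted next to one
  of the old points, which costs the sign \<open>e\<close> and lengthens one cycle by 1. Each
  insertion therefore multiplies the sum by \<open>w + e * card D * x\<close>.\<close>

lemma sum_sign_orbit_prod_geometric:
  fixes w x e :: real
  assumes e: "e = 1 \<or> e = -1" and D: "finite D"
  shows "(\<Sum>u | u permutes D. sign_or_one e u * orbit_prod (\<lambda>m. w * x ^ (m - 1)) u D (\<lambda>_. 1))
    = (\<Prod>j<card D. w + e * real j * x)"
  using D
proof (induction D rule: finite_induct)
  case empty
  then show ?case by (simp add: sign_or_one_def sign_id)
next
  case (insert n D)
  let ?h = "\<lambda>m. w * x ^ (m - 1)"
  let ?f = "\<lambda>u. sign_or_one e u * orbit_prod ?h u (insert n D) (\<lambda>_. 1)"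
  have fixed: "?f q = w * (sign_or_one e q * orbit_prod ?h q D (\<lambda>_. 1))" if "q permutes D" for q
    using orbit_prod_insert_fixed[OF that insert(1,2), of ?h "\<lambda>_. 1"] by simp
  have moved: "?f (transpose n b \<circ> q) = e * x * (sign_or_one e q * orbit_prod ?h q D (\<lambda>_. 1))"
    if q: "q permutes D" and b: "b \<in> D" for q b
  proof -
    have nb: "n \<noteq> b" using b insert by auto
    have "permutation q" using q insert(1) unfolding permutation_permutes by blast
    then have "sign (transpose b n \<circ> q) = - sign q"
      using nb by (simp add: sign_compose permutation_swap_id sign_swap_id)
    then have s: "sign_or_one e (transpose b n \<circ> q) = e * sign_or_one e q"
      using e by (auto simp: sign_or_one_def)
    have "orbit_prod ?h (transpose b n \<circ> q) (insert n D) (\<lambda>_. 1) = orbit_prod ?h q D ((\<lambda>_. 1)(b := 2))"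
      using orbit_prod_transpose_comp[OF q insert(1) b insert(2), of ?h "\<lambda>_. 1"] by (simp add: numeral_2_eq_2)
    also have "\<dots> = x * orbit_prod ?h q D (\<lambda>_. 1)"
      by (rule orbit_prod_increase_one[OF insert(1) q b]) (auto simp: power_eq_if)
    finally show ?thesis unfolding transpose_commute[of n b] s by (simp only: mult_ac)
  qed
  have "(\<Sum>u | u permutes (insert n D). ?f u) = (\<Sum>b\<in>insert n D. \<Sum>q | q permutes D. ?f (transpose n b \<circ> q))"
    by (rule sum_over_permutations_insert[OF insert(1,2)])
  also have "\<dots> = (\<Sum>q | q permutes D. ?f q) + (\<Sum>b\<in>D. \<Sum>q | q permutes D. ?f (transpose n b \<circ> q))"
    using insert by simp
  also have "(\<Sum>q | q permutes D. ?f q) = w * (\<Prod>j<card D. w + e * real j * x)"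
    unfolding insert(3)[symmetric] sum_distrib_left by (rule sum.cong[OF refl]) (use fixed in blast)
  also have "(\<Sum>b\<in>D. \<Sum>q | q permutes D. ?f (transpose n b \<circ> q)) = (\<Sum>b\<in>D. e * x * (\<Prod>j<card D. w + e * real j * x))"
    unfolding insert(3)[symmetric] sum_distrib_left
    by (rule sum.cong[OF refl], rule sum.cong[OF refl]) (use moved in blast)
  also have "w * (\<Prod>j<card D. w + e * real j * x) + (\<Sum>b\<in>D. e * x * (\<Prod>j<card D. w + e * real j * x))
      = (\<Prod>j<card (insert n D). w + e * real j * x)"
    using insert by (simp add: algebra_simps)
  finally show ?case .
qed

lemma sign_or_one_inv_comp:
  assumes "finite D" "u permutes D" "v permutes D"
  shows "sign_or_one e (inv u \<circ> v) = sign_or_one e u * sign_or_one e v"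
proof -
  have "permutation u" "permutation v" using assms unfolding permutation_permutes by blast+
  then show ?thesis
    by (simp add: sign_or_one_def sign_compose sign_inverse permutation_inverse)
qed

context multiplicative_character
begin

text \<open>At a single point the moments form a geometric sequence, for which the sum over
  permutations has product form.\<close>

lemma atom_product_nonneg:
  assumes M: "measure_on_Icc M" and mom: "\<And>m. (\<integral>x. x ^ m \<partial>M) = cyc (Suc m)"
    and e: "e = 1 \<or> e = (-1::real)"
  shows "0 \<le> (\<Prod>j<k. measure M {x} + e * real j * x)"
proof -
  interpret M: measure_on_Icc M by (rule M)
  have int: "(\<integral>y. y ^ m * indicator {x} y \<partial>M) = measure M {x} * x ^ m" for m
  proof -
    have "(\<integral>y. y ^ m * indicator {x} y \<partial>M) = (\<integral>y. x ^ m * indicator {x} y \<partial>M)"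
      by (rule Bochner_Integration.integral_cong) (auto simp: indicator_def)
    then show ?thesis by simp
  qed
  have "0 \<le> (\<Sum>u | u permutes {..<k}. sign_or_one e u *
      (\<Prod>C\<in>orbits u {..<k}. \<integral>y. y ^ (card C - 1) * indicator {x} y \<partial>M))"
    by (rule orbit_sum_nonneg[OF M mom]) (auto intro: sign_or_one_inv_comp)
  also have "\<dots> = (\<Sum>u | u permutes {..<k}. sign_or_one e u * orbit_prod (\<lambda>m. measure M {x} * x ^ (m - 1)) u {..<k} (\<lambda>_. 1))"
    unfolding orbit_prod_def int by simp
  also have "\<dots> = (\<Prod>j<k. measure M {x} + e * real j * x)"
    using sum_sign_orbit_prod_geometric[OF e, of "{..<k}"] by simp
  finally show ?thesis .
qed

text \<open>The case of two letters: the identity contributes the square of the measure, the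
  transposition the first moment over \<open>E\<close>. It holds for all closed sets, and so can
  exclude a continuous part, which inequalities at single points cannot.\<close>

lemma integral_le_measure_square:
  assumes M: "measure_on_Icc M" and mom: "\<And>m. (\<integral>x. x ^ m \<partial>M) = cyc (Suc m)"
    and e: "e = 1 \<or> e = (-1::real)" and E: "closed E"
  shows "0 \<le> (measure M E)\<^sup>2 + e * (\<integral>x. x * indicator E x \<partial>M)"
proof -
  interpret M: measure_on_Icc M by (rule M)
  define h where "h m = (\<integral>x. x ^ (m - 1) * indicator E x \<partial>M)" for m
  have h: "h 1 = measure M E" "h 2 = (\<integral>x. x * indicator E x \<partial>M)"
    using E by (simp_all add: h_def)
  have ne: "id \<noteq> transpose 0 (1::nat)"
    by (metis id_apply transpose_apply_first zero_neq_one)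
  have S: "{u. u permutes {0::nat, 1}} = {id, transpose 0 1}"
    using permutes_doubleton_iff[of _ "0::nat" 1] by auto
  have "0 \<le> (\<Sum>u | u permutes {0::nat, 1}. sign_or_one e u * (\<Prod>C\<in>orbits u {0, 1}. h (card C)))"
    unfolding h_def
    by (rule orbit_sum_nonneg[OF M mom _ _ E], simp, rule sign_or_one_inv_comp[of "{0, 1}"]) simp_all
  also have "\<dots> = (\<Sum>u | u permutes {0::nat, 1}. sign_or_one e u * orbit_prod h u {0, 1} (\<lambda>_. 1))"
    by (simp add: orbit_prod_def)
  also have "\<dots> = sign_or_one e (id :: nat \<Rightarrow> nat) * (h 1 * h 1) + sign_or_one e (transpose 0 (1::nat)) * h 2"
    unfolding S using ne orbit_prod_id_pair[of h "\<lambda>_. 1"] orbit_prod_transpose_pair[of h "\<lambda>_. 1"]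
    by (subst sum.insert) (simp_all add: numeral_2_eq_2)
  also have "\<dots> = (measure M E)\<^sup>2 + e * (\<integral>x. x * indicator E x \<partial>M)"
    using e unfolding h by (auto simp: sign_or_one_def sign_id sign_swap_id power2_eq_square)
  finally show ?thesis .
qed

end

text \<open>\<open>N y\<close> counts with multiplicity the values from \<open>y\<close> upwards,
  and the entry at index \<open>i\<close> is the supremum of those \<open>y\<close> with more than
  \<open>i\<close> values at or above them. Thus \<open>x\<close> occupies the indices from
  \<open>N x - n x\<close> to \<open>N x - 1\<close>.\<close>

lemma enumerate_multiplicities:
  fixes n :: "real \<Rightarrow> nat"
  assumes fin: "\<And>a. 0 < a \<Longrightarrow> finite {x. a \<le> x \<and> n x \<noteq> 0}"
  obtains \<alpha> where "decseq \<alpha>" "\<And>i. 0 \<le> \<alpha> i"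
    "\<And>x. 0 < x \<Longrightarrow> finite {i. \<alpha> i = x} \<and> card {i. \<alpha> i = x} = n x"
proof -
  define N where "N y = (\<Sum>x | y \<le> x \<and> n x \<noteq> 0. n x)" for y
  \<comment> \<open>The element 0 keeps the supremum meaningful when no \<open>y\<close> qualifies
    and supplies the padding by zeros.\<close>
  define S where "S i = insert 0 {y. 0 < y \<and> i < N y}" for i
  define \<alpha> where "\<alpha> i = Sup (S i)" for i
  have N_split: "n x + N y \<le> N x" if "0 < x" "x < y" for x y
  proof -
    have "(\<Sum>z\<in>insert x {z. y \<le> z \<and> n z \<noteq> 0}. n z) = n x + N y"
      unfolding N_def using that fin[of y] by (subst sum.insert) auto
    moreover have "(\<Sum>z\<in>insert x {z. y \<le> z \<and> n z \<noteq> 0}. n z) \<le> (\<Sum>z\<in>insert x {z. x \<le> z \<and> n z \<noteq> 0}. n z)"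
      using that fin[of x] by (intro sum_mono2) auto
    moreover have "(\<Sum>z\<in>insert x {z. x \<le> z \<and> n z \<noteq> 0}. n z) = N x"
    proof (cases "n x = 0")
      case True
      then show ?thesis unfolding N_def using that fin[of x] by (subst sum.insert) auto
    next
      case False
      then have "insert x {z. x \<le> z \<and> n z \<noteq> 0} = {z. x \<le> z \<and> n z \<noteq> 0}" by auto
      then show ?thesis by (simp add: N_def)
    qed
    ultimately show ?thesis by simp
  qed
  have n_le: "n x \<le> N x" if "0 < x" for x
    using N_split[OF that, of "x + 1"] by simp
  obtain B where B: "\<And>x. 1 \<le> x \<Longrightarrow> n x \<noteq> 0 \<Longrightarrow> x \<le> B"
    using bdd_above_finite[OF fin[of 1]] unfolding bdd_above_def by auto
  have bdd: "bdd_above (S i)" for i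
  proof (rule bdd_aboveI[of _ "max 1 B"])
    fix y assume "y \<in> S i"
    then show "y \<le> max 1 B"
    proof (rule contrapos_pp)
      assume "\<not> y \<le> max 1 B"
      then have "y > max 1 B" by (simp only: not_le)
      then have y: "1 < y" "B < y" "y \<noteq> 0" by auto
      have "n x = 0" if "y \<le> x" for x using B[of x] y that by linarith
      then have "{x. y \<le> x \<and> n x \<noteq> 0} = {}" by auto
      then show "y \<notin> S i" using y unfolding S_def N_def by simp
    qed
  qed
  have key1: "\<alpha> i = x" if "0 < x" "N x - n x \<le> i" "i < N x" for i x
    unfolding \<alpha>_def
  proof (rule cSup_eq_maximum)
    show "x \<in> S i" using that by (simp add: S_def)
    fix y assume y: "y \<in> S i"
    show "y \<le> x"
    proof (rule ccontr)
      assume "\<not> y \<le> x"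
      then have "n x + N y \<le> N x" "i < N y" using N_split[of x y] that y by (auto simp: S_def)
      then show False using that by linarith
    qed
  qed
  have key2: "N x - n x \<le> i \<and> i < N x" if x: "\<alpha> i = x" "0 < x" for i x
  proof -
    obtain y0 where y0: "0 < y0" "i < N y0"
    proof -
      have "\<exists>y\<in>S i. 0 < y" using x less_cSup_iff[of "S i" 0] bdd unfolding \<alpha>_def S_def by auto
      then show ?thesis using that unfolding S_def by auto
    qed
    \<comment> \<open>The entry at index \<open>i\<close> is the largest listed \<open>z\<close>
      with \<open>i < N z\<close>: the next larger listed value fails this, so the values above
      \<open>z\<close> occupy at most \<open>i\<close> indices. The bound \<open>y0\<close> leaves
      finitely many candidates.\<close>
    define Z where "Z = {z. y0 \<le> z \<and> n z \<noteq> 0 \<and> i < N z}"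
    have fY: "finite {z. y0 \<le> z \<and> n z \<noteq> 0}" by (rule fin[OF y0(1)])
    have "finite Z" using fY by (rule rev_finite_subset) (auto simp: Z_def)
    moreover have "Z \<noteq> {}"
    proof -
      have ne: "{z. y0 \<le> z \<and> n z \<noteq> 0} \<noteq> {}" using y0 unfolding N_def by (metis not_less_zero sum.empty)
      define z0 where "z0 = Min {z. y0 \<le> z \<and> n z \<noteq> 0}"
      have z0: "y0 \<le> z0" "n z0 \<noteq> 0" "\<And>z. y0 \<le> z \<Longrightarrow> n z \<noteq> 0 \<Longrightarrow> z0 \<le> z"
        using Min_in[OF fY ne] Min_le[OF fY] unfolding z0_def by auto
      then have "{z. z0 \<le> z \<and> n z \<noteq> 0} = {z. y0 \<le> z \<and> n z \<noteq> 0}" by auto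
      then have "N z0 = N y0" by (simp add: N_def)
      then show ?thesis using z0 y0 unfolding Z_def by auto
    qed
    ultimately have Zmax: "Max Z \<in> Z" "\<And>z. z \<in> Z \<Longrightarrow> z \<le> Max Z" by auto
    define z where "z = Max Z"
    have zZ: "z \<in> Z" using Zmax(1) by (simp only: z_def)
    then have z: "y0 \<le> z" "n z \<noteq> 0" "i < N z" by (auto simp: Z_def)
    define R where "R = {w. z < w \<and> n w \<noteq> 0}"
    have fR: "finite R" using fY by (rule rev_finite_subset) (use z in \<open>auto simp: R_def\<close>)
    have Nz: "N z = n z + (\<Sum>w\<in>R. n w)"
    proof -
      have "{w. z \<le> w \<and> n w \<noteq> 0} = insert z R" using z by (auto simp: R_def)
      then show ?thesis unfolding N_def using fR by (simp add: R_def)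
    qed
    have "(\<Sum>w\<in>R. n w) \<le> i"
    proof (cases "R = {}")
      case False
      define w where "w = Min R"
      have w: "w \<in> R" "\<And>v. v \<in> R \<Longrightarrow> w \<le> v" using fR False by (auto simp: w_def)
      then have "{v. w \<le> v \<and> n v \<noteq> 0} = R" by (auto simp: R_def)
      then have "N w = (\<Sum>w\<in>R. n w)" by (simp add: N_def)
      moreover have "w \<notin> Z" using Zmax(2)[of w] w(1) unfolding z_def[symmetric] by (auto simp: R_def)
      ultimately show ?thesis using w(1) z unfolding Z_def R_def by auto
    qed simp
    then have "N z - n z \<le> i" using Nz by simp
    moreover from this have "\<alpha> i = z" using z y0 by (intro key1) auto
    ultimately show ?thesis using z x by auto
  qed
  show ?thesis
  proof (rule that[of \<alpha>])
    show "decseq \<alpha>"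
    proof (rule decseq_SucI)
      fix i
      have "S (Suc i) \<subseteq> S i" by (auto simp: S_def)
      then show "\<alpha> (Suc i) \<le> \<alpha> i" unfolding \<alpha>_def using bdd by (intro cSup_subset_mono) (auto simp: S_def)
    qed
    show "0 \<le> \<alpha> i" for i unfolding \<alpha>_def using bdd by (intro cSup_upper) (auto simp: S_def)
    fix x :: real assume x: "0 < x"
    have "{i. \<alpha> i = x} = {N x - n x..<N x}" 
    proof (intro set_eqI iffI)
      fix i assume "i \<in> {i. \<alpha> i = x}"
      then show "i \<in> {N x - n x..<N x}" using key2[of i x] x by (simp only: mem_Collect_eq atLeastLessThan_iff)
    next
      fix i assume "i \<in> {N x - n x..<N x}"
      then show "i \<in> {i. \<alpha> i = x}" using key1[OF x, of i] by (simp only: mem_Collect_eq atLeastLessThan_iff)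
    qed
    then show "finite {i. \<alpha> i = x} \<and> card {i. \<alpha> i = x} = n x" using n_le[OF x] by simp
  qed
qed

section \<open>Quantization of the spectral measure\<close>

text \<open>Both conditions concern the positive half-line only. They are met by the spectral
  measure through the sign character and by its reflection through the trivial one.\<close>

locale quantized_measure = measure_on_Icc +
  assumes second: "closed E \<Longrightarrow> E \<subseteq> {0<..} \<Longrightarrow> (\<integral>x. x * indicator E x \<partial>M) \<le> (measure M E)\<^sup>2"
    and product: "0 < x \<Longrightarrow> 0 \<le> (\<Prod>j<k. measure M {x} - real j * x)"
begin

definition multiplicity :: "real \<Rightarrow> nat" where
  "multiplicity x = nat \<lfloor>measure M {x} / x\<rfloor>"

text \<open>If the weight lay strictly between \<open>N x\<close> and \<open>(N + 1) x\<close>, the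
  product of \<open>N + 2\<close> factors would have a negative last factor and all others
  positive.\<close>

lemma atom_eq:
  assumes x: "0 < x"
  shows "measure M {x} = real (multiplicity x) * x"
proof (rule ccontr)
  let ?w = "measure M {x}" and ?N = "multiplicity x"
  assume ne: "?w \<noteq> real ?N * x"
  have N: "real ?N = of_int \<lfloor>?w / x\<rfloor>" unfolding multiplicity_def using x by simp
  then have "real ?N \<le> ?w / x" "?w / x < real ?N + 1" by linarith+
  then have w: "real ?N * x \<le> ?w" "?w < (real ?N + 1) * x" using x by (simp_all add: field_simps)
  have "0 < (\<Prod>j<Suc ?N. ?w - real j * x)"
  proof (rule prod_pos)
    fix j assume "j \<in> {..<Suc ?N}"
    then have "real j * x \<le> real ?N * x" using x by (intro mult_right_mono) auto
    then show "0 < ?w - real j * x" using w ne by linarith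
  qed
  moreover have "?w - real (Suc ?N) * x < 0" using w by (simp add: algebra_simps)
  ultimately have "(\<Prod>j<Suc (Suc ?N). ?w - real j * x) < 0"
    unfolding prod.lessThan_Suc[of _ "Suc ?N"] by (intro mult_pos_neg)
  then show False using product[OF x, of "Suc (Suc ?N)"] by linarith
qed

text \<open>Here \<open>a \<mu>(E) \<le> \<integral>\<^sub>E x d\<mu> \<le> \<mu>(E)\<^sup>2\<close>.\<close>
lemma measure_gap:
  assumes E: "closed E" "E \<subseteq> {a..}" and a: "0 < a" "measure M E < a"
  shows "measure M E = 0"
proof -
  have [measurable]: "E \<in> sets borel" using E by simp
  have "a * measure M E = (\<integral>x. a * indicator E x \<partial>M)" by simp
  also have "\<dots> \<le> (\<integral>x. x * indicator E x \<partial>M)"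
  proof (rule integral_mono_AE)
    show "integrable M (\<lambda>x. x * indicator E x)"
      by (rule integrable_bounded_on_Icc[of _ 1]) (auto simp: indicator_def)
    show "AE x in M. a * indicator E x \<le> x * indicator E x"
      using E by (auto simp: indicator_def)
    show "integrable M (\<lambda>x. a * indicator E x)"
      by (rule integrable_bounded_on_Icc[of _ "\<bar>a\<bar>"]) (auto simp: indicator_def)
  qed
  also have "\<dots> \<le> (measure M E)\<^sup>2" using E a by (intro second) auto
  finally have "measure M E * (a - measure M E) \<le> 0" by (simp add: power2_eq_square algebra_simps)
  then show ?thesis using a measure_nonneg[of M E] by (auto simp: mult_le_0_iff)
qed

text \<open>Punctured balls shrink to the empty set, so a small one has measure below
  \<open>x / 2\<close>. The gap requires closed sets; it is applied to closed annuli that exhaust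
  the punctured ball.\<close>

lemma isolated_atom:
  assumes x: "0 < x"
  obtains d where "0 < d" "measure M (ball x d - {x}) = 0"
proof -
  \<comment> \<open>The radii stay at most \<open>x / 2\<close>, which keeps the balls to the right
    of \<open>x / 2\<close>, where the gap with that constant applies.\<close>
  define d where "d n = x / real (n + 2)" for n :: nat
  define A where "A n = cball x (d n) - {x}" for n
  have d: "0 < d n" "d n \<le> x / 2" for n 
  proof -
    show "0 < d n" using x by (simp add: d_def)
    show "d n \<le> x / 2" using x unfolding d_def by (intro divide_left_mono) simp_all
  qed
  have "decseq d" unfolding d_def using x by (intro decseq_SucI) (simp add: frac_le)
  then have "A n \<subseteq> A m" if "m \<le> n" for m n
    using decseqD[of d m n] that unfolding A_def by auto
  then have "decseq A" by (simp add: decseq_def)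
  have "(\<Inter>n. A n) = {}"
  proof -
    have "y \<notin> (\<Inter>n. A n)" for y
    proof
      assume y: "y \<in> (\<Inter>n. A n)"
      then have "dist x y > 0" by (auto simp: A_def)
      moreover have "d \<longlonglongrightarrow> 0" unfolding d_def by real_asymp
      ultimately have "eventually (\<lambda>n. d n < dist x y) sequentially"
        by (intro order_tendstoD(2))
      then obtain n where "d n < dist x y"
        using eventually_happens'[OF sequentially_bot] by blast
      moreover have "dist x y \<le> d n" using y by (auto simp: A_def)
      ultimately show False by linarith
    qed
    then show ?thesis by blast
  qed
  moreover have "(\<lambda>n. measure M (A n)) \<longlonglongrightarrow> measure M (\<Inter>n. A n)"
  proof (rule finite_Lim_measure_decseq[OF _ \<open>decseq A\<close>])
    show "range A \<subseteq> sets M" by (auto simp: A_def)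
  qed
  ultimately have "(\<lambda>n. measure M (A n)) \<longlonglongrightarrow> 0" by simp
  then have "eventually (\<lambda>n. measure M (A n) < x / 2) sequentially"
    using x by (intro order_tendstoD) auto
  then obtain n where n: "measure M (A n) < x / 2"
    using eventually_happens'[OF sequentially_bot] by blast
  define E where "E m = cball x (d n) - ball x (1 / real (Suc m))" for m
  have Eclosed: "closed (E m)" for m unfolding E_def by (intro closed_Diff) auto
  have EA: "E m \<subseteq> A n" for m by (auto simp: E_def A_def)
  have E0: "measure M (E m) = 0" for m
  proof (rule measure_gap[OF Eclosed, of m "x / 2"])
    show "E m \<subseteq> {x / 2..}" using d(2)[of n] by (auto simp: E_def dist_real_def)
    have "measure M (E m) \<le> measure M (A n)"
      using EA by (intro finite_measure_mono) (auto simp: A_def)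
    then show "measure M (E m) < x / 2" using n by simp
  qed (use x in simp)
  have "A n = (\<Union>m. E m)"
  proof
    show "A n \<subseteq> (\<Union>m. E m)"
    proof
      fix y assume y: "y \<in> A n"
      then have "dist x y > 0" by (auto simp: A_def)
      then obtain m where "1 / real (Suc m) < dist x y"
        using reals_Archimedean[of "dist x y"] unfolding inverse_eq_divide by blast
      then show "y \<in> (\<Union>m. E m)" using y by (auto simp: A_def E_def intro!: exI[of _ m])
    qed
  qed (use EA in auto)
  moreover have "(\<Union>m. E m) \<in> null_sets M"
    by (rule null_sets_UN) (use E0 Eclosed in \<open>auto simp: null_sets_def emeasure_eq_measure\<close>)
  ultimately have "A n \<in> null_sets M" by simp
  then have "ball x (d n) - {x} \<in> null_sets M"
  proof (rule null_sets_subset)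
    show "ball x (d n) - {x} \<subseteq> A n" by (auto simp: A_def)
  qed auto
  then show ?thesis by (intro that[OF d(1)[of n]] measure_eq_0_null_sets)
qed

text \<open>By compactness, finitely many balls with null punctured parts cover
  \<open>{a..1}\<close>, so the measure there is carried by their centres. A centre of multiplicity
  0 has weight 0 by \<open>atom_eq\<close>.\<close>

lemma finitely_many_atoms:
  assumes a: "0 < a"
  defines "F \<equiv> {x. a \<le> x \<and> multiplicity x \<noteq> 0}"
  shows "finite F" "F \<subseteq> {a..1}" "measure M ({a..1} - F) = 0"
proof -
  show F1: "F \<subseteq> {a..1}"
  proof
    fix x assume x: "x \<in> F"
    have "x \<le> 1"
    proof (rule ccontr)
      assume x1: "\<not> x \<le> 1"
      have "AE y in M. y \<notin> {x}" using AE_Icc by eventually_elim (use x1 in auto)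
      then have "measure M {x} = 0" by (subst (asm) AE_iff_measurable[of "{x}"]) (auto simp: measure_def)
      then show False using x a atom_eq[of x] by (simp add: F_def)
    qed
    then show "x \<in> {a..1}" using x by (simp add: F_def)
  qed
  have "\<exists>d>0. measure M (ball x d - {x}) = 0" if "x \<in> {a..1}" for x
    using isolated_atom[of x] that a by auto
  then obtain d where d: "\<And>x. x \<in> {a..1} \<Longrightarrow> 0 < d x" "\<And>x. x \<in> {a..1} \<Longrightarrow> measure M (ball x (d x) - {x}) = 0"
    by metis
  have "{a..1} \<subseteq> (\<Union>x\<in>{a..1}. ball x (d x))" using d(1) by force
  then obtain X where X: "X \<subseteq> {a..1}" "finite X" "{a..1} \<subseteq> (\<Union>x\<in>X. ball x (d x))"
    using compactE_image[OF compact_Icc, of "{a..1}" "\<lambda>x. ball x (d x)"] by (metis open_ball)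
  have nX: "{a..1} - X \<in> null_sets M"
  proof (rule null_sets_subset)
    show "(\<Union>x\<in>X. ball x (d x) - {x}) \<in> null_sets M"
      using X d(2) by (intro null_sets.finite_UN) (auto simp: null_sets_def emeasure_eq_measure)
    show "{a..1} - X \<in> sets M" using X(2) by (auto intro!: sets.Diff intro: borel_closed finite_imp_closed)
    show "{a..1} - X \<subseteq> (\<Union>x\<in>X. ball x (d x) - {x})" using X(3) by blast
  qed
  have "F \<subseteq> X"
  proof
    fix x assume x: "x \<in> F"
    show "x \<in> X"
    proof (rule ccontr)
      assume "x \<notin> X"
      then have "{x} \<subseteq> {a..1} - X" using x F1 by auto
      then have "{x} \<in> null_sets M" by (rule null_sets_subset[OF nX, rotated]) simp
      then show False using x a atom_eq[of x] by (simp add: F_def measure_eq_0_null_sets)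
    qed
  qed
  then show fF: "finite F" using X(2) finite_subset by blast
  have "{a..1} - F \<in> null_sets M"
  proof (rule null_sets_subset)
    have "{x} \<in> null_sets M" if "x \<in> X - F" for x
      using that X(1) a atom_eq[of x] by (auto simp: F_def null_sets_def emeasure_eq_measure)
    then have "(\<Union>x\<in>X - F. {x}) \<in> null_sets M" using X(2) by (intro null_sets.finite_UN) auto
    then show "({a..1} - X) \<union> (\<Union>x\<in>X - F. {x}) \<in> null_sets M" using nX by auto
    show "{a..1} - F \<in> sets M" using fF by (auto intro!: sets.Diff intro: borel_closed finite_imp_closed)
  qed auto
  then show "measure M ({a..1} - F) = 0" by (rule measure_eq_0_null_sets)
qed

text \<open>An atom at \<open>y\<close> weighs \<open>multiplicity y * y\<close>; its factor
  \<open>y\<close> is the shift from moment \<open>m\<close> to power \<open>Suc m\<close>.\<close>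

lemma integral_Icc_atoms:
  assumes a: "0 < a"
  shows "(\<integral>x. x ^ m * indicator {a..1} x \<partial>M)
    = (\<Sum>x | a \<le> x \<and> multiplicity x \<noteq> 0. real (multiplicity x) * x ^ Suc m)"
proof -
  define F where "F = {x. a \<le> x \<and> multiplicity x \<noteq> 0}"
  note F = finitely_many_atoms[OF a, folded F_def]
  have "{a..1} - F \<in> null_sets M"
    using F(1,3) by (auto simp: null_sets_def emeasure_eq_measure intro!: sets.Diff intro: borel_closed finite_imp_closed)
  then have "AE x in M. x \<notin> {a..1} - F" by (rule AE_not_in)
  then have "(\<integral>x. x ^ m * indicator {a..1} x \<partial>M) = (\<integral>x. (\<Sum>y\<in>F. y ^ m * indicator {y} x) \<partial>M)"
  proof (intro integral_cong_AE)
    assume "AE x in M. x \<notin> {a..1} - F"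
    then show "AE x in M. x ^ m * indicator {a..1} x = (\<Sum>y\<in>F. y ^ m * indicator {y} x)"
    proof eventually_elim
      case (elim x)
      have "(\<Sum>y\<in>F. y ^ m * indicator {y} x) = (\<Sum>y\<in>F. if y = x then x ^ m else 0)"
        by (intro sum.cong) (auto simp: indicator_def)
      then show ?case using elim F(1,2) by (auto simp: indicator_def)
    qed
  qed auto
  also have "\<dots> = (\<Sum>y\<in>F. y ^ m * measure M {y})"
  proof -
    have "integrable M (\<lambda>x. y ^ m * indicator {y} x)" for y
      by (rule integrable_bounded_on_Icc[of _ "\<bar>y ^ m\<bar>"]) (auto simp: indicator_def)
    then show ?thesis by (subst Bochner_Integration.integral_sum) simp_all
  qed
  also have "\<dots> = (\<Sum>y\<in>F. real (multiplicity y) * y ^ Suc m)"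
    using a by (intro sum.cong refl) (auto simp: F_def atom_eq)
  finally show ?thesis by (simp add: F_def)
qed

text \<open>Listing atoms with multiplicity reproduces the integrals over \<open>{a..1}\<close> for
  all \<open>a > 0\<close>. Partial sums are bounded by the full integral; dominated convergence as
  \<open>a\<close> tends to 0 gives the reverse inequality.\<close>

theorem power_sums:
  obtains \<alpha> where "decseq \<alpha>" "\<And>i. 0 \<le> \<alpha> i" "\<And>m. (\<lambda>i. \<alpha> i ^ Suc m) sums (\<integral>x. x ^ m * indicator {0<..} x \<partial>M)"
proof -
  obtain \<alpha> where \<alpha>: "decseq \<alpha>" "\<And>i. 0 \<le> \<alpha> i"
    "\<And>x. 0 < x \<Longrightarrow> finite {i. \<alpha> i = x} \<and> card {i. \<alpha> i = x} = multiplicity x"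
    using enumerate_multiplicities[of multiplicity] finitely_many_atoms(1) by blast
  have level: "finite {i. a \<le> \<alpha> i} \<and>
      (\<Sum>i | a \<le> \<alpha> i. \<alpha> i ^ Suc m) = (\<integral>x. x ^ m * indicator {a..1} x \<partial>M)" if a: "0 < a" for a m
  proof -
    let ?F = "{x. a \<le> x \<and> multiplicity x \<noteq> 0}"
    note F = finitely_many_atoms(1)[OF a]
    have eq: "{i. a \<le> \<alpha> i} = (\<Union>x\<in>?F. {i. \<alpha> i = x})"
    proof -
      have "multiplicity (\<alpha> i) \<noteq> 0" if "a \<le> \<alpha> i" for i
      proof -
        have "0 < \<alpha> i" using that a by simp
        from \<alpha>(3)[OF this] have "finite {j. \<alpha> j = \<alpha> i}" "card {j. \<alpha> j = \<alpha> i} = multiplicity (\<alpha> i)" by auto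
        then show ?thesis using card_0_eq[of "{j. \<alpha> j = \<alpha> i}"] by auto
      qed
      then show ?thesis by auto
    qed
    have fin: "finite {i. \<alpha> i = x}" if "x \<in> ?F" for x using \<alpha>(3)[of x] that a by auto
    have "(\<Sum>i | a \<le> \<alpha> i. \<alpha> i ^ Suc m) = (\<Sum>x\<in>?F. \<Sum>i | \<alpha> i = x. \<alpha> i ^ Suc m)"
      unfolding eq using F fin by (intro sum.UNION_disjoint) auto
    also have "\<dots> = (\<Sum>x\<in>?F. real (multiplicity x) * x ^ Suc m)"
    proof (rule sum.cong[OF refl])
      fix x assume "x \<in> ?F"
      then have "card {i. \<alpha> i = x} = multiplicity x" using \<alpha>(3)[of x] a by simp
      then show "(\<Sum>i | \<alpha> i = x. \<alpha> i ^ Suc m) = real (multiplicity x) * x ^ Suc m"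
        by simp
    qed
    finally show ?thesis using F fin integral_Icc_atoms[OF a, of m] unfolding eq by auto
  qed
  have sums: "(\<lambda>i. \<alpha> i ^ Suc m) sums (\<integral>x. x ^ m * indicator {0<..} x \<partial>M)" (is "_ sums ?S") for m
  proof -
    have int: "integrable M (\<lambda>x. x ^ m * indicator A x)" if "A \<in> sets borel" for A
      using that by (intro integrable_bounded_on_Icc[of _ 1])
        (auto simp: indicator_def power_abs intro!: power_le_one)
    have le: "(\<integral>x. x ^ m * indicator {a..1} x \<partial>M) \<le> ?S" if "0 < a" for a
      using that by (intro integral_mono int) (auto simp: indicator_def)
    have partial: "(\<Sum>i<n. \<alpha> i ^ Suc m) \<le> ?S" for n
    proof -
      define P where "P = {i\<in>{..<n}. 0 < \<alpha> i}"
      have P: "finite P" "(\<Sum>i<n. \<alpha> i ^ Suc m) = (\<Sum>i\<in>P. \<alpha> i ^ Suc m)"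
      proof -
        have "0 < \<alpha> i" if "\<alpha> i \<noteq> 0" for i using \<alpha>(2)[of i] that by simp
        then show "finite P" "(\<Sum>i<n. \<alpha> i ^ Suc m) = (\<Sum>i\<in>P. \<alpha> i ^ Suc m)"
          unfolding P_def by (auto intro!: sum.mono_neutral_right)
      qed
      \<comment> \<open>A positive lower bound for the positive entries among the first
        \<open>n\<close>; the 1 covers the case that there are none.\<close>
      define a where "a = Min (insert 1 (\<alpha> ` P))"
      have a: "0 < a" "\<And>i. i \<in> P \<Longrightarrow> a \<le> \<alpha> i" unfolding a_def using P(1) by (auto simp: P_def)
      have "(\<Sum>i\<in>P. \<alpha> i ^ Suc m) \<le> (\<Sum>i | a \<le> \<alpha> i. \<alpha> i ^ Suc m)"
        using level[OF a(1), of m] a \<alpha>(2) by (intro sum_mono2) auto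
      then show ?thesis using level[OF a(1), of m] le[OF a(1)] P(2) by simp
    qed
    have summ: "summable (\<lambda>i. \<alpha> i ^ Suc m)"
      by (rule summableI_nonneg_bounded[of _ ?S]) (use partial \<alpha>(2) in auto)
    have "suminf (\<lambda>i. \<alpha> i ^ Suc m) \<le> ?S"
      by (rule suminf_le_const[OF summ partial])
    moreover have "?S \<le> suminf (\<lambda>i. \<alpha> i ^ Suc m)"
    proof (rule LIMSEQ_le_const2)
      show "(\<lambda>n. \<integral>x. x ^ m * indicator {1 / real (Suc n)..1} x \<partial>M) \<longlonglongrightarrow> ?S"
      proof (rule integral_dominated_convergence[where w = "\<lambda>_. 1"])
        show "AE x in M. (\<lambda>n. x ^ m * indicator {1 / real (Suc n)..1} x) \<longlonglongrightarrow> x ^ m * indicator {0<..} x"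
          using AE_Icc
        proof eventually_elim
          case (elim x)
          have "eventually (\<lambda>n. indicator {1 / real (Suc n)..1} x = (indicator {0<..} x :: real)) sequentially"
          proof (cases "0 < x")
            case True
            have "(\<lambda>n. 1 / real (Suc n)) \<longlonglongrightarrow> 0" by real_asymp
            then have "eventually (\<lambda>n. 1 / real (Suc n) < x) sequentially"
              using True by (rule order_tendstoD)
            then show ?thesis by eventually_elim (use True elim in \<open>auto simp: indicator_def\<close>)
          next
            case False
            have "\<not> 1 / real (Suc n) \<le> x" for n
            proof -
              have "0 < 1 / real (Suc n)" by simp
              then show ?thesis using False by linarith
            qed
            then show ?thesis using False by (auto simp: indicator_def)
          qed
          then show ?case
            by (intro tendsto_eventually) (auto elim!: eventually_mono)
        qed
        show "AE x in M. norm (x ^ m * indicator {1 / real (Suc n)..1} x) \<le> 1" for n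
          using AE_Icc by eventually_elim (auto simp: indicator_def power_abs intro!: power_le_one)
      qed auto
      show "\<exists>N. \<forall>n\<ge>N. (\<integral>x. x ^ m * indicator {1 / real (Suc n)..1} x \<partial>M) \<le> suminf (\<lambda>i. \<alpha> i ^ Suc m)"
      proof (intro exI allI impI)
        fix n :: nat
        have "0 < 1 / real (Suc n)" by simp
        from level[OF this, of m] show "(\<integral>x. x ^ m * indicator {1 / real (Suc n)..1} x \<partial>M) \<le> suminf (\<lambda>i. \<alpha> i ^ Suc m)"
          using sum_le_suminf[OF summ, of "{i. 1 / real (Suc n) \<le> \<alpha> i}"] \<alpha>(2) by auto
      qed
    qed
    ultimately show ?thesis using summable_sums[OF summ] by simp
  qed
  show ?thesis by (rule that[OF \<alpha>(1,2) sums])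
qed

end

section \<open>Existence and uniqueness of the Thoma parameters\<close>

lemma (in measure_on_Icc) measure_on_Icc_reflect: "measure_on_Icc (distr M borel uminus)"
proof (intro measure_on_Icc.intro measure_on_Icc_axioms.intro real_distribution.intro real_distribution_axioms.intro)
  show "prob_space (distr M borel uminus)" by (rule prob_space_distr) simp
  show "AE x in distr M borel uminus. x \<in> {-1..1}"
    using AE_Icc by (subst AE_distr_iff) (auto elim!: eventually_mono)
qed simp

context multiplicative_character
begin

theorem thoma_parameters_exist:
  obtains \<alpha> \<beta> where "thoma_parameters \<alpha> \<beta>"
    "\<And>l. 1 < l \<Longrightarrow> cyc l = (\<Sum>i. \<alpha> i ^ l) + (-1) ^ (l - 1) * (\<Sum>i. \<beta> i ^ l)"
proof -
  obtain M where rM: "real_distribution M" and AE_M: "AE x in M. x \<in> {-1..1}"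
    and mom: "\<And>m. (\<integral>x. x ^ m \<partial>M) = cyc (Suc m)"
    using spectral_measure by blast
  have mM: "measure_on_Icc M"
    by (intro measure_on_Icc.intro measure_on_Icc_axioms.intro rM AE_M)
  interpret M: measure_on_Icc M by (rule mM)
  let ?N = "distr M borel (uminus :: real \<Rightarrow> real)"
  interpret P: quantized_measure M
  proof
    fix E :: "real set" assume "closed E"
    then show "(\<integral>x. x * indicator E x \<partial>M) \<le> (measure M E)\<^sup>2"
      using integral_le_measure_square[OF mM mom, of "-1" E] by simp
  next
    fix x :: real and k
    show "0 \<le> (\<Prod>j<k. measure M {x} - real j * x)"
      using atom_product_nonneg[OF mM mom, of "-1" x k] by simp
  qed
  have mN: "measure_on_Icc ?N" by (rule M.measure_on_Icc_reflect)
  have meas: "measure ?N E = measure M (uminus -` E)" if "E \<in> sets borel" for E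
    using that by (subst measure_distr) (auto simp: M.space_eq_univ)
  interpret N: measure_on_Icc ?N by (rule mN)
  interpret Q: quantized_measure ?N
  proof
    fix E :: "real set" assume E: "closed E"
    have "closed (uminus -` E)" using E by (intro closed_vimage) (auto intro: continuous_intros)
    then have "0 \<le> (measure M (uminus -` E))\<^sup>2 + (\<integral>x. x * indicator (uminus -` E) x \<partial>M)"
      using integral_le_measure_square[OF mM mom, of 1 "uminus -` E"] by simp
    moreover have "(\<integral>x. x * indicator E x \<partial>?N) = - (\<integral>x. x * indicator (uminus -` E) x \<partial>M)"
    proof -
      have [measurable]: "E \<in> sets borel" using E by simp
      have "(\<integral>x. x * indicator E x \<partial>?N) = (\<integral>x. - (x * indicator (uminus -` E) x) \<partial>M)"
        by (subst integral_distr) (auto intro!: Bochner_Integration.integral_cong simp: indicator_def)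
      then show ?thesis by simp
    qed
    ultimately show "(\<integral>x. x * indicator E x \<partial>?N) \<le> (measure ?N E)\<^sup>2"
      using E by (simp add: meas)
  next
    fix x :: real and k
    have "uminus -` {x} = {- x}" by auto
    then show "0 \<le> (\<Prod>j<k. measure ?N {x} - real j * x)"
      using atom_product_nonneg[OF mM mom, of 1 "- x" k] by (simp add: meas)
  qed
  obtain \<alpha> where \<alpha>: "decseq \<alpha>" "\<And>i. 0 \<le> \<alpha> i" "\<And>m. (\<lambda>i. \<alpha> i ^ Suc m) sums (\<integral>x. x ^ m * indicator {0<..} x \<partial>M)"
    using P.power_sums by blast
  obtain \<beta> where \<beta>: "decseq \<beta>" "\<And>i. 0 \<le> \<beta> i" "\<And>m. (\<lambda>i. \<beta> i ^ Suc m) sums (\<integral>x. x ^ m * indicator {0<..} x \<partial>?N)"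
    using Q.power_sums by blast
  have N_int: "(\<integral>x. x ^ m * indicator {0<..} x \<partial>?N) = (-1) ^ m * (\<integral>x. x ^ m * indicator {..<0} x \<partial>M)" for m
  proof -
    have "(\<integral>x. x ^ m * indicator {0<..} x \<partial>?N) = (\<integral>x. (-1) ^ m * (x ^ m * indicator {..<0} x) \<partial>M)"
    proof (subst integral_distr)
      have "(- x) ^ m * indicator {0<..} (- x) = (-1) ^ m * (x ^ m * indicator {..<0} x)" for x :: real
        by (subst power_minus) (simp add: indicator_def)
      then show "(\<integral>x. (- x) ^ m * indicator {0<..} (- x) \<partial>M) = (\<integral>x. (-1) ^ m * (x ^ m * indicator {..<0} x) \<partial>M)"
        by (simp only:)
    qed auto
    then show ?thesis by simp
  qed
  have int: "integrable M (\<lambda>x. x ^ m * indicator A x)" if "A \<in> sets borel" for A m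
    using that by (intro M.integrable_bounded_on_Icc[of _ 1])
      (auto simp: indicator_def power_abs intro!: power_le_one)
  show ?thesis
  proof (rule that)
    have "suminf \<alpha> + suminf \<beta> = measure M {0<..} + measure M {..<0}"
      using sums_unique[OF \<alpha>(3)[of 0]] sums_unique[OF \<beta>(3)[of 0]] N_int[of 0] by simp
    also have "\<dots> = measure M ({0<..} \<union> {..<0})"
      by (rule M.finite_measure_Union[symmetric]) auto
    also have "\<dots> \<le> 1" by (rule M.prob_le_1)
    finally show "thoma_parameters \<alpha> \<beta>"
      using \<alpha> \<beta> sums_summable[OF \<alpha>(3)[of 0]] sums_summable[OF \<beta>(3)[of 0]]
      unfolding thoma_parameters_def by simp
    fix l :: nat assume "1 < l"
    then obtain m where l: "l = Suc (Suc m)" by (auto simp: less_iff_Suc_add)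
    \<comment> \<open>The exponent \<open>Suc m\<close> is positive, so the integrand vanishes at 0
      and the mass there is not seen. At length 1 this would fail.\<close>
    have "cyc l = (\<integral>x. x ^ Suc m * indicator {0<..} x + x ^ Suc m * indicator {..<0} x \<partial>M)"
      unfolding l mom[symmetric] by (intro Bochner_Integration.integral_cong) (auto simp: indicator_def)
    also have "\<dots> = (\<integral>x. x ^ Suc m * indicator {0<..} x \<partial>M) + (\<integral>x. x ^ Suc m * indicator {..<0} x \<partial>M)"
      by (rule Bochner_Integration.integral_add) (rule int, simp)+
    also have "(\<integral>x. x ^ Suc m * indicator {..<0} x \<partial>M) = (-1) ^ Suc m * (\<integral>x. x ^ Suc m * indicator {0<..} x \<partial>?N)"
      unfolding N_int by (simp add: power_mult_distrib[symmetric])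
    also have "(\<integral>x. x ^ Suc m * indicator {0<..} x \<partial>?N) = (\<Sum>i. \<beta> i ^ l)"
      unfolding l by (rule sums_unique[OF \<beta>(3)])
    also have "(\<integral>x. x ^ Suc m * indicator {0<..} x \<partial>M) = (\<Sum>i. \<alpha> i ^ l)"
      unfolding l by (rule sums_unique[OF \<alpha>(3)])
    finally show "cyc l = (\<Sum>i. \<alpha> i ^ l) + (-1) ^ (l - 1) * (\<Sum>i. \<beta> i ^ l)"
      by (simp add: l)
  qed
qed

end

text \<open>If \<open>a i > b i\<close>, the terms that are at least \<open>a i\<close> include the
  first \<open>i + 1\<close> of \<open>a\<close> but at most the first \<open>i\<close> of
  \<open>b\<close>, which agree with those of \<open>a\<close>. The two tail sums would
  differ.\<close>

lemma decseq_le_of_tail_squares: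
  fixes a b :: "nat \<Rightarrow> real"
  assumes a: "decseq a" "\<And>i. 0 \<le> a i" "summable (\<lambda>i. (a i)\<^sup>2)" and b: "decseq b" "\<And>i. 0 \<le> b i"
    and eq: "\<And>y. 0 < y \<Longrightarrow> (\<Sum>i. (a i)\<^sup>2 * indicator {y..} (a i)) = (\<Sum>i. (b i)\<^sup>2 * indicator {y..} (b i))"
    and less: "\<And>j. j < i \<Longrightarrow> a j = b j"
  shows "a i \<le> b i"
proof (rule ccontr)
  assume c: "\<not> a i \<le> b i"
  then have y: "0 < a i" using b(2)[of i] by linarith
  have aj: "a i \<le> a j" if "j \<le> i" for j using decseqD[OF a(1) that] .
  have bj: "b j < a i" if "i \<le> j" for j using decseqD[OF b(1) that] c by linarith
  have summ: "summable (\<lambda>j. (a j)\<^sup>2 * indicator {a i..} (a j))"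
    by (rule summable_comparison_test'[OF a(3), of 0]) (auto simp: indicator_def)
  have "(\<Sum>j<i. (a j)\<^sup>2) + (a i)\<^sup>2 = (\<Sum>j<Suc i. (a j)\<^sup>2 * indicator {a i..} (a j))"
    using aj by simp
  also have "\<dots> \<le> (\<Sum>j. (a j)\<^sup>2 * indicator {a i..} (a j))"
    by (rule sum_le_suminf[OF summ]) auto
  also have "\<dots> = (\<Sum>j. (b j)\<^sup>2 * indicator {a i..} (b j))" by (rule eq[OF y])
  also have "\<dots> = (\<Sum>j<i. (b j)\<^sup>2 * indicator {a i..} (b j))"
    using bj by (intro suminf_finite) (auto simp: indicator_def not_less not_le)
  also have "\<dots> = (\<Sum>j<i. (a j)\<^sup>2)"
  proof (rule sum.cong[OF refl])
    fix j assume "j \<in> {..<i}"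
    then have "b j = a j" "a i \<le> a j" using less[of j] aj[of j] by auto
    then show "(b j)\<^sup>2 * indicator {a i..} (b j) = (a j)\<^sup>2" by simp
  qed
  finally show False using y by simp
qed

lemma decseq_eq_of_tail_squares:
  fixes a b :: "nat \<Rightarrow> real"
  assumes "decseq a" "\<And>i. 0 \<le> a i" "summable (\<lambda>i. (a i)\<^sup>2)"
    and "decseq b" "\<And>i. 0 \<le> b i" "summable (\<lambda>i. (b i)\<^sup>2)"
    and "\<And>y. 0 < y \<Longrightarrow> (\<Sum>i. (a i)\<^sup>2 * indicator {y..} (a i)) = (\<Sum>i. (b i)\<^sup>2 * indicator {y..} (b i))"
  shows "a = b"
proof
  fix i
  show "a i = b i"
  proof (induction i rule: less_induct)
    case (less i)
    have "a i \<le> b i" by (rule decseq_le_of_tail_squares) (use assms less in auto)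
    moreover have "b i \<le> a i" by (rule decseq_le_of_tail_squares) (use assms less in auto)
    ultimately show ?case by simp
  qed
qed

lemma suminf_dominated_convergence:
  fixes f :: "nat \<Rightarrow> nat \<Rightarrow> real"
  assumes lim: "\<And>i. (\<lambda>n. f n i) \<longlonglongrightarrow> g i" and bound: "\<And>n i. \<bar>f n i\<bar> \<le> h i" and h: "summable h"
  shows "(\<lambda>n. suminf (f n)) \<longlonglongrightarrow> suminf g"
proof -
  have "eventually (\<lambda>(i, n). norm (f n i) \<le> h i) (at_top \<times>\<^sub>F sequentially)"
    using bound by (intro always_eventually) auto
  from tannerys_theorem[of "\<lambda>i n. f n i", OF lim this h] show ?thesis by simp
qed

lemma thoma_parameters_bounds:
  assumes "thoma_parameters \<alpha> \<beta>"
  shows "0 \<le> \<alpha> i" "\<alpha> i \<le> 1" "0 \<le> \<beta> i" "\<beta> i \<le> 1" "summable (\<lambda>i. (\<alpha> i)\<^sup>2)" "summable (\<lambda>i. (\<beta> i)\<^sup>2)"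
proof -
  have t: "\<And>i. 0 \<le> \<alpha> i" "\<And>i. 0 \<le> \<beta> i" "summable \<alpha>" "summable \<beta>" "suminf \<alpha> + suminf \<beta> \<le> 1"
    using assms by (auto simp: thoma_parameters_def)
  have "\<alpha> i \<le> suminf \<alpha>" "\<beta> i \<le> suminf \<beta>" for i
    using sum_le_suminf[OF t(3), of "{i}"] sum_le_suminf[OF t(4), of "{i}"] t(1,2) by simp_all
  moreover have "0 \<le> suminf \<alpha>" "0 \<le> suminf \<beta>" using t by (auto intro: suminf_nonneg)
  ultimately have le: "\<alpha> i \<le> 1" "\<beta> i \<le> 1" for i
    using t(5) by (meson add_increasing add_increasing2 order_trans)+
  show "0 \<le> \<alpha> i" "\<alpha> i \<le> 1" "0 \<le> \<beta> i" "\<beta> i \<le> 1" using t le by auto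
  have "(\<alpha> i)\<^sup>2 \<le> \<alpha> i" "(\<beta> i)\<^sup>2 \<le> \<beta> i" for i
    using t le by (auto simp: power2_eq_square mult_left_le)
  then show "summable (\<lambda>i. (\<alpha> i)\<^sup>2)" "summable (\<lambda>i. (\<beta> i)\<^sup>2)"
    by (intro summable_comparison_test'[OF t(3), of 0], simp, intro summable_comparison_test'[OF t(4), of 0], simp)
qed

text \<open>The integral of \<open>\<phi>\<close> against a signed measure on the points
  \<open>\<alpha> i\<close> and \<open>- \<beta> i\<close>. The masses are squares because cycle
  values give power sums only from exponent 2 on; the monomial of degree \<open>k\<close> yields the
  value at length \<open>k + 2\<close>.\<close>

definition signed_square_sum :: "(nat \<Rightarrow> real) \<Rightarrow> (nat \<Rightarrow> real) \<Rightarrow> (real \<Rightarrow> real) \<Rightarrow> real" where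
  "signed_square_sum \<alpha> \<beta> \<phi> = (\<Sum>i. (\<alpha> i)\<^sup>2 * \<phi> (\<alpha> i)) - (\<Sum>i. (\<beta> i)\<^sup>2 * \<phi> (- \<beta> i))"

lemma signed_square_sum_poly:
  assumes t: "thoma_parameters \<alpha> \<beta>"
  shows "signed_square_sum \<alpha> \<beta> (poly r) =
    (\<Sum>k\<le>degree r. coeff r k * ((\<Sum>i. \<alpha> i ^ (k + 2)) + (-1) ^ (k + 1) * (\<Sum>i. \<beta> i ^ (k + 2))))"
proof -
  note b = thoma_parameters_bounds[OF t]
  have pw: "x ^ (k + 2) \<le> x\<^sup>2" if "0 \<le> x" "x \<le> 1" for x :: real and k
    using that power_decreasing[of 2 "k + 2" x] by simp
  have sa: "summable (\<lambda>i. \<alpha> i ^ (k + 2))" and sb: "summable (\<lambda>i. \<beta> i ^ (k + 2))" for k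
    by (rule summable_comparison_test'[OF b(5), of 0], use b pw in simp,
        rule summable_comparison_test'[OF b(6), of 0], use b pw in simp)
  have "(\<Sum>i. (\<alpha> i)\<^sup>2 * poly r (\<alpha> i)) = (\<Sum>i. \<Sum>k\<le>degree r. coeff r k * \<alpha> i ^ (k + 2))"
    by (simp add: poly_altdef sum_distrib_left power_add mult_ac power2_eq_square)
  also have "\<dots> = (\<Sum>k\<le>degree r. coeff r k * (\<Sum>i. \<alpha> i ^ (k + 2)))"
    using sa by (subst suminf_sum) (auto intro!: sum.cong suminf_mult simp del: add_2_eq_Suc')
  finally have A: "(\<Sum>i. (\<alpha> i)\<^sup>2 * poly r (\<alpha> i)) = (\<Sum>k\<le>degree r. coeff r k * (\<Sum>i. \<alpha> i ^ (k + 2)))" .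
  have "(\<Sum>i. (\<beta> i)\<^sup>2 * poly r (- \<beta> i)) = (\<Sum>i. \<Sum>k\<le>degree r. (coeff r k * (-1) ^ k) * \<beta> i ^ (k + 2))"
    by (simp add: poly_altdef sum_distrib_left power_add mult_ac power2_eq_square power_minus[of "\<beta> i" for i])
  also have "\<dots> = (\<Sum>k\<le>degree r. (coeff r k * (-1) ^ k) * (\<Sum>i. \<beta> i ^ (k + 2)))"
    using sb by (subst suminf_sum) (auto intro!: sum.cong suminf_mult simp del: add_2_eq_Suc')
  finally have B: "(\<Sum>i. (\<beta> i)\<^sup>2 * poly r (- \<beta> i)) = (\<Sum>k\<le>degree r. (coeff r k * (-1) ^ k) * (\<Sum>i. \<beta> i ^ (k + 2)))" .
  show ?thesis unfolding signed_square_sum_def A B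
    by (simp add: sum_subtractf[symmetric] algebra_simps)
qed

lemma signed_square_sum_tendsto:
  assumes t: "thoma_parameters \<alpha> \<beta>"
    and r: "\<And>n x. x \<in> {-1..1} \<Longrightarrow> \<bar>poly (r n) x\<bar> \<le> 2"
      "\<And>x. x \<in> {-1..1} \<Longrightarrow> (\<lambda>n. poly (r n) x) \<longlonglongrightarrow> \<phi> x"
  shows "(\<lambda>n. signed_square_sum \<alpha> \<beta> (poly (r n))) \<longlonglongrightarrow> signed_square_sum \<alpha> \<beta> \<phi>"
proof -
  note b = thoma_parameters_bounds[OF t]
  have i: "\<alpha> i \<in> {-1..1}" "- \<beta> i \<in> {-1..1}" for i using b(1,2)[of i] b(3,4)[of i] by auto
  show ?thesis
    unfolding signed_square_sum_def
    by (intro tendsto_diff suminf_dominated_convergence[where h = "\<lambda>i. (\<alpha> i)\<^sup>2 * 2"]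
        suminf_dominated_convergence[where h = "\<lambda>i. (\<beta> i)\<^sup>2 * 2"] tendsto_mult tendsto_const r i
        summable_mult2 b) (use r(1)[OF i(1)] r(1)[OF i(2)] in \<open>auto simp: abs_mult intro!: mult_left_mono\<close>)
qed

text \<open>Equality on polynomials passes to indicators of closed sets. A half-line to the right of
  a positive point meets only the \<alpha>, one to the left of a negative point only the
  \<beta>.\<close>

theorem thoma_parameters_unique:
  assumes t: "thoma_parameters \<alpha> \<beta>" "thoma_parameters \<alpha>' \<beta>'"
    and eq: "\<And>l. 1 < l \<Longrightarrow> (\<Sum>i. \<alpha> i ^ l) + (-1) ^ (l - 1) * (\<Sum>i. \<beta> i ^ l)
      = (\<Sum>i. \<alpha>' i ^ l) + (-1) ^ (l - 1) * (\<Sum>i. \<beta>' i ^ l)"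
  shows "\<alpha> = \<alpha>'" "\<beta> = \<beta>'"
proof -
  note b = thoma_parameters_bounds[OF t(1)] and b' = thoma_parameters_bounds[OF t(2)]
  have dec: "decseq \<alpha>" "decseq \<beta>" "decseq \<alpha>'" "decseq \<beta>'"
    using t by (auto simp: thoma_parameters_def)
  have poly: "signed_square_sum \<alpha> \<beta> (poly r) = signed_square_sum \<alpha>' \<beta>' (poly r)" for r
    unfolding signed_square_sum_poly[OF t(1)] signed_square_sum_poly[OF t(2)]
    using eq[of "_ + 2"] by (intro sum.cong refl arg_cong2[where f = "(*)"]) simp
  have ind: "signed_square_sum \<alpha> \<beta> (indicator E) = signed_square_sum \<alpha>' \<beta>' (indicator E)" if E: "closed E" for E
  proof -
    obtain r where r: "\<And>n x. x \<in> {-1..1} \<Longrightarrow> \<bar>poly (r n) x\<bar> \<le> 2"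
      "\<And>x. x \<in> {-1..1} \<Longrightarrow> (\<lambda>n. poly (r n) x) \<longlonglongrightarrow> indicator E x"
      using polynomials_tendsto_indicator[OF E] by metis
    show ?thesis
      using signed_square_sum_tendsto[OF t(1) r] signed_square_sum_tendsto[OF t(2) r]
      unfolding poly by (rule LIMSEQ_unique)
  qed
  show "\<alpha> = \<alpha>'"
  proof (rule decseq_eq_of_tail_squares)
    fix y :: real assume y: "0 < y"
    have "indicator {y..} (- \<beta> i) = (0::real)" "indicator {y..} (- \<beta>' i) = (0::real)" for i
      using b(3)[of i] b'(3)[of i] y by (auto simp: indicator_def)
    then show "(\<Sum>i. (\<alpha> i)\<^sup>2 * indicator {y..} (\<alpha> i)) = (\<Sum>i. (\<alpha>' i)\<^sup>2 * indicator {y..} (\<alpha>' i))"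
      using ind[of "{y..}"] by (simp add: signed_square_sum_def)
  qed (use dec b b' in auto)
  show "\<beta> = \<beta>'"
  proof (rule decseq_eq_of_tail_squares)
    fix y :: real assume y: "0 < y"
    have "indicator {..-y} (\<alpha> i) = (0::real)" "indicator {..-y} (\<alpha>' i) = (0::real)" for i
      using b(1)[of i] b'(1)[of i] y by (auto simp: indicator_def)
    moreover have "indicator {..-y} (- x) = (indicator {y..} x :: real)" for x :: real
      by (simp add: indicator_def)
    ultimately show "(\<Sum>i. (\<beta> i)\<^sup>2 * indicator {y..} (\<beta> i)) = (\<Sum>i. (\<beta>' i)\<^sup>2 * indicator {y..} (\<beta>' i))"
      using ind[of "{..-y}"] by (simp add: signed_square_sum_def)
  qed (use dec b b' in auto)
qed

section \<open>Multiplicative characters are extremal\<close>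

text \<open>Transport of \<open>p\<close> by translation by \<open>n\<close>, with the identity
  below \<open>n\<close>. Translation is not onto the natural numbers, so conjugacy with
  \<open>p\<close> must be realized by a separate finitary permutation.\<close>

definition shift_perm :: "nat \<Rightarrow> (nat \<Rightarrow> nat) \<Rightarrow> nat \<Rightarrow> nat" where
  "shift_perm n p x = (if x < n then x else p (x - n) + n)"

lemma shift_permutes:
  assumes "p permutes A"
  shows "shift_perm n p permutes ((\<lambda>x. x + n) ` A)"
  unfolding permutes_def
proof (intro conjI allI impI)
  fix x assume "x \<notin> (\<lambda>x. x + n) ` A"
  then have "n \<le> x \<Longrightarrow> x - n \<notin> A" by force
  then show "shift_perm n p x = x" using permutes_not_in[OF assms] by (auto simp: shift_perm_def)
next
  fix y
  show "\<exists>!x. shift_perm n p x = y"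
  proof (cases "y < n")
    case True
    then show ?thesis by (intro ex1I[of _ y]) (auto simp: shift_perm_def split: if_splits)
  next
    case False
    have "p (inv p (y - n)) = y - n" using permutes_inverses[OF assms] by simp
    moreover have "inv p (p z) = z" for z using permutes_inverses[OF assms] by simp
    ultimately show ?thesis using False
      by (intro ex1I[of _ "inv p (y - n) + n"]) (auto simp: shift_perm_def split: if_splits)
  qed
qed

lemma shift_inv:
  assumes "bij p"
  shows "shift_perm n (inv p) = inv (shift_perm n p)"
proof (rule ext)
  fix y
  have bs: "bij (shift_perm n p)"
    using assms by (intro permutes_bij[OF shift_permutes[of p UNIV]] bij_imp_permutes[of p UNIV]) auto
  have "shift_perm n p (shift_perm n (inv p) y) = y"
    using surj_f_inv_f[OF bij_is_surj[OF assms]] by (simp add: shift_perm_def)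
  then show "shift_perm n (inv p) y = inv (shift_perm n p) y"
    by (metis bij_inv_eq_iff bs)
qed

text \<open>The conjugating permutation moves only points of \<open>A\<close> and of its image; this
  control is what lets it commute with elements that live elsewhere.\<close>

lemma conjugate_transport:
  assumes p: "p permutes A" and A: "finite A" "inj_on \<phi> A" and q: "q permutes (\<phi> ` A)"
    and pq: "\<And>x. x \<in> A \<Longrightarrow> q (\<phi> x) = \<phi> (p x)"
  obtains \<tau> where "\<tau> permutes (A \<union> \<phi> ` A)" "\<tau> \<circ> p \<circ> inv \<tau> = q"
proof -
  obtain \<tau> where t: "\<tau> permutes (A \<union> \<phi> ` A)" "\<And>x. x \<in> A \<Longrightarrow> \<tau> x = \<phi> x"
    using permutes_extension[OF A] by blast
  have "\<tau> (p x) = q (\<tau> x)" for x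
  proof (cases "x \<in> A")
    case True
    then show ?thesis using t(2)[of x] t(2)[of "p x"] pq[of x] permutes_in_image[OF p] by simp
  next
    case False
    have "\<tau> x \<notin> \<phi> ` A"
    proof
      assume "\<tau> x \<in> \<phi> ` A"
      then obtain y where "y \<in> A" "\<tau> x = \<tau> y" using t(2) by auto
      then show False using False permutes_inj[OF t(1)] by (metis injD)
    qed
    then show ?thesis using False permutes_not_in[OF p] permutes_not_in[OF q] by simp
  qed
  then have "(\<tau> \<circ> p \<circ> inv \<tau>) y = q y" for y
    using permutes_inverses(1)[OF t(1)] by simp
  then show ?thesis using that[OF t(1)] by blast
qed

lemma shift_conjugate:
  assumes p: "p permutes A" "finite A"
  obtains \<tau> where "\<tau> permutes ((\<lambda>x. x + n) ` A \<union> (\<lambda>x. x + m) ` A)" "\<tau> \<circ> shift_perm n p \<circ> inv \<tau> = shift_perm m p"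
proof -
  let ?\<phi> = "\<lambda>x. x - n + m"
  have im: "?\<phi> ` (\<lambda>x. x + n) ` A = (\<lambda>x. x + m) ` A" by (simp add: image_image)
  have "inj_on ?\<phi> ((\<lambda>x. x + n) ` A)" by (auto simp: inj_on_def)
  moreover have "shift_perm m p (?\<phi> x) = ?\<phi> (shift_perm n p x)" if "x \<in> (\<lambda>x. x + n) ` A" for x
    using that by (auto simp: shift_perm_def)
  ultimately show ?thesis
    using conjugate_transport[OF shift_permutes[OF p(1), of n], of ?\<phi> "shift_perm m p"]
      shift_permutes[OF p(1), of m] p(2) that unfolding im by auto
qed

lemma shift_0 [simp]: "shift_perm 0 p = p"
  by (auto simp: shift_perm_def)

lemma permutation_shift: "permutation p \<Longrightarrow> permutation (shift_perm n p)"
  unfolding permutation_permutes using shift_permutes by (meson finite_imageI)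

lemma (in positive_class_function) value_shift:
  assumes "permutation p"
  shows "g (shift_perm n p) = g p"
proof -
  obtain A where A: "finite A" "p permutes A" using assms unfolding permutation_permutes by auto
  obtain \<tau> where t: "\<tau> permutes ((\<lambda>x. x + 0) ` A \<union> (\<lambda>x. x + n) ` A)" "\<tau> \<circ> shift_perm 0 p \<circ> inv \<tau> = shift_perm n p"
    using shift_conjugate[OF A(2,1)] by metis
  have "permutation \<tau>" unfolding permutation_permutes
    by (rule exI, rule conjI[OF _ t(1)]) (use A in simp)
  then show ?thesis using conjugate[OF assms] t(2) by (metis shift_0)
qed

text \<open>For small \<open>x\<close> the linear term dominates. The choice
  \<open>x = - t w\<close> with \<open>c * t < 2\<close> makes the form negative unless
  \<open>w = 0\<close>.\<close>

lemma complex_linear_form_zero: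
  fixes w :: complex and c :: real
  assumes "\<And>x. 0 \<le> c * (cmod x)\<^sup>2 + 2 * Re (cnj x * w)"
  shows "w = 0"
proof (rule ccontr)
  assume w: "w \<noteq> 0"
  define t where "t = 1 / (\<bar>c\<bar> + 1)"
  have t: "0 < t" "c * t < 2" unfolding t_def by (auto simp: field_simps)
  have "Re (cnj (- of_real t * w) * w) = - t * (cmod w)\<^sup>2"
    unfolding cmod_power2 by (simp add: power2_eq_square algebra_simps)
  then have "0 \<le> c * (t * cmod w)\<^sup>2 - 2 * t * (cmod w)\<^sup>2"
    using assms[of "- of_real t * w"] t(1) by (simp add: norm_mult)
  also have "\<dots> = t * (cmod w)\<^sup>2 * (c * t - 2)" by (simp add: power2_eq_square algebra_simps)
  also have "\<dots> < 0" using t w by (intro mult_pos_neg) auto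
  finally show False by simp
qed

text \<open>Positivity at the group algebra element \<open>z + (q 0 + \<dots> + q (N - 1)) / N\<close>.\<close>
lemma (in positive_class_function) mean_of_copies_nonneg:
  assumes p: "permutation p" and N: "0 < (N::nat)" and q: "\<And>j. j < N \<Longrightarrow> permutation (q j) \<and> g (q j) = g p"
  shows "0 \<le> (cmod z)\<^sup>2 * Re (g id) + 2 * Re (cnj z * g p)
    + Re (\<Sum>i<N. \<Sum>j<N. g (inv (q i) \<circ> q j)) / (real N)\<^sup>2"
proof -
  \<comment> \<open>\<open>None\<close> indexes the identity with coefficient \<open>z\<close>, and
    \<open>Some j\<close> the copy \<open>q j\<close> with coefficient \<open>1 / N\<close>.\<close>
  define u where "u = case_option id q"
  define w where "w = case_option z (\<lambda>_ :: nat. 1 / of_nat N :: complex)"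
  define I :: "nat option set" where "I = insert None (Some ` {..<N})"
  have q': "permutation (q j)" "g (q j) = g p" "g (inv (q j)) = cnj (g p)" if "j < N" for j
    using q[OF that] hermitian[of "q j"] by auto
  have "0 \<le> Re (\<Sum>i\<in>I. \<Sum>j\<in>I. cnj (w i) * g (inv (u i) \<circ> u j) * w j)"
    by (rule positive) (auto simp: u_def q' I_def)
  also have "(\<Sum>i\<in>I. \<Sum>j\<in>I. cnj (w i) * g (inv (u i) \<circ> u j) * w j) =
      cnj z * g id * z + (\<Sum>j<N. cnj z * g (q j) * (1 / of_nat N)) +
      (\<Sum>i<N. (1 / of_nat N) * g (inv (q i)) * z + (\<Sum>j<N. (1 / of_nat N) * g (inv (q i) \<circ> q j) * (1 / of_nat N)))"
    by (simp add: sum.reindex u_def w_def I_def)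
  also have "(\<Sum>j<N. cnj z * g (q j) * (1 / of_nat N)) = cnj z * g p"
    using N by (simp add: q')
  also have "(\<Sum>i<N. (1 / of_nat N) * g (inv (q i)) * z + (\<Sum>j<N. (1 / of_nat N) * g (inv (q i) \<circ> q j) * (1 / of_nat N)))
      = cnj (g p) * z + (\<Sum>i<N. \<Sum>j<N. g (inv (q i) \<circ> q j)) / of_nat N ^ 2"
    using N by (simp add: q' sum.distrib sum_divide_distrib power2_eq_square)
  finally have "0 \<le> Re (cnj z * g id * z) + Re (cnj z * g p) + Re (cnj (g p) * z)
      + Re ((\<Sum>i<N. \<Sum>j<N. g (inv (q i) \<circ> q j)) / of_nat N ^ 2)"
    by (simp only: plus_complex.sel add.assoc)
  moreover have "Re (cnj z * x * z) = (cmod z)\<^sup>2 * Re x" for x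
    unfolding cmod_power2 by (simp add: power2_eq_square algebra_simps)
  moreover have "Re (cnj (g p) * z) = Re (cnj z * g p)" by simp
  moreover have "Re (x / of_nat N ^ 2) = Re x / (real N)\<^sup>2" for x
    by (metis Re_divide_of_real of_real_of_nat_eq of_real_power)
  ultimately show ?thesis by (simp only: mult_2 add.assoc)
qed

text \<open>Positivity is used for \<open>g\<close> with arbitrary \<open>z\<close> and for
  \<open>h\<close> with \<open>z = - f p\<close>. The unknown double sums over copies add up to that
  of \<open>f\<close>, which multiplicativity evaluates. What remains for large \<open>N\<close> is
  a nonnegative form in \<open>x = z + f p\<close>, whose linear coefficient
  \<open>g p - g id * f p\<close> must vanish.\<close>

lemma multiplicative_character_extremal:
  assumes f: "multiplicative_character f" and g: "positive_class_function g" and h: "positive_class_function h"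
    and fgh: "\<And>p. permutation p \<Longrightarrow> f p = g p + h p" and p: "permutation p"
  shows "g p = g id * f p"
proof -
  interpret f: multiplicative_character f by (rule f)
  interpret g: positive_class_function g by (rule g)
  interpret h: positive_class_function h by (rule h)
  obtain A where A: "finite A" "p permutes A" using p unfolding permutation_permutes by auto
  obtain m where m: "\<And>x. x \<in> A \<Longrightarrow> x < m" using A(1) finite_nat_set_iff_bounded by auto
  \<comment> \<open>\<open>m\<close> exceeds the support of \<open>p\<close>, so distinct copies
    have disjoint supports.\<close>
  define q where "q j = shift_perm (j * m) p" for j
  have pq: "permutation (q j)" for j unfolding q_def by (rule permutation_shift[OF p])
  have vals: "f (q j) = f p" "g (q j) = g p" "h (q j) = h p" for j
    unfolding q_def using p f.value_shift g.value_shift h.value_shift by auto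
  have off: "f (inv (q i) \<circ> q j) = cnj (f p) * f p" if "i \<noteq> j" for i j
  proof -
    have disj: "(\<lambda>x. x + i * m) ` A \<inter> (\<lambda>x. x + j * m) ` A = {}" if "i < j" for i j
    proof -
      have "Suc i * m \<le> j * m" using that by (intro mult_right_mono) auto
      then show ?thesis using m by fastforce
    qed
    have "(\<lambda>x. x + i * m) ` A \<inter> (\<lambda>x. x + j * m) ` A = {}"
      using disj[of i j] disj[of j i] that by (cases "i < j") auto
    then have "f (inv (q i) \<circ> q j) = f (inv (q i)) * f (q j)"
      unfolding q_def
      by (intro f.mult[OF permutes_inv[OF shift_permutes[OF A(2)]] shift_permutes[OF A(2)]]) (use A in auto)
    then show ?thesis using f.hermitian[OF pq[of i]] vals by simp
  qed
  define a where "a = (cmod (f p))\<^sup>2"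
  have a: "cnj (f p) * f p = of_real a" unfolding a_def by (metis complex_norm_square mult.commute)
  have S: "Re (\<Sum>i<N. \<Sum>j<N. f (inv (q i) \<circ> q j)) = real N * (1 - a) + (real N)\<^sup>2 * a" for N
  proof -
    have "(\<Sum>i<N. \<Sum>j<N. f (inv (q i) \<circ> q j)) = (\<Sum>i<N. \<Sum>j<N. of_real a + (if i = j then of_real (1 - a) else 0))"
    proof (intro sum.cong refl)
      fix i j
      have "inv (q i) \<circ> q i = id"
        using pq[of i] by (simp add: permutation_bijective bij_is_inj)
      then show "f (inv (q i) \<circ> q j) = of_real a + (if i = j then of_real (1 - a) else 0)"
        using off[of i j] f.one a by (cases "i = j") auto
    qed
    also have "\<dots> = of_real (real N * (1 - a) + (real N)\<^sup>2 * a)"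
      by (simp add: sum.distrib power2_eq_square algebra_simps)
    finally show ?thesis by simp
  qed
  have gh: "g (inv (q i) \<circ> q j) + h (inv (q i) \<circ> q j) = f (inv (q i) \<circ> q j)" for i j
    using pq by (intro fgh[symmetric] permutation_compose permutation_inverse)
  \<comment> \<open>The diagonal adds \<open>N * (1 - a)\<close> to the double sum; division by the
    square of \<open>N\<close> and multiplication by \<open>N\<close> leave the constant
    \<open>1 - a\<close>.\<close>
  have main: "0 \<le> (cmod z)\<^sup>2 * Re (g id) + 2 * Re (cnj z * g p) + a * Re (h id) - 2 * Re (cnj (f p) * h p) + a" for z
  proof (rule nonneg_if_affine_bounded[of "1 - a"])
    fix N :: nat
    show "0 \<le> 1 - a + real N * ((cmod z)\<^sup>2 * Re (g id) + 2 * Re (cnj z * g p) + a * Re (h id) - 2 * Re (cnj (f p) * h p) + a)"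
    proof (cases "N = 0")
      case True
      have "\<bar>Re (f p)\<bar> \<le> 1" by (rule f.norm_le_1[OF p])
      moreover have "f p = of_real (Re (f p))" using f.real_valued[OF p] by simp
      ultimately have "a \<le> 1" unfolding a_def by (metis abs_square_le_1 norm_of_real power2_abs)
      then show ?thesis using True by simp
    next
      case False
      let ?T = "(cmod z)\<^sup>2 * Re (g id) + 2 * Re (cnj z * g p) + a * Re (h id) - 2 * Re (cnj (f p) * h p)"
      let ?G = "Re (\<Sum>i<N. \<Sum>j<N. g (inv (q i) \<circ> q j))" and ?H = "Re (\<Sum>i<N. \<Sum>j<N. h (inv (q i) \<circ> q j))"
      have GH: "?G + ?H = real N * (1 - a) + (real N)\<^sup>2 * a"
        unfolding S[symmetric] by (simp only: gh[symmetric] sum.distrib plus_complex.sel)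
      have "0 \<le> (cmod z)\<^sup>2 * Re (g id) + 2 * Re (cnj z * g p) + ?G / (real N)\<^sup>2"
        using False by (intro g.mean_of_copies_nonneg p) (auto simp: pq vals)
      moreover have "0 \<le> (cmod (- f p))\<^sup>2 * Re (h id) + 2 * Re (cnj (- f p) * h p) + ?H / (real N)\<^sup>2"
        using False by (intro h.mean_of_copies_nonneg p) (auto simp: pq vals)
      ultimately have "0 \<le> (cmod z)\<^sup>2 * Re (g id) + 2 * Re (cnj z * g p) + a * Re (h id) - 2 * Re (cnj (f p) * h p)
          + (?G + ?H) / (real N)\<^sup>2"
        by (simp add: a_def add_divide_distrib)
      then have T: "0 \<le> real N * (?T + (?G + ?H) / (real N)\<^sup>2)" by simp
      have "real N * (x + (real N * (1 - a) + (real N)\<^sup>2 * a) / (real N)\<^sup>2) = 1 - a + real N * (x + a)" for x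
        using False by (simp add: power2_eq_square field_simps)
      then show ?thesis using T unfolding GH by (simp only:)
    qed
  qed
  have "cnj (g id) = g id" using g.hermitian[of id] by simp
  then have g1: "g id = of_real (Re (g id))" by (simp add: complex_eq_iff)
  have h1: "Re (h id) = 1 - Re (g id)" using fgh[of id] f.one by (simp add: complex_eq_iff)
  have hp: "h p = f p - g p" using fgh[OF p] by simp
  have "g p - g id * f p = 0"
  proof (rule complex_linear_form_zero[of "Re (g id)"])
    fix x :: complex
    have "0 \<le> (cmod (x - f p))\<^sup>2 * Re (g id) + 2 * Re (cnj (x - f p) * g p) + a * Re (h id) - 2 * Re (cnj (f p) * h p) + a"
      by (rule main)
    also have "\<dots> = Re (g id) * (cmod x)\<^sup>2 + 2 * Re (cnj x * (g p - of_real (Re (g id)) * f p))"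
      unfolding h1 hp a_def cmod_power2 by (simp add: power2_eq_square algebra_simps)
    finally show "0 \<le> Re (g id) * (cmod x)\<^sup>2 + 2 * Re (cnj x * (g p - g id * f p))"
      using g1 by simp
  qed
  then show ?thesis by simp
qed

section \<open>The symmetric inverse semigroup\<close>

lemma R_inf_01:
  assumes "r \<in> R_inf"
  shows "r i j = 0 \<or> r i j = 1"
proof -
  have "\<forall>i j. r i j \<in> {0, 1}"
    using assms unfolding R_inf_def mem_Collect_eq by (rule conjunct1)
  then show ?thesis by simp
qed

lemma R_inf_eqI:
  assumes "r \<in> R_inf" "s \<in> R_inf" "\<And>i j. r i j = 1 \<longleftrightarrow> s i j = 1"
  shows "r = s"
proof (intro ext)
  fix i j
  show "r i j = s i j"
    using R_inf_01[OF assms(1), of i j] R_inf_01[OF assms(2), of i j] assms(3)[of i j] by metis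
qed

lemma R_inf_row: "r \<in> R_inf \<Longrightarrow> r i j = 1 \<Longrightarrow> r i k = 1 \<Longrightarrow> j = k"
  unfolding R_inf_def by blast

lemma R_inf_col: "r \<in> R_inf \<Longrightarrow> r i k = 1 \<Longrightarrow> r j k = 1 \<Longrightarrow> i = j"
  unfolding R_inf_def by blast

text \<open>Elements of the semigroup are partial injections and their product is composition of
  relations; this replaces the sums by statements about entries equal to 1.\<close>

lemma mat_mult_R_inf:
  assumes r: "r \<in> R_inf" and s: "s \<in> R_inf"
  shows "(r \<odot> s) i j = (if \<exists>k. r i k = 1 \<and> s k j = 1 then 1 else 0)"
proof (cases "\<exists>k. r i k = 1")
  case True
  then obtain k where k: "r i k = 1" by blast
  have "r i l \<noteq> 0 \<longleftrightarrow> l = k" for l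
    using R_inf_row[OF r k, of l] R_inf_01[OF r, of i l] k by (metis zero_neq_one)
  then have "{k. r i k \<noteq> 0} = {k}" by simp
  then have "(r \<odot> s) i j = s k j" using k by (simp add: mat_mult_def)
  moreover have "(\<exists>k. r i k = 1 \<and> s k j = 1) \<longleftrightarrow> s k j = 1" using k R_inf_row[OF r k] by metis
  ultimately show ?thesis using R_inf_01[OF s, of k j] by auto
next
  case False
  then have "{k. r i k \<noteq> 0} = {}" using R_inf_01[OF r, of i] by auto
  then have "(r \<odot> s) i j = 0" by (simp add: mat_mult_def)
  then show ?thesis using False by auto
qed

lemma mat_mult_eq_1:
  "r \<in> R_inf \<Longrightarrow> s \<in> R_inf \<Longrightarrow> (r \<odot> s) i j = 1 \<longleftrightarrow> (\<exists>k. r i k = 1 \<and> s k j = 1)"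
  by (simp add: mat_mult_R_inf)

lemma mat_mult_closed:
  assumes r: "r \<in> R_inf" and s: "s \<in> R_inf"
  shows "r \<odot> s \<in> R_inf"
proof -
  obtain N M where N: "\<And>n. n \<ge> N \<Longrightarrow> r n n = 1" and M: "\<And>n. n \<ge> M \<Longrightarrow> s n n = 1"
    using r s unfolding R_inf_def by blast
  note eq = mat_mult_eq_1[OF r s]
  show ?thesis
    unfolding R_inf_def
  proof (intro CollectI conjI allI impI)
    show "(r \<odot> s) i j \<in> {0, 1}" for i j by (simp add: mat_mult_R_inf[OF r s])
  next
    fix i j k assume "(r \<odot> s) i j = 1 \<and> (r \<odot> s) i k = 1"
    then show "j = k" unfolding eq using R_inf_row[OF r, of i] R_inf_row[OF s] by metis
  next
    fix i j k assume "(r \<odot> s) i k = 1 \<and> (r \<odot> s) j k = 1"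
    then show "i = j" unfolding eq using R_inf_col[OF r] R_inf_col[OF s, of _ k] by metis
  next
    have "\<forall>n\<ge>max N M. (r \<odot> s) n n = 1" unfolding eq using N M by auto
    then show "\<exists>N. \<forall>n\<ge>N. (r \<odot> s) n n = 1" by blast
  qed
qed

lemma mat_star_closed: "r \<in> R_inf \<Longrightarrow> mat_star r \<in> R_inf"
  unfolding R_inf_def mat_star_def by blast

lemma mat_mult_assoc:
  assumes "r \<in> R_inf" "s \<in> R_inf" "t \<in> R_inf"
  shows "r \<odot> s \<odot> t = r \<odot> (s \<odot> t)"
proof (rule R_inf_eqI)
  note rs = mat_mult_closed[OF assms(1,2)] and st = mat_mult_closed[OF assms(2,3)]
  show "(r \<odot> s \<odot> t) i j = 1 \<longleftrightarrow> (r \<odot> (s \<odot> t)) i j = 1" for i j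
    unfolding mat_mult_eq_1[OF rs assms(3)] mat_mult_eq_1[OF assms(1) st]
      mat_mult_eq_1[OF assms(1,2)] mat_mult_eq_1[OF assms(2,3)] by blast
qed (use assms in \<open>auto intro: mat_mult_closed\<close>)

lemma mat_star_mult:
  assumes "r \<in> R_inf" "s \<in> R_inf"
  shows "mat_star (r \<odot> s) = mat_star s \<odot> mat_star r"
proof (rule R_inf_eqI)
  fix i j
  have "mat_star (r \<odot> s) i j = 1 \<longleftrightarrow> (\<exists>k. r j k = 1 \<and> s k i = 1)"
    unfolding mat_star_def mat_mult_eq_1[OF assms] ..
  moreover have "(mat_star s \<odot> mat_star r) i j = 1 \<longleftrightarrow> (\<exists>k. s k i = 1 \<and> r j k = 1)"
    unfolding mat_mult_eq_1[OF mat_star_closed[OF assms(2)] mat_star_closed[OF assms(1)]]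
    by (simp add: mat_star_def)
  ultimately show "mat_star (r \<odot> s) i j = 1 \<longleftrightarrow> (mat_star s \<odot> mat_star r) i j = 1" by blast
qed (use assms in \<open>auto intro: mat_star_closed mat_mult_closed\<close>)

lemma mat_star_star [simp]: "mat_star (mat_star r) = r"
  by (simp add: mat_star_def)

lemma S_inf_permutation: "S_inf = perm_matrix ` {p. permutation p}"
  by (simp add: S_inf_def permutation)

lemma perm_matrix_in_R_inf: "permutation p \<Longrightarrow> perm_matrix p \<in> R_inf"
  using S_inf_subset_R_inf S_inf_permutation by auto

lemma perm_matrix_in_S_inf: "permutation p \<Longrightarrow> perm_matrix p \<in> S_inf"
  by (simp add: S_inf_permutation)

lemma mat_one_in_R_inf: "mat_one \<in> R_inf"
  using perm_matrix_in_R_inf[of id] by (simp add: perm_matrix_id)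

lemma mat_mult_one:
  assumes "r \<in> R_inf"
  shows "r \<odot> mat_one = r" "mat_one \<odot> r = r"
proof -
  have one: "mat_one i j = 1 \<longleftrightarrow> i = j" for i j by (simp add: mat_one_def)
  show "r \<odot> mat_one = r" "mat_one \<odot> r = r"
    by (rule R_inf_eqI[OF mat_mult_closed[OF assms mat_one_in_R_inf] assms],
        unfold mat_mult_eq_1[OF assms mat_one_in_R_inf] one, blast)
      (rule R_inf_eqI[OF mat_mult_closed[OF mat_one_in_R_inf assms] assms],
        unfold mat_mult_eq_1[OF mat_one_in_R_inf assms] one, blast)
qed

lemma mat_star_one: "mat_star mat_one = mat_one"
  by (auto simp: mat_star_def mat_one_def fun_eq_iff)

lemma perm_matrix_compose: "permutation p \<Longrightarrow> perm_matrix (p \<circ> q) = perm_matrix p \<odot> perm_matrix q"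
  by (rule perm_matrix_comp) (rule permutation_bijective)

lemma mat_star_perm: "permutation p \<Longrightarrow> mat_star (perm_matrix p) = perm_matrix (inv p)"
  by (rule mat_star_perm_matrix) (rule permutation_bijective)

lemma perm_matrix_inv: "permutation p \<Longrightarrow> perm_matrix p \<odot> perm_matrix (inv p) = mat_one"
  "permutation p \<Longrightarrow> perm_matrix (inv p) \<odot> perm_matrix p = mat_one"
  using perm_matrix_compose[of p "inv p"] perm_matrix_compose[of "inv p" p] permutation_inverse[of p]
    permutation_bijective[of p]
  by (simp_all add: perm_matrix_id bij_is_inj surj_iff[THEN iffD1, OF bij_is_surj])

text \<open>\<open>r\<close> is the identity from \<open>N\<close> on and, with at most one 1 in
  each row and column, cannot link indices below \<open>N\<close> to those above, while
  \<open>p\<close> acts only from \<open>N\<close> on.\<close>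

lemma mat_mult_commute_disjoint:
  assumes r: "r \<in> R_inf" "\<And>n. N \<le> n \<Longrightarrow> r n n = 1" and p: "p permutes S" "finite S" "S \<subseteq> {N..}"
  shows "r \<odot> perm_matrix p = perm_matrix p \<odot> r"
proof -
  have pp: "permutation p" using p unfolding permutation_permutes by blast
  note P = perm_matrix_in_R_inf[OF pp]
  have fix_low: "p j = j" if "j < N" for j using p that by (intro permutes_not_in[OF p(1)]) auto
  have high: "N \<le> p j" if "N \<le> j" for j
  proof (rule ccontr)
    assume "\<not> N \<le> p j"
    then have "p (p j) = p j" by (intro fix_low) simp
    then have "p j = j" using permutes_inj[OF p(1)] by (metis injD)
    then show False using that \<open>\<not> N \<le> p j\<close> by simp
  qed
  have iff: "r i (p j) = 1 \<longleftrightarrow> (\<exists>k. i = p k \<and> r k j = 1)" for i j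
  proof (cases "N \<le> j")
    case True
    have "r i (p j) = 1 \<longleftrightarrow> i = p j"
      using R_inf_col[OF r(1), of _ "p j"] r(2)[OF high[OF True]] by metis
    moreover have "r k j = 1 \<longleftrightarrow> k = j" for k
      using R_inf_col[OF r(1), of _ j] r(2)[OF True] by metis
    ultimately show ?thesis by auto
  next
    case False
    have low: "i < N" if "r i j = 1" for i
    proof (rule ccontr)
      assume "\<not> i < N"
      then have "r i i = 1" using r(2) by simp
      then have "i = j" using R_inf_row[OF r(1)] that by blast
      then show False using False \<open>\<not> i < N\<close> by simp
    qed
    show ?thesis using False fix_low low by (metis not_le)
  qed
  show ?thesis
  proof (rule R_inf_eqI)
    fix i j
    have "(r \<odot> perm_matrix p) i j = 1 \<longleftrightarrow> r i (p j) = 1"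
      unfolding mat_mult_eq_1[OF r(1) P] by (auto simp: perm_matrix_def split: if_splits)
    moreover have "(perm_matrix p \<odot> r) i j = 1 \<longleftrightarrow> (\<exists>k. i = p k \<and> r k j = 1)"
      unfolding mat_mult_eq_1[OF P r(1)] by (auto simp: perm_matrix_def split: if_splits)
    ultimately show "(r \<odot> perm_matrix p) i j = 1 \<longleftrightarrow> (perm_matrix p \<odot> r) i j = 1"
      using iff by blast
  qed (use r P in \<open>auto intro: mat_mult_closed\<close>)
qed

section \<open>Positive definite functions on sets of matrices\<close>

lemma positive_definite_onD:
  fixes r :: "'i \<Rightarrow> inf_matrix" and z :: "'i \<Rightarrow> complex"
  assumes f: "positive_definite_on G f" and I: "finite I" "\<And>i. i \<in> I \<Longrightarrow> r i \<in> G"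
  shows "0 \<le> Re (\<Sum>i\<in>I. \<Sum>j\<in>I. cnj (z i) * f (mat_star (r i) \<odot> r j) * z j)"
proof -
  obtain h where h: "bij_betw h {..<card I} I"
    using ex_bij_betw_nat_finite[OF I(1)] by (auto simp: atLeast0LessThan)
  have "(\<Sum>i\<in>I. \<Sum>j\<in>I. cnj (z i) * f (mat_star (r i) \<odot> r j) * z j)
      = (\<Sum>i<card I. \<Sum>j<card I. cnj (z (h i)) * f (mat_star (r (h i)) \<odot> r (h j)) * z (h j))"
    by (subst sum.reindex_bij_betw[OF h, symmetric], rule sum.cong[OF refl],
        subst sum.reindex_bij_betw[OF h, symmetric], rule refl)
  moreover have "\<forall>i<card I. r (h i) \<in> G" using I(2) bij_betwE[OF h] by auto
  then have "hermitian_nonneg_definite (card I) (\<lambda>i j. f (mat_star (r (h i)) \<odot> r (h j)))"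
    using f[unfolded positive_definite_on_def, rule_format, of "card I" "\<lambda>i. r (h i)"] by blast
  then have "0 \<le> Re (\<Sum>i<card I. \<Sum>j<card I. cnj (z (h i)) * f (mat_star (r (h i)) \<odot> r (h j)) * z (h j))"
    unfolding hermitian_nonneg_definite_def by (elim conjE allE[of _ "\<lambda>i. z (h i)"]) blast
  ultimately show ?thesis by simp
qed

lemma positive_definite_on_hermitian:
  assumes f: "positive_definite_on G f" and G: "mat_one \<in> G" "G \<subseteq> R_inf" and r: "r \<in> G"
  shows "f (mat_star r) = cnj (f r)"
proof -
  let ?r = "\<lambda>i::nat. if i = 0 then mat_one else r"
  have "\<forall>i<2. ?r i \<in> G" using G r by simp
  then have "hermitian_nonneg_definite 2 (\<lambda>i j. f (mat_star (?r i) \<odot> ?r j))"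
    using f[unfolded positive_definite_on_def, rule_format, of 2 ?r] by blast
  then have "f (mat_star (?r j) \<odot> ?r i) = cnj (f (mat_star (?r i) \<odot> ?r j))" if "i < 2" "j < 2" for i j
    using that unfolding hermitian_nonneg_definite_def by blast
  from this[of 0 1] have "f (mat_star r \<odot> mat_one) = cnj (f (mat_star mat_one \<odot> r))"
    by simp
  moreover have "mat_star r \<odot> mat_one = mat_star r" "mat_star mat_one \<odot> r = r"
    using r G by (auto simp: mat_star_one intro!: mat_mult_one mat_star_closed)
  ultimately show ?thesis by simp
qed

lemma positive_definite_onI:
  assumes herm: "\<And>r s. r \<in> G \<Longrightarrow> s \<in> G \<Longrightarrow> f (mat_star s \<odot> r) = cnj (f (mat_star r \<odot> s))"
    and pos: "\<And>(n::nat) r z. (\<And>i. i < n \<Longrightarrow> r i \<in> G) \<Longrightarrow>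
      0 \<le> Re (\<Sum>i<n. \<Sum>j<n. cnj (z i) * f (mat_star (r i) \<odot> r j) * z j)"
  shows "positive_definite_on G f"
  unfolding positive_definite_on_def hermitian_nonneg_definite_def
proof (intro allI impI conjI)
  fix n :: nat and r :: "nat \<Rightarrow> inf_matrix" and z :: "nat \<Rightarrow> complex"
  assume r: "\<forall>i<n. r i \<in> G"
  show "0 \<le> Re (\<Sum>i<n. \<Sum>j<n. cnj (z i) * f (mat_star (r i) \<odot> r j) * z j)"
    by (rule pos) (use r in auto)
  have "cnj (\<Sum>i<n. \<Sum>j<n. cnj (z i) * f (mat_star (r i) \<odot> r j) * z j)
      = (\<Sum>i<n. \<Sum>j<n. cnj (z j) * f (mat_star (r j) \<odot> r i) * z i)"
    unfolding cnj_sum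
  proof (intro sum.cong refl)
    fix i j assume "i \<in> {..<n}" "j \<in> {..<n}"
    then have "f (mat_star (r j) \<odot> r i) = cnj (f (mat_star (r i) \<odot> r j))" using r by (intro herm) auto
    then show "cnj (cnj (z i) * f (mat_star (r i) \<odot> r j) * z j) = cnj (z j) * f (mat_star (r j) \<odot> r i) * z i"
      by simp
  qed
  also have "\<dots> = (\<Sum>i<n. \<Sum>j<n. cnj (z i) * f (mat_star (r i) \<odot> r j) * z j)" by (rule sum.swap)
  finally show "(\<Sum>i<n. \<Sum>j<n. cnj (z i) * f (mat_star (r i) \<odot> r j) * z j) \<in> \<real>"
    by (simp only: Reals_cnj_iff)
next
  fix n :: nat and r :: "nat \<Rightarrow> inf_matrix" and i j
  assume "\<forall>i<n. r i \<in> G" "i < n" "j < n"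
  then show "f (mat_star (r j) \<odot> r i) = cnj (f (mat_star (r i) \<odot> r j))" by (intro herm) auto
qed

lemma mat_one_in_S_inf: "mat_one \<in> S_inf"
  using perm_matrix_in_S_inf[of id] by (simp add: perm_matrix_id)

lemma positive_class_function_restrict:
  assumes c: "central_on S_inf f" and f: "positive_definite_on S_inf f"
  shows "positive_class_function (\<lambda>p. f (perm_matrix p))"
proof
  fix p q :: "nat \<Rightarrow> nat" assume "permutation p" "permutation q"
  then show "f (perm_matrix (p \<circ> q)) = f (perm_matrix (q \<circ> p))"
    using c perm_matrix_in_S_inf unfolding central_on_def by (simp add: perm_matrix_compose)
next
  fix p :: "nat \<Rightarrow> nat" assume "permutation p"
  then show "f (perm_matrix (inv p)) = cnj (f (perm_matrix p))"
    using positive_definite_on_hermitian[OF f mat_one_in_S_inf S_inf_subset_R_inf perm_matrix_in_S_inf]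
    by (simp add: mat_star_perm)
next
  fix n :: nat and v :: "nat \<Rightarrow> nat \<Rightarrow> nat" and w :: "nat \<Rightarrow> complex"
  assume v: "\<And>i. i < n \<Longrightarrow> permutation (v i)"
  have "0 \<le> Re (\<Sum>i<n. \<Sum>j<n. cnj (w i) * f (mat_star (perm_matrix (v i)) \<odot> perm_matrix (v j)) * w j)"
    by (rule positive_definite_onD[OF f]) (use v perm_matrix_in_S_inf in auto)
  also have "(\<Sum>i<n. \<Sum>j<n. cnj (w i) * f (mat_star (perm_matrix (v i)) \<odot> perm_matrix (v j)) * w j)
    = (\<Sum>i<n. \<Sum>j<n. cnj (w i) * f (perm_matrix (inv (v i) \<circ> v j)) * w j)"
    by (intro sum.cong refl) (simp add: v mat_star_perm perm_matrix_compose permutation_inverse)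
  finally show "0 \<le> Re (\<Sum>i<n. \<Sum>j<n. cnj (w i) * f (perm_matrix (inv (v i) \<circ> v j)) * w j)" .
qed

section \<open>Moving permutations away from the support of a matrix\<close>

definition support_bound :: "inf_matrix \<Rightarrow> nat" where
  "support_bound r = (LEAST N. \<forall>n\<ge>N. r n n = 1)"

lemma support_bound: "r \<in> R_inf \<Longrightarrow> support_bound r \<le> n \<Longrightarrow> r n n = 1"
  using LeastI_ex[of "\<lambda>N. \<forall>n\<ge>N. r n n = 1"] unfolding support_bound_def R_inf_def by blast

text \<open>For larger shifts the value is the same: this is the limit of \<open>f (r P)\<close> along copies \<open>P\<close> of \<open>p\<close> moving to infinity.\<close>
definition far :: "(inf_matrix \<Rightarrow> complex) \<Rightarrow> (nat \<Rightarrow> nat) \<Rightarrow> inf_matrix \<Rightarrow> complex" where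
  "far f p r = f (r \<odot> perm_matrix (shift_perm (support_bound r) p))"

locale R_inf_character =
  fixes f :: "inf_matrix \<Rightarrow> complex"
  assumes central: "central_on R_inf f" and posdef: "positive_definite_on R_inf f"
begin

lemma commute: "r \<in> R_inf \<Longrightarrow> s \<in> R_inf \<Longrightarrow> f (r \<odot> s) = f (s \<odot> r)"
  using central unfolding central_on_def by blast

lemma hermitian: "r \<in> R_inf \<Longrightarrow> f (mat_star r) = cnj (f r)"
  by (rule positive_definite_on_hermitian[OF posdef mat_one_in_R_inf order_refl])

text \<open>Two copies of \<open>p\<close> beyond the support of \<open>r\<close> are conjugate by a
  permutation that also lives beyond it and so commutes with \<open>r\<close>; centrality removes
  the conjugation.\<close>

lemma far_eq:
  assumes r: "r \<in> R_inf" and p: "permutation p" and n: "support_bound r \<le> n"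
  shows "f (r \<odot> perm_matrix (shift_perm n p)) = far f p r"
proof -
  obtain A where A: "finite A" "p permutes A" using p unfolding permutation_permutes by auto
  let ?m = "support_bound r"
  obtain \<tau> where t: "\<tau> permutes ((\<lambda>x. x + ?m) ` A \<union> (\<lambda>x. x + n) ` A)"
    "\<tau> \<circ> shift_perm ?m p \<circ> inv \<tau> = shift_perm n p"
    using shift_conjugate[OF A(2,1)] by metis
  have pt: "permutation \<tau>" unfolding permutation_permutes
    by (rule exI, rule conjI[OF _ t(1)]) (use A in simp)
  let ?T = "perm_matrix \<tau>" and ?T' = "perm_matrix (inv \<tau>)" and ?P = "perm_matrix (shift_perm ?m p)"
  have R: "?T \<in> R_inf" "?T' \<in> R_inf" "?P \<in> R_inf"
    using pt p by (auto intro!: perm_matrix_in_R_inf permutation_inverse permutation_shift)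
  have "r \<odot> ?T = ?T \<odot> r"
    by (rule mat_mult_commute_disjoint[OF r support_bound[OF r] t(1)]) (use A n in auto)
  moreover have "perm_matrix (shift_perm n p) = ?T \<odot> ?P \<odot> ?T'"
    using t(2) pt p by (metis perm_matrix_compose permutation_compose permutation_shift)
  ultimately have "r \<odot> perm_matrix (shift_perm n p) = ?T \<odot> (r \<odot> ?P) \<odot> ?T'"
    using r R by (simp add: mat_mult_assoc mat_mult_closed) (metis mat_mult_assoc mat_mult_closed)
  then have "f (r \<odot> perm_matrix (shift_perm n p)) = f (?T' \<odot> (?T \<odot> (r \<odot> ?P)))"
    using commute[of "?T \<odot> (r \<odot> ?P)" ?T'] r R by (simp add: mat_mult_closed)
  also have "?T' \<odot> (?T \<odot> (r \<odot> ?P)) = r \<odot> ?P"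
    using r R perm_matrix_inv(2)[OF pt] mat_mult_one(2)[OF r]
    by (simp add: mat_mult_assoc[symmetric] mat_mult_closed)
  finally show ?thesis by (simp add: far_def)
qed

text \<open>A copy \<open>P\<close> far enough out commutes with \<open>r\<close>, so
  \<open>f (r s P) = f (s P r) = f (s r P)\<close>. The shift exceeds the bounds of both products,
  so both far values can be computed with the same copy.\<close>

lemma far_central:
  assumes r: "r \<in> R_inf" and s: "s \<in> R_inf" and p: "permutation p"
  shows "far f p (r \<odot> s) = far f p (s \<odot> r)"
proof -
  define n where "n = max (support_bound r) (max (support_bound (r \<odot> s)) (support_bound (s \<odot> r)))"
  obtain A where A: "finite A" "p permutes A" using p unfolding permutation_permutes by auto
  let ?P = "perm_matrix (shift_perm n p)"
  have P: "?P \<in> R_inf" using p by (intro perm_matrix_in_R_inf permutation_shift)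
  have c: "r \<odot> ?P = ?P \<odot> r"
    by (rule mat_mult_commute_disjoint[OF r support_bound[OF r] shift_permutes[OF A(2)]])
      (use A in \<open>auto simp: n_def\<close>)
  have "far f p (r \<odot> s) = f (r \<odot> s \<odot> ?P)"
    using r s p by (intro far_eq[symmetric] mat_mult_closed) (auto simp: n_def)
  also have "\<dots> = f (s \<odot> ?P \<odot> r)"
    using commute[of r "s \<odot> ?P"] r s P by (simp add: mat_mult_assoc mat_mult_closed)
  also have "s \<odot> ?P \<odot> r = s \<odot> r \<odot> ?P"
    using r s P c by (simp add: mat_mult_assoc)
  also have "f \<dots> = far f p (s \<odot> r)"
    using r s p by (intro far_eq mat_mult_closed) (auto simp: n_def)
  finally show ?thesis .
qed

lemma mat_star_shift:
  "permutation p \<Longrightarrow> mat_star (perm_matrix (shift_perm n p)) = perm_matrix (shift_perm n (inv p))"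
  by (simp add: mat_star_perm permutation_shift shift_inv permutation_bijective)

lemma far_star:
  assumes r: "r \<in> R_inf" and p: "permutation p"
  shows "far f p (mat_star r) = cnj (far f (inv p) r)"
proof -
  define n where "n = max (support_bound r) (support_bound (mat_star r))"
  let ?P = "perm_matrix (shift_perm n p)" and ?Q = "perm_matrix (shift_perm n (inv p))"
  have P: "?P \<in> R_inf" and Q: "?Q \<in> R_inf"
    using p by (auto intro!: perm_matrix_in_R_inf permutation_shift permutation_inverse)
  have "mat_star ?Q = ?P" using mat_star_shift[OF p, of n] by (metis mat_star_star)
  have "far f p (mat_star r) = f (mat_star r \<odot> ?P)"
    using r p by (intro far_eq[symmetric] mat_star_closed) (auto simp: n_def)
  also have "mat_star r \<odot> ?P = mat_star (?Q \<odot> r)"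
    using r Q \<open>mat_star ?Q = ?P\<close> by (simp add: mat_star_mult)
  also have "f \<dots> = cnj (f (r \<odot> ?Q))"
    using hermitian[of "?Q \<odot> r"] commute[of ?Q r] r Q by (simp add: mat_mult_closed)
  also have "f (r \<odot> ?Q) = far f (inv p) r"
    using r p by (intro far_eq permutation_inverse) (auto simp: n_def)
  finally show ?thesis .
qed

text \<open>The normalization makes the functions for \<open>c\<close> and \<open>- c\<close> add up
  to \<open>f\<close>.\<close>

definition far_part :: "complex \<Rightarrow> (nat \<Rightarrow> nat) \<Rightarrow> inf_matrix \<Rightarrow> complex" where
  "far_part c p r = (f r + (c * far f p r + cnj c * far f (inv p) r) / 2) / 2"

lemma far_part_central: "permutation p \<Longrightarrow> central_on R_inf (far_part c p)"
  unfolding central_on_def far_part_def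
  by (auto simp: commute far_central permutation_inverse)

text \<open>Each test element \<open>r i\<close> is accompanied by \<open>r i P\<close> with the
  extra coefficient \<open>c\<close>, where one copy \<open>P\<close> of \<open>p\<close> lies
  beyond the supports of all \<open>mat_star (r i) \<odot> r j\<close>. The two mixed terms are far
  values; in the term with \<open>P\<close> on both sides, centrality brings \<open>P\<close> next
  to its inverse.\<close>

lemma far_part_positive_definite:
  assumes p: "permutation p" and c: "cmod c = 1"
  shows "positive_definite_on R_inf (far_part c p)"
proof (rule positive_definite_onI)
  fix r s assume r: "r \<in> R_inf" and s: "s \<in> R_inf"
  have X: "mat_star r \<odot> s \<in> R_inf" using r s by (intro mat_mult_closed mat_star_closed)
  have "mat_star s \<odot> r = mat_star (mat_star r \<odot> s)"
    using r s by (simp add: mat_star_mult mat_star_closed)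
  then show "far_part c p (mat_star s \<odot> r) = cnj (far_part c p (mat_star r \<odot> s))"
    using hermitian[OF X] far_star[OF X p] far_star[OF X permutation_inverse[OF p]]
    by (simp add: far_part_def inv_inv_eq permutation_bijective[OF p] add.commute)
next
  fix n :: nat and r :: "nat \<Rightarrow> inf_matrix" and z :: "nat \<Rightarrow> complex"
  assume r: "\<And>i. i < n \<Longrightarrow> r i \<in> R_inf"
  let ?X = "\<lambda>i j. mat_star (r i) \<odot> r j"
  have X: "?X i j \<in> R_inf" if "i < n" "j < n" for i j
    using r that by (intro mat_mult_closed mat_star_closed) auto
  obtain N where N: "\<And>i j. i < n \<Longrightarrow> j < n \<Longrightarrow> support_bound (?X i j) \<le> N"
  proof
    fix i j assume "i < n" "j < n"
    then show "support_bound (?X i j) \<le> Max ((\<lambda>(i, j). support_bound (?X i j)) ` ({..<n} \<times> {..<n}))"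
      by (intro Max_ge) auto
  qed
  let ?P = "perm_matrix (shift_perm N p)" and ?Q = "perm_matrix (shift_perm N (inv p))"
  have P: "?P \<in> R_inf" and Q: "?Q \<in> R_inf"
    using p by (auto intro!: perm_matrix_in_R_inf permutation_shift permutation_inverse)
  have starP: "mat_star ?P = ?Q" by (rule mat_star_shift[OF p])
  have PQ: "?P \<odot> ?Q = mat_one"
    using perm_matrix_inv(1)[OF permutation_shift[OF p, of N]] shift_inv[OF permutation_bijective[OF p], of N] by simp
  let ?r = "\<lambda>u. if snd u then r (fst u) \<odot> ?P else r (fst u)"
  let ?z = "\<lambda>u. if snd u then c * z (fst u) else z (fst u)"
  let ?F = "\<lambda>u v. cnj (?z u) * f (mat_star (?r u) \<odot> ?r v) * ?z v"
  have cc: "cnj c * c = 1" using c complex_norm_square[of c] by (simp add: mult.commute)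
  have F: "(\<Sum>x\<in>UNIV. \<Sum>y\<in>UNIV. ?F (i, x) (j, y)) = 4 * (cnj (z i) * far_part c p (?X i j) * z j)"
    if i: "i < n" and j: "j < n" for i j
  proof -
    note ri = r[OF i] and rj = r[OF j] and Xij = X[OF i j]
    note ri' = mat_star_closed[OF ri]
    have FT: "f (mat_star (r i) \<odot> (r j \<odot> ?P)) = far f p (?X i j)"
      using far_eq[OF Xij p N[OF i j]] mat_mult_assoc[OF ri' rj P] by simp
    have "mat_star (r i \<odot> ?P) \<odot> r j = ?Q \<odot> ?X i j"
      using mat_star_mult[OF ri P] mat_mult_assoc[OF Q ri' rj] starP by simp
    then have TF: "f (mat_star (r i \<odot> ?P) \<odot> r j) = far f (inv p) (?X i j)"
      using commute[OF Q Xij] far_eq[OF Xij permutation_inverse[OF p] N[OF i j]] by simp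
    have "mat_star (r i \<odot> ?P) \<odot> (r j \<odot> ?P) = ?Q \<odot> (?X i j \<odot> ?P)"
      using mat_star_mult[OF ri P] starP mat_mult_assoc[OF Q ri' mat_mult_closed[OF rj P]] mat_mult_assoc[OF ri' rj P]
      by simp
    moreover have "f (?Q \<odot> (?X i j \<odot> ?P)) = f (?X i j \<odot> (?P \<odot> ?Q))"
      using commute[OF Q mat_mult_closed[OF Xij P]] mat_mult_assoc[OF Xij P Q] by simp
    ultimately have TT: "f (mat_star (r i \<odot> ?P) \<odot> (r j \<odot> ?P)) = f (?X i j)"
      using PQ mat_mult_one(1)[OF Xij] by simp
    have "(\<Sum>x\<in>UNIV. \<Sum>y\<in>UNIV. ?F (i, x) (j, y)) = cnj (z i) * f (?X i j) * z j
        + cnj (z i) * far f p (?X i j) * (c * z j) + cnj (c * z i) * far f (inv p) (?X i j) * z j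
        + cnj (c * z i) * f (?X i j) * (c * z j)"
      by (simp add: sum_bool FT TF TT)
    also have "cnj (c * z i) * f (?X i j) * (c * z j) = (cnj c * c) * (cnj (z i) * f (?X i j) * z j)"
      by (simp add: mult_ac)
    finally show ?thesis unfolding cc by (simp add: far_part_def algebra_simps)
  qed
  have "0 \<le> Re (\<Sum>u\<in>{..<n} \<times> UNIV. \<Sum>v\<in>{..<n} \<times> UNIV. ?F u v)"
    by (rule positive_definite_onD[OF posdef, where r = ?r and z = ?z])
      (use r P in \<open>auto intro: mat_mult_closed\<close>)
  also have "(\<Sum>u\<in>{..<n} \<times> UNIV. \<Sum>v\<in>{..<n} \<times> UNIV. ?F u v)
      = (\<Sum>i<n. \<Sum>x\<in>UNIV. \<Sum>j<n. \<Sum>y\<in>UNIV. ?F (i, x) (j, y))"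
    by (simp only: sum.cartesian_product')
  also have "\<dots> = (\<Sum>i<n. \<Sum>j<n. \<Sum>x\<in>UNIV. \<Sum>y\<in>UNIV. ?F (i, x) (j, y))"
    by (intro sum.cong refl sum.swap)
  also have "\<dots> = 4 * (\<Sum>i<n. \<Sum>j<n. cnj (z i) * far_part c p (?X i j) * z j)"
    unfolding sum_distrib_left by (intro sum.cong refl) (use F in auto)
  finally show "0 \<le> Re (\<Sum>i<n. \<Sum>j<n. cnj (z i) * far_part c p (?X i j) * z j)" by simp
qed

end

text \<open>A relation \<open>a g + b h = 0\<close> and \<open>f = g + h\<close> give
  \<open>(a - b) g = - b f\<close>; the case \<open>a = b\<close> is excluded by evaluation at
  \<open>mat_one\<close>.\<close>

lemma indecomposable_proportional:
  assumes ind: "indecomposable_on G f" and one: "f mat_one = 1" "mat_one \<in> G"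
    and g: "central_on G g" "positive_definite_on G g" and h: "central_on G h" "positive_definite_on G h"
    and fgh: "\<And>r. r \<in> G \<Longrightarrow> f r = g r + h r" and r: "r \<in> G"
  shows "g r = g mat_one * f r"
proof -
  have "\<not> linearly_independent_on G g h"
    using ind g h fgh unfolding indecomposable_on_def by blast
  then obtain a b where ab: "\<And>r. r \<in> G \<Longrightarrow> a * g r + b * h r = 0" "\<not> (a = 0 \<and> b = 0)"
    unfolding linearly_independent_on_def by blast
  have eq: "(a - b) * g s = - b * f s" if "s \<in> G" for s
    using ab(1)[OF that] fgh[OF that] by (simp add: algebra_simps)
  have "a \<noteq> b"
  proof
    assume "a = b"
    then have "b = 0" using eq[OF one(2)] one(1) by simp
    then show False using \<open>a = b\<close> ab(2) by simp
  qed
  moreover have "(a - b) * g r = (a - b) * (g mat_one * f r)"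
    using eq[OF r] eq[OF one(2)] one(1) by (simp only: mult.assoc[symmetric]) simp
  ultimately show ?thesis by simp
qed

text \<open>The choices \<open>c = 1\<close> and \<open>c = \<i>\<close> show that the sum and the
  difference of the far functions of \<open>p\<close> and \<open>inv p\<close> are multiples of
  \<open>f\<close>. At \<open>mat_one\<close> the copy need not be moved at all, which identifies
  the factor.\<close>

lemma far_eq_mult:
  assumes f: "indecomposable_character R_inf f" and p: "permutation p" and r: "r \<in> R_inf"
  shows "far f p r = f (perm_matrix p) * f r"
proof -
  have f1: "f mat_one = 1" and ind: "indecomposable_on R_inf f"
    using f by (auto simp: indecomposable_character_def)
  interpret R_inf_character f using f by unfold_locales (auto simp: indecomposable_character_def)
  have K: "c * far f p s + cnj c * far f (inv p) s
      = (c * far f p mat_one + cnj c * far f (inv p) mat_one) * f s" if c: "cmod c = 1" and s: "s \<in> R_inf" for c s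
  proof -
    have "far_part c p s = far_part c p mat_one * f s"
      by (rule indecomposable_proportional[OF ind f1 mat_one_in_R_inf
            far_part_central[OF p] far_part_positive_definite[OF p c] far_part_central[OF p, of "- c"]
            far_part_positive_definite[OF p, of "- c"] _ s])
        (use c in \<open>auto simp: far_part_def field_simps\<close>)
    then have "4 * (c * far f p s + cnj c * far f (inv p) s)
        = 4 * ((c * far f p mat_one + cnj c * far f (inv p) mat_one) * f s)"
      using f1 by (simp add: far_part_def field_simps)
    then show ?thesis by (rule mult_left_cancel[THEN iffD1, rotated]) simp
  qed
  have "far f p s = far f p mat_one * f s" if "s \<in> R_inf" for s
  proof -
    have "far f p s + far f (inv p) s = (far f p mat_one + far f (inv p) mat_one) * f s"
      using K[of 1 s] that by simp
    moreover have "\<i> * (far f p s - far f (inv p) s) = \<i> * ((far f p mat_one - far f (inv p) mat_one) * f s)"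
      using K[of \<i> s] that by (simp add: algebra_simps)
    then have "far f p s - far f (inv p) s = (far f p mat_one - far f (inv p) mat_one) * f s" by simp
    ultimately have "2 * far f p s = 2 * (far f p mat_one * f s)" by (simp add: algebra_simps) algebra
    then show ?thesis by simp
  qed
  moreover have "far f p mat_one = f (perm_matrix p)"
  proof -
    have "far f p mat_one = f (mat_one \<odot> perm_matrix (shift_perm 0 p))"
    proof (rule far_eq[OF mat_one_in_R_inf p, symmetric])
      show "support_bound mat_one \<le> 0" unfolding support_bound_def by (rule Least_le) (simp add: mat_one_def)
    qed
    then show ?thesis using mat_mult_one(2)[OF perm_matrix_in_R_inf[OF p]] by simp
  qed
  ultimately show ?thesis using r by simp
qed

section \<open>Restriction to the finitary symmetric group\<close>

lemma central_on_subset: "central_on G f \<Longrightarrow> H \<subseteq> G \<Longrightarrow> central_on H f"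
  unfolding central_on_def by blast

lemma positive_definite_on_subset: "positive_definite_on G f \<Longrightarrow> H \<subseteq> G \<Longrightarrow> positive_definite_on H f"
  unfolding positive_definite_on_def by blast

text \<open>The permutation \<open>p\<close> is moved away by a conjugation that fixes
  \<open>B\<close> pointwise and hence commutes with \<open>q\<close>. The value at the product
  thereby becomes a far value at the matrix of \<open>q\<close>.\<close>

lemma multiplicative_character_restrict:
  assumes f: "indecomposable_character R_inf f"
  shows "multiplicative_character (\<lambda>p. f (perm_matrix p))"
proof -
  have c: "central_on R_inf f" "positive_definite_on R_inf f" "f mat_one = 1"
    using f by (auto simp: indecomposable_character_def)
  interpret R: R_inf_character f using c by unfold_locales
  interpret positive_class_function "\<lambda>p. f (perm_matrix p)"
    by (rule positive_class_function_restrict[OF central_on_subset[OF c(1) S_inf_subset_R_inf]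
          positive_definite_on_subset[OF c(2) S_inf_subset_R_inf]])
  show ?thesis
  proof
    show "f (perm_matrix id) = 1" using c by (simp add: perm_matrix_id)
    fix p q :: "nat \<Rightarrow> nat" and A B :: "nat set"
    assume p: "p permutes A" and q: "q permutes B" and fin: "finite A" "finite B" and disj: "A \<inter> B = {}"
    have pp: "permutation p" and pq: "permutation q"
      using p q fin unfolding permutation_permutes by blast+
    obtain b where b: "\<And>x. x \<in> B \<Longrightarrow> x < b" using fin(2) finite_nat_set_iff_bounded by auto
    let ?Q = "perm_matrix q"
    have Q: "?Q \<in> R_inf" by (rule perm_matrix_in_R_inf[OF pq])
    define n where "n = max b (support_bound ?Q)"
    have "inj_on (\<lambda>x. x + n) A" by (simp add: inj_on_def)
    moreover have "shift_perm n p (x + n) = p x + n" for x by (simp add: shift_perm_def)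
    ultimately obtain \<tau> where t: "\<tau> permutes (A \<union> (\<lambda>x. x + n) ` A)" "\<tau> \<circ> p \<circ> inv \<tau> = shift_perm n p"
      using conjugate_transport[OF p fin(1) _ shift_permutes[OF p]] by metis
    have pt: "permutation \<tau>" unfolding permutation_permutes
      by (rule exI, rule conjI[OF _ t(1)]) (use fin in simp)
    have tfix: "\<tau> x = x" if "x \<in> B" for x
      using that disj b[OF that] by (intro permutes_not_in[OF t(1)]) (auto simp: n_def)
    have tq: "\<tau> \<circ> q = q \<circ> \<tau>"
    proof
      fix x
      show "(\<tau> \<circ> q) x = (q \<circ> \<tau>) x"
      proof (cases "x \<in> B")
        case True
        then show ?thesis using tfix[of x] tfix[of "q x"] permutes_in_image[OF q] by simp
      next
        case False
        have "\<tau> x \<notin> B"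
        proof
          assume "\<tau> x \<in> B"
          then have "\<tau> (\<tau> x) = \<tau> x" by (rule tfix)
          then have "\<tau> x = x" using permutes_inj[OF t(1)] by (metis injD)
          then show False using False \<open>\<tau> x \<in> B\<close> by simp
        qed
        then show ?thesis using False permutes_not_in[OF q] by simp
      qed
    qed
    have "\<tau> \<circ> (p \<circ> q) \<circ> inv \<tau> = shift_perm n p \<circ> q"
    proof
      fix x
      have "q (inv \<tau> x) = inv \<tau> (q x)"
        using fun_cong[OF tq, of "inv \<tau> x"] permutes_inverses[OF t(1)] by (metis comp_apply)
      then show "(\<tau> \<circ> (p \<circ> q) \<circ> inv \<tau>) x = (shift_perm n p \<circ> q) x"
        unfolding t(2)[symmetric] by simp
    qed
    then have "f (perm_matrix (p \<circ> q)) = f (perm_matrix (shift_perm n p \<circ> q))"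
      using conjugate[OF permutation_compose[OF pp pq] pt] by simp
    also have "\<dots> = f (perm_matrix (q \<circ> shift_perm n p))"
      using pp pq by (intro central permutation_shift)
    also have "\<dots> = f (?Q \<odot> perm_matrix (shift_perm n p))"
      by (simp add: perm_matrix_compose[OF pq])
    also have "\<dots> = far f p ?Q"
      by (rule R.far_eq[OF Q pp]) (simp add: n_def)
    also have "\<dots> = f (perm_matrix p) * f ?Q" by (rule far_eq_mult[OF f pp Q])
    finally show "f (perm_matrix (p \<circ> q)) = f (perm_matrix p) * f ?Q" .
  qed
qed

text \<open>By extremality both summands are multiples of \<open>f\<close>, with their values at
  \<open>mat_one\<close> as factors, so these values yield a linear relation. Independence would
  make both vanish, against \<open>f mat_one = 1\<close>.\<close>

lemma indecomposable_restrict: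
  assumes f: "multiplicative_character (\<lambda>p. f (perm_matrix p))"
  shows "indecomposable_on S_inf f"
  unfolding indecomposable_on_def
proof (rule notI, elim exE conjE)
  fix g h assume g: "central_on S_inf g" "positive_definite_on S_inf g"
    and h: "central_on S_inf h" "positive_definite_on S_inf h"
    and li: "linearly_independent_on S_inf g h" and fgh: "\<forall>r\<in>S_inf. f r = g r + h r"
  interpret multiplicative_character "\<lambda>p. f (perm_matrix p)" by (rule f)
  have "g r = g mat_one * f r \<and> h r = h mat_one * f r" if r: "r \<in> S_inf" for r
  proof -
    obtain p where p: "permutation p" "r = perm_matrix p" using r by (auto simp: S_inf_permutation)
    have "f (perm_matrix p) = g (perm_matrix p) + h (perm_matrix p)" if "permutation p" for p
      using fgh perm_matrix_in_S_inf[OF that] by blast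
    then show ?thesis
      using multiplicative_character_extremal[OF f positive_class_function_restrict[OF g] positive_class_function_restrict[OF h] _ p(1)]
        multiplicative_character_extremal[OF f positive_class_function_restrict[OF h] positive_class_function_restrict[OF g] _ p(1)]
      by (simp add: p(2) perm_matrix_id add.commute)
  qed
  then have "\<forall>r\<in>S_inf. h mat_one * g r + (- g mat_one) * h r = 0" by (metis (no_types, opaque_lifting) add.right_inverse mult.left_commute mult_minus_left)
  then have "h mat_one = 0" "- g mat_one = 0" using li unfolding linearly_independent_on_def by blast+
  then have "f mat_one = 0" using fgh mat_one_in_S_inf by simp
  then show False using one by (simp add: perm_matrix_id)
qed

text \<open>The induction carries along the permutation behind the partial product, because
  multiplicativity needs its support to be disjoint from the next cycle.\<close>

lemma foldr_cycle_matrix: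
  assumes f: "multiplicative_character (\<lambda>p. f (perm_matrix p))" and cs: "distinct (concat cs)"
  shows "\<exists>p. p permutes set (concat cs) \<and> foldr (\<odot>) (map cycle_matrix cs) mat_one = perm_matrix p \<and>
    f (perm_matrix p) = (\<Prod>c\<leftarrow>cs. f (cycle_matrix c))"
  using cs
proof (induction cs)
  case Nil
  interpret multiplicative_character "\<lambda>p. f (perm_matrix p)" by (rule f)
  have "f mat_one = 1" using one by (simp add: perm_matrix_id)
  then show ?case by (intro exI[of _ id] conjI permutes_id, unfold perm_matrix_id) simp_all
next
  case (Cons c cs)
  interpret multiplicative_character "\<lambda>p. f (perm_matrix p)" by (rule f)
  obtain p where p: "p permutes set (concat cs)" "foldr (\<odot>) (map cycle_matrix cs) mat_one = perm_matrix p"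
    "f (perm_matrix p) = (\<Prod>c\<leftarrow>cs. f (cycle_matrix c))"
    using Cons by auto
  let ?q = "cycle_of_list c"
  have "f (perm_matrix (?q \<circ> p)) = f (perm_matrix ?q) * f (perm_matrix p)"
    by (rule mult[OF cycle_permutes p(1)]) (use Cons.prems in auto)
  then have "f (perm_matrix (?q \<circ> p)) = (\<Prod>c\<leftarrow>c # cs. f (cycle_matrix c))"
    using p(3) by (simp add: cycle_matrix_def)
  moreover have "perm_matrix (?q \<circ> p) = cycle_matrix c \<odot> perm_matrix p"
    unfolding cycle_matrix_def by (rule perm_matrix_compose[OF permutation_of_cycle])
  then have "foldr (\<odot>) (map cycle_matrix (c # cs)) mat_one = perm_matrix (?q \<circ> p)"
    using p(2) by simp
  moreover have "(?q \<circ> p) permutes set (concat (c # cs))"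
    by (rule permutes_compose[OF permutes_subset[OF p(1)] permutes_subset[OF cycle_permutes]]) auto
  ultimately show ?case by blast
qed

theorem proposition7:
  fixes f :: "inf_matrix \<Rightarrow> complex"
  assumes "indecomposable_character R_inf f"
  shows "indecomposable_character S_inf f \<and>
    (\<exists>!(\<alpha>, \<beta>). thoma_parameters \<alpha> \<beta> \<and>
      (\<forall>s\<in>S_inf. \<forall>cs. cycle_decomposition cs s \<longrightarrow>
        (\<forall>c\<in>set cs. f (cycle_matrix c) =
            of_real (\<Sum>i. \<alpha> i ^ length c)
            + (-1) ^ (length c - 1) * of_real (\<Sum>i. \<beta> i ^ length c)) \<and>
        f s = (\<Prod>c\<leftarrow>cs. f (cycle_matrix c))))"
proof
  have m: "multiplicative_character (\<lambda>p. f (perm_matrix p))"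
    by (rule multiplicative_character_restrict[OF assms])
  interpret multiplicative_character "\<lambda>p. f (perm_matrix p)" by (rule m)
  show "indecomposable_character S_inf f"
    using assms indecomposable_restrict[OF m] S_inf_subset_R_inf
    unfolding indecomposable_character_def
    by (blast intro: central_on_subset positive_definite_on_subset)
  let ?Q = "\<lambda>\<alpha> \<beta>. thoma_parameters \<alpha> \<beta> \<and>
      (\<forall>s\<in>S_inf. \<forall>cs. cycle_decomposition cs s \<longrightarrow>
        (\<forall>c\<in>set cs. f (cycle_matrix c) =
            of_real (\<Sum>i. \<alpha> i ^ length c)
            + (-1) ^ (length c - 1) * of_real (\<Sum>i. \<beta> i ^ length c)) \<and>
        f s = (\<Prod>c\<leftarrow>cs. f (cycle_matrix c)))"
  have cast: "of_real (\<Sum>i. \<alpha> i ^ l) + (-1) ^ (l - 1) * of_real (\<Sum>i. \<beta> i ^ l)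
      = (of_real ((\<Sum>i. \<alpha> i ^ l) + (-1) ^ (l - 1) * (\<Sum>i. \<beta> i ^ l)) :: complex)" for \<alpha> \<beta> :: "nat \<Rightarrow> real" and l
    by simp
  obtain \<alpha> \<beta> where t: "thoma_parameters \<alpha> \<beta>"
    "\<And>l. 1 < l \<Longrightarrow> cyc l = (\<Sum>i. \<alpha> i ^ l) + (-1) ^ (l - 1) * (\<Sum>i. \<beta> i ^ l)"
    using thoma_parameters_exist by blast
  have cyc_value: "f (cycle_matrix c) = of_real (cyc (length c))" if "distinct c" for c
    using cycle_eq_cyc[OF that] by (simp add: cycle_matrix_def)
  have Q: "?Q \<alpha> \<beta>"
  proof (intro conjI ballI allI impI t(1))
    fix s cs c assume "cycle_decomposition cs s" "c \<in> set cs"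
    then have "1 < length c" "distinct c"
      unfolding cycle_decomposition_def using distinct_concat_iff[of cs] by auto
    then show "f (cycle_matrix c) = of_real (\<Sum>i. \<alpha> i ^ length c) + (-1) ^ (length c - 1) * of_real (\<Sum>i. \<beta> i ^ length c)"
      unfolding cast using cyc_value t(2) by simp
  next
    fix s cs assume "cycle_decomposition cs s"
    then show "f s = (\<Prod>c\<leftarrow>cs. f (cycle_matrix c))"
      using foldr_cycle_matrix[of f cs] m unfolding cycle_decomposition_def by auto
  qed
  \<comment> \<open>Uniqueness needs the formula at every length; the single cycle
    \<open>[0..<l]\<close>, which is its own decomposition, provides it.\<close>
  have cyc_formula: "cyc l = (\<Sum>i. \<alpha>' i ^ l) + (-1) ^ (l - 1) * (\<Sum>i. \<beta>' i ^ l)" if Q': "?Q \<alpha>' \<beta>'" and l: "1 < l" for \<alpha>' \<beta>' l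
  proof -
    let ?c = "[0..<l]"
    have "cycle_matrix ?c \<in> S_inf"
      unfolding cycle_matrix_def by (rule perm_matrix_in_S_inf[OF permutation_of_cycle])
    moreover have "cycle_decomposition [?c] (cycle_matrix ?c)"
      using l mat_mult_one(1)[OF perm_matrix_in_R_inf[OF permutation_of_cycle]]
      by (simp add: cycle_decomposition_def cycle_matrix_def)
    ultimately have "f (cycle_matrix ?c) = of_real (\<Sum>i. \<alpha>' i ^ l) + (-1) ^ (l - 1) * of_real (\<Sum>i. \<beta>' i ^ l)"
      using Q' by fastforce
    then have "(of_real (cyc l) :: complex) = of_real ((\<Sum>i. \<alpha>' i ^ l) + (-1) ^ (l - 1) * (\<Sum>i. \<beta>' i ^ l))"
      unfolding cast using cyc_value[of ?c] by simp
    then show ?thesis by (simp only: of_real_eq_iff)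
  qed
  have uniq: "\<alpha>' = \<alpha> \<and> \<beta>' = \<beta>" if Q': "?Q \<alpha>' \<beta>'" for \<alpha>' \<beta>'
    using thoma_parameters_unique[OF conjunct1[OF Q'] t(1)] cyc_formula[OF Q'] t(2) by simp
  show "\<exists>!(\<alpha>, \<beta>). ?Q \<alpha> \<beta>"
  proof (rule ex1I[of _ "(\<alpha>, \<beta>)"])
    show "case (\<alpha>, \<beta>) of (\<alpha>, \<beta>) \<Rightarrow> ?Q \<alpha> \<beta>" unfolding prod.case by (rule Q)
  next
    fix x assume "case x of (\<alpha>, \<beta>) \<Rightarrow> ?Q \<alpha> \<beta>"
    then show "x = (\<alpha>, \<beta>)" using uniq by (cases x) (simp only: prod.case)
  qed
qed

end
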